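(* Assume the setting described in the context ($\xi$ integer-valued, in the domain of attraction of the normal law, $\alpha=2$, with normalising sequence $(a_n)$ and $b_n=n\mu$), and assume that $(S_n)_{n\ge0}$ is aperiodic. If $(x_n)_{n\ge1}$ is a sequence of integers such that $x_n\ge a_n$ and $\lim_{n\to\infty}\frac{x_n}{n}=0$, then with $r_n=r(n/x_n)$ we have, as $n\to\infty$, $$\mathbb P\big(S_n-\lfloor b_n\rfloor=x_n,\ M_n\le r_n\big)\sim\frac{1}{\sqrt{2\pi n\,\sigma^2(r_n)}}\,e^{-nH(x_n/n)} .$$
   Context: $\xi$ is an integer-valued random variable, $\xi_1,\xi_2,\dots$ are i.i.d. copies, $S_n=\sum_{i=1}^n\xi_i$, $M_n=\max\{\xi_1,\dots,\xi_n\}$. Aperiodic means that the law of $\xi$ has maximal span $1$, i.e. it is not supported in any $a+h\mathbb Z$ with integer $h\ge2$. Setting "$\alpha=2$": $\mathbb E|\xi|<\infty$, $\mu=\mathbb E[\xi]$, and the truncated variance $\sigma^2(x)=\mathbb E[(\xi-\mu)^2\mathbf 1_{\{|\xi-\mu|\le x\}}]$ is slowly varying as $x\to\infty$ (the variance may be finite or infinite). $(a_n)$ is a positive sequence, $a_n\to\infty$, with $\sigma^2(a_n)a_n^{-2}\sim n^{-1}$; $b_n=n\mu$. Threshold: fix a function $r:(0,\infty)\to\mathbb R_+$ with $r(t)\to\infty$ and $\frac{r(t)}{\sigma^2(r(t))}\sim t$ as $t\to\infty$; put $r_n=r(n/x_n)$. Thus if $x_n/n\to0$ then $r_n\to\infty$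 and $\frac{r_n}{\sigma^2(r_n)}\sim\frac{n}{x_n}$. Entropy: for fixed $n$ and $u\ge0$ let $M(u)=\mathbb E[e^{u(\xi-\mu)}\mathbf 1_{\{\xi\le r_n\}}]$ and $m(u)=M'(u)/M(u)$, which is strictly increasing for $n$ large; let $\lambda(t)=m^{-1}(t)$ be its inverse function (defined for $t\ge m(0)$ in the range of $m$, which contains $x_n/n$ for $n$ large), and $H(t)=-\log M(\lambda(t))+t\lambda(t)$. ($M,m,\lambda,H$ depend on $n$ through $r_n$.) *)

theory Defs
  imports "HOL-Probability.Probability" "HOL-Library.Landau_Symbols"
begin

text \<open>Measurability, usually part of the notion, is omitted: the only use below is for a truncated
  variance, which is nondecreasing and hence Borel.\<close>

definition slowly_varying :: "(real \<Rightarrow> real) \<Rightarrow> bool" where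
  "slowly_varying L \<longleftrightarrow>
     (\<forall>\<^sub>F x in at_top. L x > 0) \<and> (\<forall>c>0. ((\<lambda>x. L (c * x) / L x) \<longlongrightarrow> 1) at_top)"

definition aperiodic :: "'a measure \<Rightarrow> ('a \<Rightarrow> int) \<Rightarrow> bool" where
  "aperiodic \<Omega> \<xi> \<longleftrightarrow> (\<forall>a h :: int. h \<ge> 2 \<longrightarrow> \<not> (AE \<omega> in \<Omega>. \<exists>k :: int. \<xi> \<omega> = a + h * k))"

definition mean :: "'a measure \<Rightarrow> ('a \<Rightarrow> int) \<Rightarrow> real" where
  "mean \<Omega> \<xi> = (\<integral>\<omega>. real_of_int (\<xi> \<omega>) \<partial>\<Omega>)"

definition trunc_var :: "'a measure \<Rightarrow> ('a \<Rightarrow> int) \<Rightarrow> real \<Rightarrow> real" where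
  "trunc_var \<Omega> \<xi> x =
     (\<integral>\<omega>. (real_of_int (\<xi> \<omega>) - mean \<Omega> \<xi>)\<^sup>2 *
          indicator {\<omega>. \<bar>real_of_int (\<xi> \<omega>) - mean \<Omega> \<xi>\<bar> \<le> x} \<omega> \<partial>\<Omega>)"

definition partial_sum :: "(nat \<Rightarrow> 'a \<Rightarrow> int) \<Rightarrow> nat \<Rightarrow> 'a \<Rightarrow> int" where
  "partial_sum X n \<omega> = (\<Sum>i=1..n. X i \<omega>)"

text \<open>Only meaningful for \<open>n \<ge> 1\<close>.\<close>

definition running_max :: "(nat \<Rightarrow> 'a \<Rightarrow> int) \<Rightarrow> nat \<Rightarrow> 'a \<Rightarrow> int" where
  "running_max X n \<omega> = Max ((\<lambda>i. X i \<omega>) ` {1..n})"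

text \<open>The functions \<open>M\<close>, \<open>m\<close>, \<open>\<lambda>\<close> and \<open>H\<close>, for the truncation level \<open>\<rho>\<close>.\<close>

definition trunc_mgf :: "'a measure \<Rightarrow> ('a \<Rightarrow> int) \<Rightarrow> real \<Rightarrow> real \<Rightarrow> real" where
  "trunc_mgf \<Omega> \<xi> \<rho> u =
     (\<integral>\<omega>. exp (u * (real_of_int (\<xi> \<omega>) - mean \<Omega> \<xi>)) *
          indicator {\<omega>. real_of_int (\<xi> \<omega>) \<le> \<rho>} \<omega> \<partial>\<Omega>)"

text \<open>The derivative is taken within \<open>[0, \<infinity>)\<close>, so it is one-sided at \<open>0\<close>: for \<open>u < 0\<close> the integrand
  of \<open>M(u)\<close> need not be integrable.\<close>

definition tilted_mean :: "'a measure \<Rightarrow> ('a \<Rightarrow> int) \<Rightarrow> real \<Rightarrow> real \<Rightarrow> real" where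
  "tilted_mean \<Omega> \<xi> \<rho> u =
     vector_derivative (trunc_mgf \<Omega> \<xi> \<rho>) (at u within {0..}) / trunc_mgf \<Omega> \<xi> \<rho> u"

definition tilt :: "'a measure \<Rightarrow> ('a \<Rightarrow> int) \<Rightarrow> real \<Rightarrow> real \<Rightarrow> real" where
  "tilt \<Omega> \<xi> \<rho> t = the_inv_into {0..} (tilted_mean \<Omega> \<xi> \<rho>) t"

definition entropy :: "'a measure \<Rightarrow> ('a \<Rightarrow> int) \<Rightarrow> real \<Rightarrow> real \<Rightarrow> real" where
  "entropy \<Omega> \<xi> \<rho> t = - ln (trunc_mgf \<Omega> \<xi> \<rho> (tilt \<Omega> \<xi> \<rho> t)) + t * tilt \<Omega> \<xi> \<rho> t"

end

theory Submission
  imports Defs "HOL-Real_Asymp.Real_Asymp"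
begin

text \<open>Put \<open>Y = \<xi> - \<mu>\<close> and \<open>R = r\<^sub>n - \<mu>\<close>, and tilt the law of \<open>Y\<close> restricted to \<open>Y \<le> R\<close> by
  \<open>exp (l * Y)\<close>, with \<open>l\<close> chosen so that the tilted mean is \<open>x\<^sub>n / n\<close>. By Karamata's theorem
  the jumps of size at least \<open>\<epsilon> * R\<close> are negligible for second moments, so that \<open>l * R\<close> stays bounded away
  from \<open>0\<close> and infinity and the tilted variance is asymptotic to \<open>\<sigma>\<^sup>2(r\<^sub>n)\<close>. Since \<open>x\<^sub>n \<ge> a\<^sub>n\<close> forces
  \<open>r\<^sub>n\<close> to be at most of the order of the standard deviation of the tilted sum, the tilted sums
  satisfy a Lindeberg condition and hence a central limit theorem. Aperiodicity and Potter's bound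
  dominate their characteristic functions, and Fourier inversion turns this into a local limit theorem at
  the mean of the tilted sum; undoing the tilting produces the factor \<open>exp (- n * H(x\<^sub>n / n))\<close>.\<close>

section \<open>Truncated moments\<close>

text \<open>The obstacle is that \<open>Y\<close> may have infinite variance while the truncation
  acts on the right only. What makes the tilted second moment finite is the tilt itself:
  \<open>z * exp z\<close> is bounded for \<open>z \<le> C\<close>, so
  \<open>Y^2 * exp (l * Y)\<close> is at most a constant times \<open>\<bar>Y\<bar> / l\<close>
  wherever \<open>l * Y \<le> C\<close>. With \<open>l\<close> of order \<open>1 / R\<close>, the
  jumps beyond \<open>\<epsilon> * R\<close> on either side then cost \<open>R\<close> times a tail
  of the first absolute moment, which is the quantity that Karamata's theorem compares with
  \<open>\<sigma>^2(R)\<close>. The order of \<open>l\<close> comes from the defining relation of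
  \<open>r\<close>: the tilted mean at \<open>c / R\<close> is asymptotic to
  \<open>c * \<sigma>^2(R) / R\<close>, and \<open>x_n / n\<close> is asymptotic to
  \<open>\<sigma>^2(R) / R\<close>, so that \<open>l * R\<close> tends to 1; the bounds 1/2 and 2
  leave room around this limit. The tilted law changes with \<open>n\<close>, so a local limit
  theorem for one fixed law does not apply, and the integrable majorant of the characteristic
  functions must be uniform in \<open>n\<close>. The floor in the event displaces the lattice point
  from the tilted mean by less than 1, which is negligible against the standard deviation and, as
  \<open>l\<close> tends to 0, in the exponent too.\<close>

locale slowly_varying_variance = prob_space M for M :: "'a measure" +
  fixes Y :: "'a \<Rightarrow> real"
  assumes Y_measurable [measurable]: "Y \<in> borel_measurable M"
    and Y_integrable: "integrable M Y"
    and Y_centred: "expectation Y = 0"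
    and slowly_varying: "slowly_varying (\<lambda>y. \<integral>\<omega>. (Y \<omega>)\<^sup>2 * indicator {\<omega>. \<bar>Y \<omega>\<bar> \<le> y} \<omega> \<partial>M)"
begin

definition V :: "real \<Rightarrow> real" where
  "V y = (\<integral>\<omega>. (Y \<omega>)\<^sup>2 * indicator {\<omega>. \<bar>Y \<omega>\<bar> \<le> y} \<omega> \<partial>M)"

definition T :: "real \<Rightarrow> real" where
  "T y = (\<integral>\<omega>. \<bar>Y \<omega>\<bar> * indicator {\<omega>. y < \<bar>Y \<omega>\<bar>} \<omega> \<partial>M)"

lemma V_integrable: "integrable M (\<lambda>\<omega>. (Y \<omega>)\<^sup>2 * indicator {\<omega>. \<bar>Y \<omega>\<bar> \<le> y} \<omega>)"
  by (rule integrable_const_bound[where B = "y\<^sup>2"])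
     (auto split: split_indicator simp: abs_le_square_iff[symmetric])

lemma T_integrable: "integrable M (\<lambda>\<omega>. \<bar>Y \<omega>\<bar> * indicator {\<omega>. y < \<bar>Y \<omega>\<bar>} \<omega>)"
  by (rule Bochner_Integration.integrable_bound[OF Y_integrable])
     (auto split: split_indicator)

lemma V_mono: "y \<le> z \<Longrightarrow> V y \<le> V z"
  unfolding V_def by (intro integral_mono V_integrable) (auto split: split_indicator)

lemma V_nonneg: "0 \<le> V y"
  unfolding V_def by (intro Bochner_Integration.integral_nonneg) simp

lemma T_nonneg: "0 \<le> T y"
  unfolding T_def by (intro Bochner_Integration.integral_nonneg) simp

text \<open>Linear growth is crude, but it is what later bounds the standard deviation of the tilted
  sum by a multiple of \<open>n\<close>.\<close>

lemma V_le: assumes "0 \<le> y" shows "V y \<le> y * expectation (\<lambda>\<omega>. \<bar>Y \<omega>\<bar>)"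
proof -
  have "V y \<le> (\<integral>\<omega>. y * \<bar>Y \<omega>\<bar> \<partial>M)"
    unfolding V_def
  proof (intro integral_mono V_integrable integrable_mult_right integrable_abs Y_integrable)
    fix \<omega>
    show "(Y \<omega>)\<^sup>2 * indicator {\<omega>. \<bar>Y \<omega>\<bar> \<le> y} \<omega> \<le> y * \<bar>Y \<omega>\<bar>"
      using assms mult_right_mono[of "\<bar>Y \<omega>\<bar>" y "\<bar>Y \<omega>\<bar>"]
      by (auto split: split_indicator simp: power2_eq_square)
  qed
  then show ?thesis by simp
qed

lemma V_eventually_pos: "\<forall>\<^sub>F y in at_top. 0 < V y"
  using slowly_varying unfolding slowly_varying_def V_def by blast

lemma V_ratio: "c > 0 \<Longrightarrow> ((\<lambda>y. V (c * y) / V y) \<longlongrightarrow> 1) at_top"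
  using slowly_varying unfolding slowly_varying_def V_def by blast

lemma T_tendsto: "(T \<longlongrightarrow> 0) at_top"
proof -
  have "((\<lambda>y. \<integral>\<omega>. \<bar>Y \<omega>\<bar> * indicator {\<omega>. y < \<bar>Y \<omega>\<bar>} \<omega> \<partial>M) \<longlongrightarrow> (\<integral>\<omega>. 0 \<partial>M)) at_top"
  proof (rule integral_dominated_convergence_at_top[where w = "\<lambda>\<omega>. \<bar>Y \<omega>\<bar>"])
    show "AE \<omega> in M. ((\<lambda>y. \<bar>Y \<omega>\<bar> * indicator {\<omega>. y < \<bar>Y \<omega>\<bar>} \<omega>) \<longlongrightarrow> 0) at_top"
    proof (rule AE_I2)
      fix \<omega>
      have "\<forall>\<^sub>F y in at_top. \<bar>Y \<omega>\<bar> * indicator {\<omega>. y < \<bar>Y \<omega>\<bar>} \<omega> = 0"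
        using eventually_ge_at_top[of "\<bar>Y \<omega>\<bar>"] by eventually_elim simp
      then show "((\<lambda>y. \<bar>Y \<omega>\<bar> * indicator {\<omega>. y < \<bar>Y \<omega>\<bar>} \<omega>) \<longlongrightarrow> 0) at_top"
        by (rule tendsto_eventually)
    qed
  qed (use Y_integrable in \<open>auto split: split_indicator\<close>)
  then show ?thesis by (simp add: T_def[abs_def])
qed

text \<open>On \<open>y < \<bar>Y\<bar> \<le> 2 * y\<close> one has
  \<open>\<bar>Y\<bar> \<le> Y^2 / y\<close>, so this block costs the increment of \<open>V\<close>
  over one doubling, which slow variation makes small compared with \<open>V y\<close>.\<close>

lemma T_doubling: assumes "0 < y" shows "T y \<le> (V (2 * y) - V y) / y + T (2 * y)"
proof -
  have "T y \<le> (\<integral>\<omega>. ((Y \<omega>)\<^sup>2 * indicator {\<omega>. \<bar>Y \<omega>\<bar> \<le> 2 * y} \<omega>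
      - (Y \<omega>)\<^sup>2 * indicator {\<omega>. \<bar>Y \<omega>\<bar> \<le> y} \<omega>) / y + \<bar>Y \<omega>\<bar> * indicator {\<omega>. 2 * y < \<bar>Y \<omega>\<bar>} \<omega> \<partial>M)"
    unfolding T_def
  proof (intro integral_mono T_integrable Bochner_Integration.integrable_add integrable_divide
      Bochner_Integration.integrable_diff V_integrable)
    fix \<omega>
    have "\<bar>Y \<omega>\<bar> \<le> (Y \<omega>)\<^sup>2 / y" if "y < \<bar>Y \<omega>\<bar>"
      using that assms mult_left_mono[of y "\<bar>Y \<omega>\<bar>" "\<bar>Y \<omega>\<bar>"]
      by (simp add: field_simps power2_eq_square)
    then show "\<bar>Y \<omega>\<bar> * indicator {\<omega>. y < \<bar>Y \<omega>\<bar>} \<omega> \<le> ((Y \<omega>)\<^sup>2 * indicator {\<omega>. \<bar>Y \<omega>\<bar> \<le> 2 * y} \<omega>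
      - (Y \<omega>)\<^sup>2 * indicator {\<omega>. \<bar>Y \<omega>\<bar> \<le> y} \<omega>) / y + \<bar>Y \<omega>\<bar> * indicator {\<omega>. 2 * y < \<bar>Y \<omega>\<bar>} \<omega>"
      using assms by (auto split: split_indicator)
  qed
  also have "\<dots> = (V (2 * y) - V y) / y + T (2 * y)"
    unfolding V_def T_def by (simp add: V_integrable T_integrable)
  finally show ?thesis .
qed

lemma real_two_power_at_top: "filterlim (\<lambda>N. 2 ^ N :: real) at_top sequentially"
  by real_asymp

text \<open>Karamata's theorem: sum \<open>T_doubling\<close> over dyadic blocks.\<close>

lemma T_negligible: "((\<lambda>y. y * T y / V y) \<longlongrightarrow> 0) at_top"
proof (rule tendstoI)
  fix e :: real assume e: "e > 0"
  define d where "d = min (1/2) (e / 8)"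
  have d: "0 < d" "d \<le> 1/2" "4 * d < e" using e by (auto simp: d_def min_def)
  have "\<forall>\<^sub>F y in at_top. V (2 * y) / V y < 1 + d"
    using V_ratio[of 2] d by (intro order_tendstoD) auto
  then have "\<forall>\<^sub>F y in at_top. 0 < y \<and> 0 < V y \<and> V (2 * y) \<le> (1 + d) * V y"
    using V_eventually_pos eventually_gt_at_top[of 0]
    by eventually_elim (auto simp: field_simps)
  then obtain z where z: "\<And>y. z \<le> y \<Longrightarrow> 0 < y \<and> 0 < V y \<and> V (2 * y) \<le> (1 + d) * V y"
    by (auto simp: eventually_at_top_linorder)
  \<comment> \<open>The constant 4 closes the induction: in units of \<open>V y / y\<close> one step
    gives \<open>d + 4 * d * (1 + d) / 2 = d * (3 + 2 * d)\<close>, at most \<open>4 * d\<close>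
    because \<open>d \<le> 1/2\<close>. The halving by the doubled argument beats the growth
    \<open>1 + d\<close> of \<open>V\<close>.\<close>
  have step: "T y \<le> 4 * d * V y / y + T (2 ^ N * y)" if "z \<le> y" for N y
    using that
  proof (induction N arbitrary: y)
    case 0 then show ?case using z[of y] d by simp
  next
    case (Suc N)
    note zy = z[OF Suc.prems]
    have "T y \<le> (V (2 * y) - V y) / y + T (2 * y)" using zy T_doubling by blast
    also have "T (2 * y) \<le> 4 * d * V (2 * y) / (2 * y) + T (2 ^ N * (2 * y))"
      using Suc.prems zy by (intro Suc.IH) auto
    also have "(V (2 * y) - V y) / y \<le> d * V y / y"
      using zy by (intro divide_right_mono) (auto simp: algebra_simps)
    also have "4 * d * V (2 * y) / (2 * y) \<le> 4 * d * ((1 + d) * V y) / (2 * y)"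
      using zy d by (intro divide_right_mono mult_left_mono) auto
    also have "d * V y / y + (4 * d * ((1 + d) * V y) / (2 * y) + T (2 ^ N * (2 * y)))
       = (d * V y / y) * (3 + 2 * d) + T (2 ^ Suc N * y)"
      using zy by (simp add: field_simps)
    also have "\<dots> \<le> (d * V y / y) * 4 + T (2 ^ Suc N * y)"
      using zy d by (intro add_right_mono mult_left_mono) auto
    finally show ?case by (simp add: mult_ac)
  qed
  have le: "T y \<le> 4 * d * V y / y" if y: "z \<le> y" for y
  proof -
    have "filterlim (\<lambda>N. y * 2 ^ N) at_top sequentially"
      using z[OF y] by (intro filterlim_tendsto_pos_mult_at_top[OF tendsto_const]
          real_two_power_at_top) auto
    then have "(\<lambda>N. T (2 ^ N * y)) \<longlonglongrightarrow> 0"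
      using filterlim_compose[OF T_tendsto] by (simp add: mult.commute)
    then have "(\<lambda>N. 4 * d * V y / y + T (2 ^ N * y)) \<longlonglongrightarrow> 4 * d * V y / y + 0"
      by (intro tendsto_intros)
    then show ?thesis
      using step[OF y] by (intro LIMSEQ_le_const) auto
  qed
  show "\<forall>\<^sub>F y in at_top. dist (y * T y / V y) 0 < e"
    using eventually_ge_at_top[of z]
  proof eventually_elim
    case (elim y)
    note zy = z[OF elim]
    have "y * T y / V y \<le> 4 * d" using le[OF elim] zy by (simp add: field_simps)
    moreover have "0 \<le> y * T y / V y" using zy T_nonneg by simp
    ultimately show ?case using d by (simp add: dist_real_def)
  qed
qed

text \<open>Quadrupling the argument costs at most a factor 2, the square root of 4; the leading 2
  pays for the last incomplete step. An exponent below 1 is what matters, both for comparing the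
  truncation level with \<open>a n\<close> and for the decay of characteristic functions.\<close>

lemma V_potter:
  obtains y0 where "0 < y0" "0 < V y0" "\<And>y z. y0 \<le> y \<Longrightarrow> y \<le> z \<Longrightarrow> V z \<le> 2 * sqrt (z / y) * V y"
proof -
  have "\<forall>\<^sub>F y in at_top. V (4 * y) / V y < 2"
    using V_ratio[of 4] by (intro order_tendstoD) auto
  then have "\<forall>\<^sub>F y in at_top. 0 < y \<and> 0 < V y \<and> V (4 * y) \<le> 2 * V y"
    using V_eventually_pos eventually_gt_at_top[of 0]
    by eventually_elim (auto simp: field_simps)
  then obtain y0 where y0: "\<And>y. y0 \<le> y \<Longrightarrow> 0 < y \<and> 0 < V y \<and> V (4 * y) \<le> 2 * V y"
    by (auto simp: eventually_at_top_linorder)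
  have *: "V z \<le> 2 * sqrt (z / y) * V y" if "y0 \<le> y" "y \<le> z" "z \<le> 4 ^ k * y" for k y z
    using that
  proof (induction k arbitrary: y)
    case 0 then show ?case using y0[of y] by auto
  next
    case (Suc k)
    note zy = y0[OF Suc.prems(1)]
    show ?case
    proof (cases "z \<le> 4 * y")
      case True
      have "1 \<le> sqrt (z / y)" using Suc.prems zy by simp
      then have "2 * 1 * V y \<le> 2 * sqrt (z / y) * V y"
        using zy by (intro mult_right_mono mult_left_mono) auto
      then show ?thesis using V_mono[OF True] zy by linarith
    next
      case False
      have "V z \<le> 2 * sqrt (z / (4 * y)) * V (4 * y)"
        using False Suc.prems zy by (intro Suc.IH) auto
      also have "\<dots> \<le> 2 * sqrt (z / (4 * y)) * (2 * V y)"
        using zy False by (intro mult_left_mono) auto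
      also have "sqrt (z / (4 * y)) = sqrt (z / y) / 2"
        by (simp add: real_sqrt_divide real_sqrt_mult)
      finally show ?thesis by simp
    qed
  qed
  show ?thesis
  proof (rule that[of y0])
    fix y z assume yz: "y0 \<le> y" "y \<le> z"
    obtain k where "z / y < 4 ^ k" using real_arch_pow[of 4 "z / y"] by auto
    then have "z \<le> 4 ^ k * y" using y0[OF yz(1)] by (simp add: field_simps)
    then show "V z \<le> 2 * sqrt (z / y) * V y" using * yz by blast
  qed (use y0[of y0] in auto)
qed

text \<open>Karamata's theorem at the level \<open>\<epsilon> * R n\<close>, with
  \<open>V (\<epsilon> * R n)\<close> exchanged for \<open>V (R n)\<close> by slow variation. The
  estimates of large jumps reduce to it.\<close>

lemma tail_negligible:
  assumes R: "filterlim R at_top sequentially" and \<epsilon>: "\<epsilon> > 0"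
  shows "(\<lambda>n. R n * T (\<epsilon> * R n) / V (R n)) \<longlonglongrightarrow> 0"
proof -
  have eR: "filterlim (\<lambda>n. \<epsilon> * R n) at_top sequentially"
    using R \<epsilon> by (intro filterlim_tendsto_pos_mult_at_top[OF tendsto_const]) auto
  have "(\<lambda>n. inverse \<epsilon> * ((\<epsilon> * R n) * T (\<epsilon> * R n) / V (\<epsilon> * R n)) * (V (\<epsilon> * R n) / V (R n)))
       \<longlonglongrightarrow> inverse \<epsilon> * 0 * 1"
    by (intro tendsto_mult tendsto_const filterlim_compose[OF T_negligible eR]
        filterlim_compose[OF V_ratio[OF \<epsilon>] R])
  moreover have "\<forall>\<^sub>F n in sequentially. inverse \<epsilon> * ((\<epsilon> * R n) * T (\<epsilon> * R n) / V (\<epsilon> * R n))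
      * (V (\<epsilon> * R n) / V (R n)) = R n * T (\<epsilon> * R n) / V (R n)"
    using eventually_compose_filterlim[OF V_eventually_pos eR]
      eventually_compose_filterlim[OF V_eventually_pos R]
    by eventually_elim (use \<epsilon> in \<open>simp add: field_simps\<close>)
  ultimately show ?thesis by (auto elim: Lim_transform_eventually)
qed

text \<open>One factor \<open>y\<close> is absorbed into the bounded function \<open>z * h z\<close>
  at \<open>z = l * y\<close>, at the price \<open>1 / l\<close>; only a first moment remains. As
  \<open>y\<close> may be arbitrarily negative, this also controls the untruncated left
  tail.\<close>

lemma tilted_bound:
  fixes h :: "real \<Rightarrow> real"
  assumes "\<And>z. z \<le> C \<Longrightarrow> \<bar>z * h z\<bar> \<le> K" "0 < l" "l * R \<le> C" "y \<le> R"
  shows "\<bar>y\<^sup>2 * h (l * y)\<bar> \<le> K / l * \<bar>y\<bar>"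
proof -
  have "\<bar>(l * y) * h (l * y)\<bar> \<le> K"
    using assms mult_left_mono[of y R l] by (intro assms(1)) linarith
  then have "\<bar>y\<bar> * \<bar>(l * y) * h (l * y)\<bar> \<le> \<bar>y\<bar> * K" by (rule mult_left_mono) simp
  then show ?thesis using assms(2)
    by (simp add: field_simps power2_eq_square abs_mult)
qed

lemma tilted_integrable:
  fixes h :: "real \<Rightarrow> real"
  assumes [measurable]: "h \<in> borel_measurable borel"
    and "\<And>z. z \<le> C \<Longrightarrow> \<bar>z * h z\<bar> \<le> K" "0 < l" "l * R \<le> C"
  shows "integrable M (\<lambda>\<omega>. (Y \<omega>)\<^sup>2 * h (l * Y \<omega>) * indicator {\<omega>. Y \<omega> \<le> R} \<omega>)"
proof (rule Bochner_Integration.integrable_bound[where f = "\<lambda>\<omega>. K / l * \<bar>Y \<omega>\<bar>"])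
  have "0 \<le> K" using assms(2)[of C] by linarith
  then show "AE \<omega> in M. norm ((Y \<omega>)\<^sup>2 * h (l * Y \<omega>) * indicator {\<omega>. Y \<omega> \<le> R} \<omega>)
      \<le> norm (K / l * \<bar>Y \<omega>\<bar>)"
    using tilted_bound[OF assms(2-4)] assms(3) by (intro AE_I2) (auto split: split_indicator)
qed (use Y_integrable in \<open>simp_all del: times_divide_eq_left\<close>)

text \<open>Used with \<open>h z = exp z\<close> for the tilted variance and with \<open>h z = (exp z - 1) / z\<close> for the
  tilted mean.\<close>

lemma tilted_moment:
  fixes h :: "real \<Rightarrow> real"
  assumes h_meas [measurable]: "h \<in> borel_measurable borel"
    and h_cont: "isCont h 0" "h 0 = 1"
    and h_bound: "\<And>z. z \<le> C \<Longrightarrow> \<bar>z * h z\<bar> \<le> K"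
    and R: "filterlim R at_top sequentially"
    and D: "D > 0" and l: "\<forall>\<^sub>F n in sequentially. 1 / D \<le> l n * R n \<and> l n * R n \<le> C"
  shows "(\<lambda>n. (\<integral>\<omega>. (Y \<omega>)\<^sup>2 * h (l n * Y \<omega>) * indicator {\<omega>. Y \<omega> \<le> R n} \<omega> \<partial>M) / V (R n)) \<longlonglongrightarrow> 1"
proof (rule tendstoI)
  fix e :: real assume e: "e > 0"
  have C: "C > 0"
  proof -
    obtain n where "1 / D \<le> l n * R n \<and> l n * R n \<le> C"
      using eventually_happens[OF l] by auto
    then show ?thesis using D by (smt (verit) divide_pos_pos)
  qed
  have K: "K \<ge> 0" using h_bound[of C] by linarith
  obtain \<delta> where \<delta>: "\<delta> > 0" "\<And>z. \<bar>z\<bar> < \<delta> \<Longrightarrow> \<bar>h z - 1\<bar> < e / 2"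
    using h_cont e unfolding continuous_at_eps_delta
    by (metis dist_real_def half_gt_zero diff_zero dist_commute)
  \<comment> \<open>On \<open>\<bar>Y\<bar> \<le> \<epsilon> * r\<close> the argument
    \<open>u * Y\<close> is at most \<open>C * \<epsilon> < \<delta>\<close> in modulus, where
    \<open>h\<close> is within \<open>e / 2\<close> of 1; \<open>\<epsilon> \<le> 1\<close> keeps
    this zone inside \<open>\<bar>Y\<bar> \<le> r\<close>.\<close>
  define \<epsilon> where "\<epsilon> = min 1 (\<delta> / (2 * C))"
  have \<epsilon>: "0 < \<epsilon>" "\<epsilon> \<le> 1" "C * \<epsilon> < \<delta>"
    using \<delta>(1) C by (auto simp: \<epsilon>_def min_def field_simps)
  let ?g = "\<lambda>n. (1 - V (\<epsilon> * R n) / V (R n)) + K * D * (R n * T (\<epsilon> * R n) / V (R n))"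
  have "?g \<longlonglongrightarrow> (1 - 1) + K * D * 0"
    by (intro tendsto_intros tail_negligible[OF R \<epsilon>(1)] filterlim_compose[OF V_ratio[OF \<epsilon>(1)] R])
  then have "\<forall>\<^sub>F n in sequentially. ?g n < e / 2"
    using e by (intro order_tendstoD) auto
  then show "\<forall>\<^sub>F n in sequentially.
      dist ((\<integral>\<omega>. (Y \<omega>)\<^sup>2 * h (l n * Y \<omega>) * indicator {\<omega>. Y \<omega> \<le> R n} \<omega> \<partial>M) / V (R n)) 1 < e"
    using l eventually_compose_filterlim[OF V_eventually_pos R]
      eventually_compose_filterlim[OF eventually_gt_at_top[of 0] R]
  proof eventually_elim
    case (elim n)
    define r where "r = R n"
    define u where "u = l n"
    have r: "0 < r" "0 < V r" using elim by (auto simp: r_def)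
    have ur: "1 / D \<le> u * r" "u * r \<le> C" using elim by (auto simp: u_def r_def)
    have "0 < u * r" using ur(1) D by (smt (verit) divide_pos_pos)
    then have u: "0 < u" using r by (simp add: zero_less_mult_iff)
    \<comment> \<open>The lower bound on \<open>u * r\<close> turns the price \<open>1 / u\<close>
      of \<open>tilted_bound\<close> into the factor \<open>r\<close> that
      \<open>tail_negligible\<close> can absorb.\<close>
    have Ku: "K / u \<le> K * D * r"
    proof -
      have "1 \<le> D * (u * r)" using ur D by (simp add: field_simps)
      then have "K * 1 \<le> K * (D * (u * r))" using K by (rule mult_left_mono)
      then show ?thesis using u by (simp add: field_simps)
    qed
    let ?f = "\<lambda>\<omega>. (Y \<omega>)\<^sup>2 * h (u * Y \<omega>) * indicator {\<omega>. Y \<omega> \<le> r} \<omega>"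
    let ?v = "\<lambda>y \<omega>. (Y \<omega>)\<^sup>2 * indicator {\<omega>. \<bar>Y \<omega>\<bar> \<le> y} \<omega>"
    let ?t = "\<lambda>\<omega>. \<bar>Y \<omega>\<bar> * indicator {\<omega>. \<epsilon> * r < \<bar>Y \<omega>\<bar>} \<omega>"
    have int: "integrable M ?f" by (rule tilted_integrable[OF h_meas h_bound u ur(2)])
    have "\<bar>(\<integral>\<omega>. ?f \<omega> \<partial>M) - V r\<bar> = \<bar>\<integral>\<omega>. ?f \<omega> - ?v r \<omega> \<partial>M\<bar>"
      unfolding V_def by (simp add: int V_integrable)
    also have "\<dots> \<le> (\<integral>\<omega>. \<bar>?f \<omega> - ?v r \<omega>\<bar> \<partial>M)" by (rule integral_abs_bound)
    \<comment> \<open>Pointwise split at \<open>\<epsilon> * r\<close>. Below it only the relative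
      error \<open>e / 2\<close> of \<open>h\<close> counts. Beyond it the second term pays for the
      part of \<open>V r\<close> without a tilted counterpart, and the third for the tilted
      integrand, on both sides.\<close>
    also have "\<dots> \<le> (\<integral>\<omega>. e / 2 * ?v r \<omega> + (?v r \<omega> - ?v (\<epsilon> * r) \<omega>) + K * D * r * ?t \<omega> \<partial>M)"
    proof (intro integral_mono integrable_abs Bochner_Integration.integrable_diff int V_integrable
        Bochner_Integration.integrable_add integrable_mult_right T_integrable)
      fix \<omega>
      show "\<bar>?f \<omega> - ?v r \<omega>\<bar> \<le> e / 2 * ?v r \<omega> + (?v r \<omega> - ?v (\<epsilon> * r) \<omega>) + K * D * r * ?t \<omega>"
      proof (cases "\<bar>Y \<omega>\<bar> \<le> \<epsilon> * r")
        case True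
        have "\<epsilon> * r \<le> 1 * r" using \<epsilon> r by (intro mult_right_mono) auto
        then have 1: "\<bar>Y \<omega>\<bar> \<le> r" using True by simp
        have "\<bar>u * Y \<omega>\<bar> \<le> u * (\<epsilon> * r)" using True u by (simp add: abs_mult)
        also have "\<dots> \<le> C * \<epsilon>" using mult_right_mono[OF ur(2), of \<epsilon>] \<epsilon> by (simp add: mult_ac)
        finally have "\<bar>u * Y \<omega>\<bar> < \<delta>" using \<epsilon> by linarith
        then have "\<bar>h (u * Y \<omega>) - 1\<bar> \<le> e / 2" using \<delta>(2) less_imp_le by blast
        then have "(Y \<omega>)\<^sup>2 * \<bar>h (u * Y \<omega>) - 1\<bar> \<le> (Y \<omega>)\<^sup>2 * (e / 2)" by (intro mult_left_mono) auto
        moreover have "(Y \<omega>)\<^sup>2 * \<bar>h (u * Y \<omega>) - 1\<bar> = \<bar>(Y \<omega>)\<^sup>2 * h (u * Y \<omega>) - (Y \<omega>)\<^sup>2\<bar>"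
          by (metis abs_mult abs_power2 mult.right_neutral right_diff_distrib)
        moreover have "?t \<omega> = 0" "?v r \<omega> = (Y \<omega>)\<^sup>2" "?v (\<epsilon> * r) \<omega> = (Y \<omega>)\<^sup>2"
          "?f \<omega> = (Y \<omega>)\<^sup>2 * h (u * Y \<omega>)"
          using True 1 by auto
        ultimately show ?thesis by (simp only:) (simp add: mult.commute)
      next
        case False
        have "\<bar>?f \<omega>\<bar> \<le> K * D * r * \<bar>Y \<omega>\<bar>"
        proof (cases "Y \<omega> \<le> r")
          case True
          have "\<bar>(Y \<omega>)\<^sup>2 * h (u * Y \<omega>)\<bar> \<le> K / u * \<bar>Y \<omega>\<bar>"
            by (rule tilted_bound[OF h_bound u ur(2) True])
          also have "\<dots> \<le> K * D * r * \<bar>Y \<omega>\<bar>" using Ku by (rule mult_right_mono) simp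
          finally show ?thesis using True by simp
        qed (use K D r in simp)
        moreover have "0 \<le> e / 2 * ?v r \<omega>" "0 \<le> ?v r \<omega>" using e by auto
        moreover have "?t \<omega> = \<bar>Y \<omega>\<bar>" "?v (\<epsilon> * r) \<omega> = 0" using False by auto
        ultimately show ?thesis by (simp only:) linarith
      qed
    qed
    also have "\<dots> = e / 2 * V r + (V r - V (\<epsilon> * r)) + K * D * r * T (\<epsilon> * r)"
      unfolding V_def T_def by (simp add: V_integrable T_integrable)
    finally have "\<bar>(\<integral>\<omega>. ?f \<omega> \<partial>M) / V r - 1\<bar> \<le> e / 2 + ?g n"
    proof -
      assume *: "\<bar>(\<integral>\<omega>. ?f \<omega> \<partial>M) - V r\<bar> \<le> e / 2 * V r + (V r - V (\<epsilon> * r)) + K * D * r * T (\<epsilon> * r)"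
      have "\<bar>(\<integral>\<omega>. ?f \<omega> \<partial>M) / V r - 1\<bar> = \<bar>(\<integral>\<omega>. ?f \<omega> \<partial>M) - V r\<bar> / V r"
        using r abs_divide[of "(\<integral>\<omega>. ?f \<omega> \<partial>M) - V r" "V r"] by (simp add: diff_divide_distrib)
      also have "\<dots> \<le> (e / 2 * V r + (V r - V (\<epsilon> * r)) + K * D * r * T (\<epsilon> * r)) / V r"
        using * r by (intro divide_right_mono) auto
      also have "\<dots> = e / 2 + ?g n"
        using r unfolding r_def[symmetric] by (simp add: add_divide_distrib diff_divide_distrib)
      finally show ?thesis .
    qed
    then have "\<bar>(\<integral>\<omega>. ?f \<omega> \<partial>M) / V r - 1\<bar> < e" using elim(1) by linarith
    then show ?case unfolding dist_real_def r_def u_def .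
  qed
qed

section \<open>The tilted law\<close>

text \<open>Unnormalised density of the tilted law. For \<open>u \<ge> 0\<close> it is bounded,
  since \<open>Y \<le> R\<close> on its support.\<close>

definition W :: "real \<Rightarrow> real \<Rightarrow> 'a \<Rightarrow> real" where
  "W R u \<omega> = exp (u * Y \<omega>) * indicator {\<omega>. Y \<omega> \<le> R} \<omega>"

definition mgf :: "real \<Rightarrow> real \<Rightarrow> real" where
  "mgf R u = (\<integral>\<omega>. W R u \<omega> \<partial>M)"

text \<open>An integral and not a derivative, so that it can be estimated directly;
  \<open>mgf_has_derivative\<close> identifies it with the one-sided derivative occurring in
  \<open>tilted_mean\<close>.\<close>

definition dmgf :: "real \<Rightarrow> real \<Rightarrow> real" where
  "dmgf R u = (\<integral>\<omega>. Y \<omega> * W R u \<omega> \<partial>M)"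

lemma W_measurable [measurable]: "W R u \<in> borel_measurable M"
  unfolding W_def[abs_def] by measurable

lemma W_nonneg: "0 \<le> W R u \<omega>"
  by (simp add: W_def)

lemma W_le: assumes "0 \<le> u" "u \<le> b" shows "W R u \<omega> \<le> exp (b * \<bar>R\<bar>)"
proof (cases "Y \<omega> \<le> R")
  case True
  have "u * Y \<omega> \<le> u * \<bar>R\<bar>" using True assms by (intro mult_left_mono) auto
  also have "\<dots> \<le> b * \<bar>R\<bar>" using assms by (intro mult_right_mono) auto
  finally show ?thesis using True by (simp add: W_def)
qed (simp add: W_def)

lemma W_integrable: assumes "0 \<le> u" shows "integrable M (W R u)"
  by (rule integrable_const_bound[where B = "exp (u * \<bar>R\<bar>)"])
     (use W_le[OF assms order_refl] in \<open>auto simp: W_nonneg\<close>)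

lemma YW_integrable: assumes "0 \<le> u" shows "integrable M (\<lambda>\<omega>. Y \<omega> * W R u \<omega>)"
proof (rule Bochner_Integration.integrable_bound[where f = "\<lambda>\<omega>. exp (u * \<bar>R\<bar>) * Y \<omega>"])
  show "AE \<omega> in M. norm (Y \<omega> * W R u \<omega>) \<le> norm (exp (u * \<bar>R\<bar>) * Y \<omega>)"
    using W_le[OF assms order_refl, of R] W_nonneg[of R u]
    by (auto simp: abs_mult mult.commute intro!: mult_left_mono)
qed (use Y_integrable in auto)

text \<open>The difference quotients are dominated by
  \<open>exp (b * \<bar>R\<bar>) * \<bar>Y\<bar>\<close>, so that integrability of \<open>Y\<close>
  suffices, even at \<open>u = 0\<close>, where the weight gives no decay on the left.\<close>

lemma mgf_has_derivative:
  assumes u: "0 \<le> u"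
  shows "(mgf R has_real_derivative dmgf R u) (at u within {0..})"
  unfolding has_field_derivative_iff tendsto_at_iff_sequentially comp_def
proof (intro allI impI)
  fix X :: "nat \<Rightarrow> real"
  assume X: "\<forall>i. X i \<in> {0..} - {u}" "X \<longlonglongrightarrow> u"
  obtain b where b: "\<And>i. X i \<le> b" "u \<le> b"
  proof -
    have "Bseq X" using X(2) convergentI convergent_imp_Bseq by blast
    then obtain K where "\<forall>i. norm (X i) \<le> K" by (meson BseqE)
    then show ?thesis using that[of "max K u"] by (force simp: abs_le_iff le_max_iff_disj)
  qed
  have "(\<lambda>i. \<integral>\<omega>. (W R (X i) \<omega> - W R u \<omega>) / (X i - u) \<partial>M) \<longlonglongrightarrow> (\<integral>\<omega>. Y \<omega> * W R u \<omega> \<partial>M)"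
  proof (rule integral_dominated_convergence[where w = "\<lambda>\<omega>. exp (b * \<bar>R\<bar>) * \<bar>Y \<omega>\<bar>"])
    show "AE \<omega> in M. (\<lambda>i. (W R (X i) \<omega> - W R u \<omega>) / (X i - u)) \<longlonglongrightarrow> Y \<omega> * W R u \<omega>"
    proof (rule AE_I2)
      fix \<omega>
      have "((\<lambda>v. exp (v * Y \<omega>)) has_real_derivative exp (u * Y \<omega>) * Y \<omega>) (at u within {0..})"
        by (auto intro!: derivative_eq_intros)
      then have "(\<lambda>i. (exp (X i * Y \<omega>) - exp (u * Y \<omega>)) / (X i - u)) \<longlonglongrightarrow> exp (u * Y \<omega>) * Y \<omega>"
        using X unfolding has_field_derivative_iff tendsto_at_iff_sequentially comp_def by blast
      then show "(\<lambda>i. (W R (X i) \<omega> - W R u \<omega>) / (X i - u)) \<longlonglongrightarrow> Y \<omega> * W R u \<omega>"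
        by (auto simp: W_def mult.commute split: split_indicator)
    qed
    show "AE \<omega> in M. norm ((W R (X i) \<omega> - W R u \<omega>) / (X i - u)) \<le> exp (b * \<bar>R\<bar>) * \<bar>Y \<omega>\<bar>" for i
    proof (rule AE_I2)
      fix \<omega>
      \<comment> \<open>The tangent line of \<open>exp\<close> at \<open>p\<close>. Used for both
        orders of the two parameters, it bounds the modulus of the increment.\<close>
      have *: "exp p - exp q \<le> \<bar>p - q\<bar> * exp p" for p q :: real
      proof -
        have "exp p * (1 + (q - p)) \<le> exp p * exp (q - p)"
          by (intro mult_left_mono exp_ge_add_one_self) auto
        then have "exp p - exp q \<le> (p - q) * exp p" by (simp add: exp_diff algebra_simps)
        also have "\<dots> \<le> \<bar>p - q\<bar> * exp p" by (intro mult_right_mono) auto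
        finally show ?thesis .
      qed
      have step: "W R p \<omega> - W R q \<omega> \<le> \<bar>p - q\<bar> * \<bar>Y \<omega>\<bar> * exp (b * \<bar>R\<bar>)" if "0 \<le> p" "p \<le> b" for p q
      proof (cases "Y \<omega> \<le> R")
        case True
        have "W R p \<omega> - W R q \<omega> \<le> \<bar>p * Y \<omega> - q * Y \<omega>\<bar> * W R p \<omega>"
          using *[of "p * Y \<omega>" "q * Y \<omega>"] True by (simp add: W_def)
        also have "\<bar>p * Y \<omega> - q * Y \<omega>\<bar> = \<bar>p - q\<bar> * \<bar>Y \<omega>\<bar>"
          by (simp add: abs_mult left_diff_distrib[symmetric])
        also have "\<bar>p - q\<bar> * \<bar>Y \<omega>\<bar> * W R p \<omega> \<le> \<bar>p - q\<bar> * \<bar>Y \<omega>\<bar> * exp (b * \<bar>R\<bar>)"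
          using that by (intro mult_left_mono W_le) auto
        finally show ?thesis .
      qed (simp add: W_def)
      have "\<bar>W R (X i) \<omega> - W R u \<omega>\<bar> \<le> \<bar>X i - u\<bar> * \<bar>Y \<omega>\<bar> * exp (b * \<bar>R\<bar>)"
        using step[of "X i" u] step[of u "X i"] X(1) b u by (auto simp: abs_le_iff abs_minus_commute)
      then show "norm ((W R (X i) \<omega> - W R u \<omega>) / (X i - u)) \<le> exp (b * \<bar>R\<bar>) * \<bar>Y \<omega>\<bar>"
        using X(1) by (auto simp: divide_le_eq mult_ac)
    qed
  qed (use Y_integrable in auto)
  moreover have "(\<integral>\<omega>. (W R (X i) \<omega> - W R u \<omega>) / (X i - u) \<partial>M) = (mgf R (X i) - mgf R u) / (X i - u)" for i
    using X(1) u unfolding mgf_def by (subst integral_divide_zero) (simp add: W_integrable)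
  ultimately show "(\<lambda>i. (mgf R (X i) - mgf R u) / (X i - u)) \<longlonglongrightarrow> dmgf R u"
    by (simp only: dmgf_def)
qed

lemma dmgf_continuous: "continuous_on {0..} (dmgf R)"
  unfolding continuous_on_sequentially comp_def
proof (intro allI ballI impI, elim conjE)
  fix X :: "nat \<Rightarrow> real" and u
  assume u: "u \<in> {0..}" and X: "\<forall>i. X i \<in> {0..}" "X \<longlonglongrightarrow> u"
  obtain b where b: "\<And>i. X i \<le> b"
  proof -
    have "Bseq X" using X(2) convergentI convergent_imp_Bseq by blast
    then obtain K where "\<forall>i. norm (X i) \<le> K" by (meson BseqE)
    then show ?thesis using that[of K] by (auto simp: abs_le_iff)
  qed
  show "(\<lambda>i. dmgf R (X i)) \<longlonglongrightarrow> dmgf R u"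
    unfolding dmgf_def
  proof (rule integral_dominated_convergence[where w = "\<lambda>\<omega>. exp (b * \<bar>R\<bar>) * \<bar>Y \<omega>\<bar>"])
    show "AE \<omega> in M. (\<lambda>i. Y \<omega> * W R (X i) \<omega>) \<longlonglongrightarrow> Y \<omega> * W R u \<omega>"
      unfolding W_def using X(2) by (intro AE_I2 tendsto_intros)
    show "AE \<omega> in M. norm (Y \<omega> * W R (X i) \<omega>) \<le> exp (b * \<bar>R\<bar>) * \<bar>Y \<omega>\<bar>" for i
      using W_le[of "X i" b R] W_nonneg[of R "X i"] X(1) b
      by (auto simp: abs_mult mult.commute intro!: mult_left_mono)
  qed (use Y_integrable in auto)
qed

lemma mgf_continuous: "continuous_on {0..} (mgf R)"
  using mgf_has_derivative by (intro DERIV_continuous_on) auto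

text \<open>Eventual positivity of \<open>V\<close> excludes \<open>Y = 0\<close> almost surely, and
  a centred variable then has mass on both sides of 0. Some interval \<open>(0, k]\<close> already
  carries positive mass, and negative values are never cut off, so beyond \<open>k\<close> the
  truncated law keeps mass on both sides and is no point mass.\<close>

lemma nondegenerate:
  obtains R0 where "\<And>R c. R0 \<le> R \<Longrightarrow> \<not> (AE \<omega> in M. Y \<omega> \<le> R \<longrightarrow> Y \<omega> = c)"
proof -
  have not0: "\<not> (AE \<omega> in M. Y \<omega> = 0)"
  proof
    assume *: "AE \<omega> in M. Y \<omega> = 0"
    have "V y = 0" for y
    proof -
      have "V y = (\<integral>\<omega>. 0 \<partial>M)" unfolding V_def
        by (rule integral_cong_AE) (use * in auto)
      then show ?thesis by simp
    qed
    then show False using eventually_happens[OF V_eventually_pos] by auto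
  qed
  have neg: "\<not> (AE \<omega> in M. 0 \<le> Y \<omega>)"
    using integral_nonneg_eq_0_iff_AE[OF Y_integrable] Y_centred not0 by auto
  have pos: "\<not> (AE \<omega> in M. Y \<omega> \<le> 0)"
  proof
    assume *: "AE \<omega> in M. Y \<omega> \<le> 0"
    have "(AE \<omega> in M. - Y \<omega> = 0)"
      by (subst integral_nonneg_eq_0_iff_AE[symmetric]) (use * Y_integrable Y_centred in auto)
    then show False using not0 by auto
  qed
  have "\<exists>k :: nat. \<not> (AE \<omega> in M. \<not> (0 < Y \<omega> \<and> Y \<omega> \<le> k))"
  proof (rule ccontr)
    assume "\<not> ?thesis"
    then have "AE \<omega> in M. \<forall>k :: nat. \<not> (0 < Y \<omega> \<and> Y \<omega> \<le> k)" unfolding AE_all_countable by blast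
    then have "AE \<omega> in M. Y \<omega> \<le> 0"
      by eventually_elim (meson linorder_not_less real_arch_simple)
    then show False using pos by simp
  qed
  then obtain k :: nat where k: "\<not> (AE \<omega> in M. \<not> (0 < Y \<omega> \<and> Y \<omega> \<le> k))" by auto
  show ?thesis
  proof (rule that[of "real k"], rule notI)
    fix R c assume R: "real k \<le> R" and c: "AE \<omega> in M. Y \<omega> \<le> R \<longrightarrow> Y \<omega> = c"
    show False
    proof (cases "c \<le> 0")
      case True
      have "AE \<omega> in M. \<not> (0 < Y \<omega> \<and> Y \<omega> \<le> k)" using c by eventually_elim (use True R in auto)
      then show ?thesis using k by simp
    next
      case False
      have "AE \<omega> in M. 0 \<le> Y \<omega>" using c by eventually_elim (use False R in auto)
      then show ?thesis using neg by simp
    qed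
  qed
qed

lemma mgf_pos:
  assumes "\<And>c. \<not> (AE \<omega> in M. Y \<omega> \<le> R \<longrightarrow> Y \<omega> = c)" "0 \<le> u"
  shows "0 < mgf R u"
proof (rule ccontr)
  assume "\<not> ?thesis"
  moreover have "0 \<le> mgf R u"
    unfolding mgf_def by (intro Bochner_Integration.integral_nonneg W_nonneg)
  ultimately have "mgf R u = 0" by simp
  then have "AE \<omega> in M. W R u \<omega> = 0"
    unfolding mgf_def using assms(2)
    by (subst (asm) integral_nonneg_eq_0_iff_AE) (auto simp: W_integrable W_nonneg)
  then have "AE \<omega> in M. Y \<omega> \<le> R \<longrightarrow> Y \<omega> = 0"
    by eventually_elim (auto simp: W_def split: split_indicator_asm)
  then show False using assms(1) by blast
qed

text \<open>A covariance argument: with \<open>c\<close> the mean at \<open>u\<close>, the weight at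
  \<open>v\<close> is the weight at \<open>u\<close> times \<open>exp ((v - u) * Y)\<close>, and
  \<open>(Y - c) * (exp ((v - u) * Y) - k)\<close> is nonnegative, vanishing only at
  \<open>Y = c\<close>. Differentiating the tilted mean instead would involve, at
  \<open>u = 0\<close>, a second moment that may be infinite.\<close>

lemma tilted_mean_strict_mono:
  assumes nondeg: "\<And>c. \<not> (AE \<omega> in M. Y \<omega> \<le> R \<longrightarrow> Y \<omega> = c)" and uv: "0 \<le> u" "u < v"
  shows "dmgf R u / mgf R u < dmgf R v / mgf R v"
proof (rule ccontr)
  assume le: "\<not> ?thesis"
  define c where "c = dmgf R u / mgf R u"
  have pos: "0 < mgf R u" "0 < mgf R v" using mgf_pos[OF nondeg] uv by auto
  have "dmgf R v / mgf R v \<le> c" using le c_def by simp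
  then have le: "dmgf R v - c * mgf R v \<le> 0" using pos by (simp add: field_simps)
  have eq: "dmgf R u - c * mgf R u = 0" using pos by (simp add: c_def)
  define k where "k = exp ((v - u) * c)"
  let ?g = "\<lambda>\<omega>. (Y \<omega> * W R v \<omega> - c * W R v \<omega>) - k * (Y \<omega> * W R u \<omega> - c * W R u \<omega>)"
  have int: "integrable M ?g"
    using uv by (intro Bochner_Integration.integrable_diff integrable_mult_right W_integrable YW_integrable) auto
  have g: "?g \<omega> = W R u \<omega> * ((Y \<omega> - c) * (exp ((v - u) * Y \<omega>) - k))" for \<omega>
  proof -
    have "W R v \<omega> = W R u \<omega> * exp ((v - u) * Y \<omega>)"
      by (simp add: W_def left_diff_distrib flip: exp_add)
    then show ?thesis by (simp add: algebra_simps)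
  qed
  have prod: "0 \<le> (y - c) * (exp ((v - u) * y) - k)" "(y - c) * (exp ((v - u) * y) - k) = 0 \<Longrightarrow> y = c" for y
    using uv by (cases "y \<le> c"; auto simp: k_def zero_le_mult_iff)+
  have "(\<integral>\<omega>. ?g \<omega> \<partial>M) = (dmgf R v - c * mgf R v) - k * (dmgf R u - c * mgf R u)"
    using uv by (simp add: mgf_def dmgf_def W_integrable YW_integrable)
  also have "\<dots> \<le> 0" using le eq by simp
  finally have "(\<integral>\<omega>. ?g \<omega> \<partial>M) \<le> 0" .
  moreover have "0 \<le> (\<integral>\<omega>. ?g \<omega> \<partial>M)"
    unfolding g by (intro Bochner_Integration.integral_nonneg mult_nonneg_nonneg[OF W_nonneg] prod(1))
  ultimately have "(\<integral>\<omega>. ?g \<omega> \<partial>M) = 0" by simp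
  moreover have "AE \<omega> in M. 0 \<le> ?g \<omega>" unfolding g by (intro AE_I2 mult_nonneg_nonneg[OF W_nonneg] prod(1))
  ultimately have "AE \<omega> in M. ?g \<omega> = 0"
    using integral_nonneg_eq_0_iff_AE[OF int] by simp
  then have "AE \<omega> in M. Y \<omega> \<le> R \<longrightarrow> Y \<omega> = c"
    unfolding g by eventually_elim (use prod(2) in \<open>auto simp: W_def split: split_indicator_asm\<close>)
  then show False using nondeg by blast
qed

end

section \<open>Test functions for the tilted moments\<close>

lemma mult_exp_bound: "z \<le> C \<Longrightarrow> \<bar>z * exp z\<bar> \<le> \<bar>C\<bar> * exp C + 1" for z C :: real
proof (cases "0 \<le> z")
  case True
  assume "z \<le> C"
  then have "z * exp z \<le> C * exp C" using True by (intro mult_mono) auto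
  then show ?thesis using True \<open>z \<le> C\<close> by simp
next
  case False
  have "- z \<le> exp (- z)" using exp_ge_add_one_self[of "- z"] by linarith
  then have "- z * exp z \<le> exp (- z) * exp z" by (intro mult_right_mono) auto
  also have "\<dots> = 1" by (simp flip: exp_add)
  finally have "\<bar>z * exp z\<bar> \<le> 1" using False by (simp add: abs_mult)
  moreover have "0 \<le> \<bar>C\<bar> * exp C" by simp
  ultimately show ?thesis by linarith
qed

text \<open>From \<open>exp z = 1 + z * exp_quotient z\<close>: it rewrites the tilted mean as a
  tilted second moment plus an untilted truncated mean. The value at 0 is the continuous
  one.\<close>

definition exp_quotient :: "real \<Rightarrow> real" where
  "exp_quotient z = (if z = 0 then 1 else (exp z - 1) / z)"

lemma exp_quotient_measurable [measurable]: "exp_quotient \<in> borel_measurable borel"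
  unfolding exp_quotient_def[abs_def] by measurable

lemma exp_quotient_bound: "z \<le> C \<Longrightarrow> \<bar>z * exp_quotient z\<bar> \<le> exp C + 1"
proof -
  assume "z \<le> C"
  then have "exp z \<le> exp C" by simp
  then have "\<bar>exp z - 1\<bar> \<le> exp C + 1"
    using exp_gt_zero[of z] exp_gt_zero[of C] unfolding abs_le_iff by linarith
  then show ?thesis by (auto simp: exp_quotient_def intro: add_nonneg_nonneg)
qed

lemma isCont_exp_quotient: "isCont exp_quotient 0"
proof -
  have "((\<lambda>z :: real. (exp z - exp 0) / (z - 0)) \<longlongrightarrow> exp 0) (at 0)"
    using DERIV_exp[of 0] unfolding has_field_derivative_iff .
  moreover have "\<forall>\<^sub>F z :: real in at 0. (exp z - exp 0) / (z - 0) = exp_quotient z"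
    by (auto simp: exp_quotient_def eventually_at intro: exI[of _ 1])
  ultimately have "(exp_quotient \<longlongrightarrow> 1) (at 0)"
    by (auto elim: Lim_transform_eventually)
  then show ?thesis by (simp add: isCont_def exp_quotient_def)
qed

section \<open>Asymptotics of the tilted mean and existence of the tilt\<close>

context slowly_varying_variance
begin

text \<open>Write \<open>Y * exp (u * Y) = Y + u * Y^2 * exp_quotient (u * Y)\<close> with
  \<open>u = c / R\<close>. The second part is asymptotic to \<open>c * V R / R\<close> by
  \<open>tilted_moment\<close>; by centring, the first has the same expectation as
  \<open>- Y\<close> on \<open>Y > R\<close>, which \<open>tail_negligible\<close> absorbs.\<close>

lemma dmgf_asymp:
  assumes R: "filterlim R at_top sequentially" and c: "c > 0"
  shows "(\<lambda>n. dmgf (R n) (c / R n) * (R n / V (R n))) \<longlonglongrightarrow> c"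
proof -
  let ?S = "\<lambda>n. \<integral>\<omega>. (Y \<omega>)\<^sup>2 * exp_quotient (c / R n * Y \<omega>) * indicator {\<omega>. Y \<omega> \<le> R n} \<omega> \<partial>M"
  let ?E = "\<lambda>n. \<integral>\<omega>. Y \<omega> * indicator {\<omega>. Y \<omega> \<le> R n} \<omega> \<partial>M"
  have ev: "\<forall>\<^sub>F n in sequentially. 0 < R n \<and> 0 < V (R n)"
    using eventually_compose_filterlim[OF V_eventually_pos R]
      eventually_compose_filterlim[OF eventually_gt_at_top[of 0] R] by eventually_elim simp
  have S: "(\<lambda>n. ?S n / V (R n)) \<longlonglongrightarrow> 1"
  proof (rule tilted_moment[where C = c and D = "1 / c" and K = "exp c + 1"])
    show "\<forall>\<^sub>F n in sequentially. 1 / (1 / c) \<le> c / R n * R n \<and> c / R n * R n \<le> c"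
      using ev by eventually_elim simp
  qed (use isCont_exp_quotient exp_quotient_bound R c exp_quotient_def[of 0] in auto)
  have E: "(\<lambda>n. R n * ?E n / V (R n)) \<longlonglongrightarrow> 0"
  proof (rule Lim_null_comparison)
    show "\<forall>\<^sub>F n in sequentially. norm (R n * ?E n / V (R n)) \<le> R n * T (1 * R n) / V (R n)"
      using ev
    proof eventually_elim
      case (elim n)
      have int: "integrable M (\<lambda>\<omega>. Y \<omega> * indicator {\<omega>. R n < Y \<omega>} \<omega>)"
        by (rule Bochner_Integration.integrable_bound[OF Y_integrable]) (auto split: split_indicator)
      have "?E n = (\<integral>\<omega>. Y \<omega> - Y \<omega> * indicator {\<omega>. R n < Y \<omega>} \<omega> \<partial>M)"
        by (rule Bochner_Integration.integral_cong) (auto split: split_indicator)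
      also have "\<dots> = - (\<integral>\<omega>. Y \<omega> * indicator {\<omega>. R n < Y \<omega>} \<omega> \<partial>M)"
        using int Y_integrable Y_centred by simp
      finally have "\<bar>?E n\<bar> = \<bar>\<integral>\<omega>. Y \<omega> * indicator {\<omega>. R n < Y \<omega>} \<omega> \<partial>M\<bar>" by simp
      also have "\<dots> \<le> (\<integral>\<omega>. \<bar>Y \<omega> * indicator {\<omega>. R n < Y \<omega>} \<omega>\<bar> \<partial>M)" by (rule integral_abs_bound)
      also have "\<dots> \<le> T (R n)" unfolding T_def
        using int by (intro integral_mono T_integrable integrable_abs) (auto split: split_indicator)
      finally have "\<bar>?E n\<bar> \<le> T (R n)" .
      then show ?case using elim by (auto simp: abs_mult intro!: divide_right_mono)
    qed
    show "(\<lambda>n. R n * T (1 * R n) / V (R n)) \<longlonglongrightarrow> 0" by (rule tail_negligible[OF R]) simp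
  qed
  have "(\<lambda>n. c * (?S n / V (R n)) + R n * ?E n / V (R n)) \<longlonglongrightarrow> c * 1 + 0"
    by (intro tendsto_intros S E)
  moreover have "\<forall>\<^sub>F n in sequentially. c * (?S n / V (R n)) + R n * ?E n / V (R n)
      = dmgf (R n) (c / R n) * (R n / V (R n))"
    using ev
  proof eventually_elim
    case (elim n)
    have "dmgf (R n) (c / R n) = (\<integral>\<omega>. (c / R n) * ((Y \<omega>)\<^sup>2 * exp_quotient (c / R n * Y \<omega>)
         * indicator {\<omega>. Y \<omega> \<le> R n} \<omega>) + Y \<omega> * indicator {\<omega>. Y \<omega> \<le> R n} \<omega> \<partial>M)"
      unfolding dmgf_def
    proof (rule Bochner_Integration.integral_cong[OF refl])
      fix \<omega>
      show "Y \<omega> * W (R n) (c / R n) \<omega> = (c / R n) * ((Y \<omega>)\<^sup>2 * exp_quotient (c / R n * Y \<omega>)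
         * indicator {\<omega>. Y \<omega> \<le> R n} \<omega>) + Y \<omega> * indicator {\<omega>. Y \<omega> \<le> R n} \<omega>"
        using elim c by (cases "Y \<omega> = 0"; cases "Y \<omega> \<le> R n")
          (auto simp: W_def exp_quotient_def field_simps power2_eq_square)
    qed
    also have "\<dots> = (c / R n) * ?S n + ?E n"
    proof -
      have "integrable M (\<lambda>\<omega>. (Y \<omega>)\<^sup>2 * exp_quotient (c / R n * Y \<omega>) * indicator {\<omega>. Y \<omega> \<le> R n} \<omega>)"
        using elim c by (intro tilted_integrable[where C = c and K = "exp c + 1"])
          (auto intro: exp_quotient_bound)
      moreover have "integrable M (\<lambda>\<omega>. Y \<omega> * indicator {\<omega>. Y \<omega> \<le> R n} \<omega>)"
        by (rule Bochner_Integration.integrable_bound[OF Y_integrable]) (auto split: split_indicator)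
      ultimately show ?thesis by (simp only: Bochner_Integration.integral_add
            integral_mult_right_zero integrable_mult_right)
    qed
    finally show ?case using elim by (simp add: field_simps)
  qed
  ultimately show ?thesis by (auto elim: Lim_transform_eventually)
qed

text \<open>As \<open>l\<close> tends to 0 and \<open>R\<close> to infinity, the weight tends to 1
  pointwise, and it is bounded by \<open>exp C\<close>. Convergence in mean, stronger than that of
  \<open>mgf\<close>, is what compares characteristic functions uniformly in the frequency.\<close>

lemma W_L1_tendsto:
  assumes R: "filterlim R at_top sequentially"
    and l: "\<forall>\<^sub>F n in sequentially. 0 \<le> l n \<and> l n * R n \<le> C"
  shows "(\<lambda>n. \<integral>\<omega>. \<bar>W (R n) (l n) \<omega> - 1\<bar> \<partial>M) \<longlonglongrightarrow> 0"
proof -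
  have ev: "\<forall>\<^sub>F n in sequentially. 0 \<le> l n \<and> l n * R n \<le> C \<and> 0 < R n"
    using l eventually_compose_filterlim[OF eventually_gt_at_top[of 0] R] by eventually_elim simp
  have l0: "l \<longlonglongrightarrow> 0"
  proof (rule Lim_null_comparison)
    show "\<forall>\<^sub>F n in sequentially. norm (l n) \<le> C * inverse (R n)"
      using ev by eventually_elim (auto simp: field_simps)
    have "(\<lambda>n. C * inverse (R n)) \<longlonglongrightarrow> C * 0"
      by (intro tendsto_mult tendsto_const tendsto_inverse_0_at_top R)
    then show "(\<lambda>n. C * inverse (R n)) \<longlonglongrightarrow> 0" by simp
  qed
  \<comment> \<open>The bounds hold only eventually, whereas dominated convergence asks for them at
    every index; hence the shift by \<open>N\<close>.\<close>
  obtain N where N: "\<And>n. N \<le> n \<Longrightarrow> 0 \<le> l n \<and> l n * R n \<le> C \<and> 0 < R n"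
    using ev by (auto simp: eventually_sequentially)
  have "(\<lambda>n. \<integral>\<omega>. \<bar>W (R (n + N)) (l (n + N)) \<omega> - 1\<bar> \<partial>M) \<longlonglongrightarrow> (\<integral>\<omega>. 0 \<partial>M)"
  proof (rule integral_dominated_convergence[where w = "\<lambda>\<omega>. exp C + 1"])
    show "AE \<omega> in M. (\<lambda>n. \<bar>W (R (n + N)) (l (n + N)) \<omega> - 1\<bar>) \<longlonglongrightarrow> 0"
    proof (rule AE_I2)
      fix \<omega>
      have "(\<lambda>n. exp (l n * Y \<omega>)) \<longlonglongrightarrow> exp (0 * Y \<omega>)" by (intro tendsto_intros l0)
      moreover have "\<forall>\<^sub>F n in sequentially. exp (l n * Y \<omega>) = W (R n) (l n) \<omega>"
        using eventually_compose_filterlim[OF eventually_ge_at_top[of "Y \<omega>"] R]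
        by eventually_elim (simp add: W_def)
      ultimately have "(\<lambda>n. W (R n) (l n) \<omega>) \<longlonglongrightarrow> 1"
        by (auto elim: Lim_transform_eventually)
      then have "(\<lambda>n. \<bar>W (R n) (l n) \<omega> - 1\<bar>) \<longlonglongrightarrow> \<bar>1 - 1\<bar>" by (intro tendsto_intros)
      then show "(\<lambda>n. \<bar>W (R (n + N)) (l (n + N)) \<omega> - 1\<bar>) \<longlonglongrightarrow> 0"
        by (intro LIMSEQ_ignore_initial_segment) simp
    qed
    show "AE \<omega> in M. norm (\<bar>W (R (n + N)) (l (n + N)) \<omega> - 1\<bar>) \<le> exp C + 1" for n
    proof (rule AE_I2)
      fix \<omega>
      have "W (R (n + N)) (l (n + N)) \<omega> \<le> exp (l (n + N) * \<bar>R (n + N)\<bar>)"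
        using N[of "n + N"] by (intro W_le) auto
      also have "\<dots> \<le> exp C" using N[of "n + N"] by simp
      finally show "norm (\<bar>W (R (n + N)) (l (n + N)) \<omega> - 1\<bar>) \<le> exp C + 1"
        using W_nonneg[of "R (n + N)" "l (n + N)" \<omega>] by simp
    qed
  qed auto
  then show ?thesis using LIMSEQ_offset by auto
qed

lemma mgf_tendsto:
  assumes R: "filterlim R at_top sequentially"
    and l: "\<forall>\<^sub>F n in sequentially. 0 \<le> l n \<and> l n * R n \<le> C"
  shows "(\<lambda>n. mgf (R n) (l n)) \<longlonglongrightarrow> 1"
proof -
  have "(\<lambda>n. mgf (R n) (l n) - 1) \<longlonglongrightarrow> 0"
  proof (rule Lim_null_comparison[OF _ W_L1_tendsto[OF R l]])
    show "\<forall>\<^sub>F n in sequentially. norm (mgf (R n) (l n) - 1) \<le> (\<integral>\<omega>. \<bar>W (R n) (l n) \<omega> - 1\<bar> \<partial>M)"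
      using l
    proof eventually_elim
      case (elim n)
      have "mgf (R n) (l n) - 1 = (\<integral>\<omega>. W (R n) (l n) \<omega> - 1 \<partial>M)"
        using elim by (simp add: mgf_def W_integrable prob_space)
      then show ?case using integral_abs_bound[of M "\<lambda>\<omega>. W (R n) (l n) \<omega> - 1"] by simp
    qed
  qed
  then show ?thesis by (simp add: LIM_zero_iff)
qed

text \<open>At \<open>c / R n\<close> the tilted mean is asymptotic to
  \<open>c * V (R n) / R n\<close>, and the target corresponds to \<open>c = 1\<close>. The levels
  3/4 and 3/2 separate it from the values at \<open>c = 1/2\<close> and \<open>c = 2\<close>, and
  the intermediate value theorem applies.\<close>

lemma tilt_exists:
  assumes R: "filterlim R at_top sequentially"
    and t: "(\<lambda>n. t n * (R n / V (R n))) \<longlonglongrightarrow> 1"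
  shows "\<forall>\<^sub>F n in sequentially. \<exists>l. 1 / 2 \<le> l * R n \<and> l * R n \<le> 2 \<and> 0 < l
           \<and> dmgf (R n) l / mgf (R n) l = t n"
proof -
  have ev: "\<forall>\<^sub>F n in sequentially. 0 < R n \<and> 0 < V (R n)"
    using eventually_compose_filterlim[OF V_eventually_pos R]
      eventually_compose_filterlim[OF eventually_gt_at_top[of 0] R] by eventually_elim simp
  have lim: "(\<lambda>n. dmgf (R n) (c / R n) / mgf (R n) (c / R n) * (R n / V (R n))) \<longlonglongrightarrow> c" if "c > 0" for c
  proof -
    have "(\<lambda>n. mgf (R n) (c / R n)) \<longlonglongrightarrow> 1"
      using ev that by (intro mgf_tendsto[OF R, where C = c]) (auto elim!: eventually_mono)
    then have "(\<lambda>n. (dmgf (R n) (c / R n) * (R n / V (R n))) / mgf (R n) (c / R n)) \<longlonglongrightarrow> c / 1"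
      by (intro tendsto_divide dmgf_asymp[OF R that]) auto
    then show ?thesis by (simp add: mult.commute)
  qed
  obtain R0 where R0: "\<And>R c. R0 \<le> R \<Longrightarrow> \<not> (AE \<omega> in M. Y \<omega> \<le> R \<longrightarrow> Y \<omega> = c)"
    using nondegenerate by blast
  have "\<forall>\<^sub>F n in sequentially. 3 / 4 < t n * (R n / V (R n))"
    "\<forall>\<^sub>F n in sequentially. t n * (R n / V (R n)) < 3 / 2"
    by (intro order_tendstoD[OF t]; simp)+
  moreover have "\<forall>\<^sub>F n in sequentially. dmgf (R n) (1 / 2 / R n) / mgf (R n) (1 / 2 / R n)
      * (R n / V (R n)) < 3 / 4"
    by (rule order_tendstoD(2)[OF lim]) auto
  moreover have "\<forall>\<^sub>F n in sequentially. 3 / 2 < dmgf (R n) (2 / R n) / mgf (R n) (2 / R n)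
      * (R n / V (R n))"
    by (rule order_tendstoD(1)[OF lim]) auto
  ultimately show ?thesis
    using ev
      eventually_compose_filterlim[OF eventually_ge_at_top[of R0] R]
  proof eventually_elim
    case (elim n)
    let ?m = "\<lambda>u. dmgf (R n) u / mgf (R n) u"
    have pos: "0 < R n" "0 < R n / V (R n)" using elim by auto
    have le: "?m (1 / 2 / R n) \<le> t n" "t n \<le> ?m (2 / R n)"
      using elim pos mult_right_less_imp_less[of "?m (1 / 2 / R n)" "R n / V (R n)" "t n"]
        mult_right_less_imp_less[of "t n" "R n / V (R n)" "?m (2 / R n)"] by linarith+
    have "continuous_on {1 / 2 / R n..2 / R n} ?m"
    proof (rule continuous_on_subset[of "{0..}"])
      show "continuous_on {0..} ?m"
        using mgf_pos[OF R0] elim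
        by (intro continuous_on_divide mgf_continuous dmgf_continuous) (auto simp: order_less_imp_not_eq2)
    qed (use pos in auto)
    moreover have "1 / 2 / R n \<le> 2 / R n" using pos by (simp add: field_simps)
    ultimately obtain l where "1 / 2 / R n \<le> l" "l \<le> 2 / R n" "?m l = t n"
      using IVT'[of ?m] le by blast
    moreover have "0 < 1 / 2 / R n" using pos by simp
    ultimately have "0 < l" by linarith
    then show ?case using \<open>1 / 2 / R n \<le> l\<close> \<open>l \<le> 2 / R n\<close> \<open>?m l = t n\<close> using pos by (intro exI[of _ l]) (auto simp: field_simps)
  qed
qed

lemma second_moment_integrable:
  assumes "0 < l" shows "integrable M (\<lambda>\<omega>. (Y \<omega>)\<^sup>2 * W R l \<omega>)"
  using tilted_integrable[where h = exp, OF _ mult_exp_bound assms order_refl]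
  by (simp add: W_def mult.assoc)

lemma second_moment_tendsto:
  assumes R: "filterlim R at_top sequentially" and D: "D > 0"
    and l: "\<forall>\<^sub>F n in sequentially. 1 / D \<le> l n * R n \<and> l n * R n \<le> C"
  shows "(\<lambda>n. (\<integral>\<omega>. (Y \<omega>)\<^sup>2 * W (R n) (l n) \<omega> \<partial>M) / V (R n)) \<longlonglongrightarrow> 1"
  using tilted_moment[where h = exp, OF _ _ _ mult_exp_bound R D l]
  by (simp add: W_def mult.assoc)

text \<open>Lindeberg's condition at the scale \<open>R\<close>: by \<open>tilted_bound\<close> the
  tilt leaves at most a multiple of \<open>R * T (\<epsilon> * R)\<close> beyond
  \<open>\<epsilon> * R\<close>.\<close>

lemma second_moment_tail:
  assumes R: "filterlim R at_top sequentially" and D: "D > 0"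
    and l: "\<forall>\<^sub>F n in sequentially. 0 < l n \<and> 1 / D \<le> l n * R n \<and> l n * R n \<le> C" and \<epsilon>: "\<epsilon> > 0"
  shows "(\<lambda>n. (\<integral>\<omega>. (Y \<omega>)\<^sup>2 * W (R n) (l n) \<omega> * indicator {\<omega>. \<epsilon> * R n < \<bar>Y \<omega>\<bar>} \<omega> \<partial>M) / V (R n)) \<longlonglongrightarrow> 0"
proof (rule Lim_null_comparison)
  define K where "K = \<bar>C\<bar> * exp C + 1"
  show "(\<lambda>n. K * D * (R n * T (\<epsilon> * R n) / V (R n))) \<longlonglongrightarrow> 0"
    using tendsto_mult_right_zero[OF tail_negligible[OF R \<epsilon>]] by simp
  show "\<forall>\<^sub>F n in sequentially. norm ((\<integral>\<omega>. (Y \<omega>)\<^sup>2 * W (R n) (l n) \<omega>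
      * indicator {\<omega>. \<epsilon> * R n < \<bar>Y \<omega>\<bar>} \<omega> \<partial>M) / V (R n)) \<le> K * D * (R n * T (\<epsilon> * R n) / V (R n))"
    using l eventually_compose_filterlim[OF V_eventually_pos R]
      eventually_compose_filterlim[OF eventually_gt_at_top[of 0] R]
  proof eventually_elim
    case (elim n)
    have K: "0 < K" unfolding K_def by (intro add_nonneg_pos mult_nonneg_nonneg) auto
    have "1 \<le> D * (l n * R n)" using elim D by (simp add: field_simps)
    then have "K * 1 \<le> K * (D * (l n * R n))" using K by (intro mult_left_mono) auto
    then have Kl: "K / l n \<le> K * D * R n" using elim by (simp add: field_simps)
    let ?f = "\<lambda>\<omega>. (Y \<omega>)\<^sup>2 * W (R n) (l n) \<omega> * indicator {\<omega>. \<epsilon> * R n < \<bar>Y \<omega>\<bar>} \<omega>"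
    have "(\<integral>\<omega>. ?f \<omega> \<partial>M) \<le> (\<integral>\<omega>. K * D * R n * (\<bar>Y \<omega>\<bar> * indicator {\<omega>. \<epsilon> * R n < \<bar>Y \<omega>\<bar>} \<omega>) \<partial>M)"
    proof (rule integral_mono)
      show "integrable M ?f"
        by (rule Bochner_Integration.integrable_bound[OF second_moment_integrable[of "l n" "R n"]])
          (use elim in \<open>auto split: split_indicator simp: W_nonneg\<close>)
      fix \<omega>
      show "?f \<omega> \<le> K * D * R n * (\<bar>Y \<omega>\<bar> * indicator {\<omega>. \<epsilon> * R n < \<bar>Y \<omega>\<bar>} \<omega>)"
      proof (cases "Y \<omega> \<le> R n")
        case True
        have "(Y \<omega>)\<^sup>2 * exp (l n * Y \<omega>) \<le> \<bar>(Y \<omega>)\<^sup>2 * exp (l n * Y \<omega>)\<bar>" by simp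
        also have "\<dots> \<le> K / l n * \<bar>Y \<omega>\<bar>"
          using elim True unfolding K_def by (intro tilted_bound[OF mult_exp_bound]) auto
        also have "\<dots> \<le> K * D * R n * \<bar>Y \<omega>\<bar>" using Kl by (intro mult_right_mono) auto
        finally show ?thesis using True by (auto simp: W_def split: split_indicator)
      qed (use K D elim in \<open>simp add: W_def\<close>)
    qed (intro integrable_mult_right T_integrable)
    also have "\<dots> = K * D * R n * T (\<epsilon> * R n)" by (simp add: T_def)
    finally have "(\<integral>\<omega>. ?f \<omega> \<partial>M) / V (R n) \<le> K * D * R n * T (\<epsilon> * R n) / V (R n)"
      using elim by (intro divide_right_mono) auto
    moreover have "0 \<le> (\<integral>\<omega>. ?f \<omega> \<partial>M)"
      by (intro Bochner_Integration.integral_nonneg mult_nonneg_nonneg W_nonneg) auto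
    ultimately show ?case using elim by (simp add: mult_ac)
  qed
qed

section \<open>The tilted probability measure and its characteristic function\<close>

definition tilted_measure :: "real \<Rightarrow> real \<Rightarrow> 'a measure" where
  "tilted_measure R l = density M (\<lambda>\<omega>. ennreal (W R l \<omega> / mgf R l))"

text \<open>Characteristic function of \<open>Y - c\<close> under the tilted law, written over
  \<open>M\<close> so that it can be compared with the untilted one.\<close>

definition tilted_char :: "real \<Rightarrow> real \<Rightarrow> real \<Rightarrow> real \<Rightarrow> complex" where
  "tilted_char R l c \<theta> = (CLINT \<omega>|M. complex_of_real (W R l \<omega>) * iexp (\<theta> * (Y \<omega> - c))) / mgf R l"

lemma tilted_measure_sets [measurable_cong, simp]: "sets (tilted_measure R l) = sets M"
  by (simp add: tilted_measure_def)

lemma tilted_measure_integral: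
  fixes f :: "'a \<Rightarrow> 'b :: {banach, second_countable_topology}"
  assumes "f \<in> borel_measurable M" "0 < mgf R l"
  shows "(\<integral>\<omega>. f \<omega> \<partial>tilted_measure R l) = (\<integral>\<omega>. W R l \<omega> *\<^sub>R f \<omega> \<partial>M) /\<^sub>R mgf R l"
    and "integrable M (\<lambda>\<omega>. W R l \<omega> *\<^sub>R f \<omega>) \<Longrightarrow> integrable (tilted_measure R l) f"
proof -
  have *: "(W R l \<omega> / mgf R l) *\<^sub>R f \<omega> = inverse (mgf R l) *\<^sub>R (W R l \<omega> *\<^sub>R f \<omega>)" for \<omega>
    by (simp add: field_simps)
  show "(\<integral>\<omega>. f \<omega> \<partial>tilted_measure R l) = (\<integral>\<omega>. W R l \<omega> *\<^sub>R f \<omega> \<partial>M) /\<^sub>R mgf R l"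
  proof -
    have "(\<integral>\<omega>. f \<omega> \<partial>tilted_measure R l) = (\<integral>\<omega>. (W R l \<omega> / mgf R l) *\<^sub>R f \<omega> \<partial>M)"
      unfolding tilted_measure_def using assms
      by (intro integral_density) (auto simp: W_nonneg intro!: divide_nonneg_pos)
    then show ?thesis unfolding * by (simp only: integral_scaleR_right)
  qed
  show "integrable (tilted_measure R l) f" if int: "integrable M (\<lambda>\<omega>. W R l \<omega> *\<^sub>R f \<omega>)"
  proof -
    have "integrable (tilted_measure R l) f \<longleftrightarrow> integrable M (\<lambda>\<omega>. (W R l \<omega> / mgf R l) *\<^sub>R f \<omega>)"
      unfolding tilted_measure_def using assms
      by (intro integrable_density) (auto simp: W_nonneg intro!: divide_nonneg_pos)
    then show ?thesis unfolding * using integrable_scaleR_right[OF int] by simp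
  qed
qed

lemma tilted_measure_prob:
  assumes "0 \<le> l" "0 < mgf R l" shows "prob_space (tilted_measure R l)"
proof
  have "emeasure (tilted_measure R l) (space M) = (\<integral>\<^sup>+\<omega>. ennreal (W R l \<omega> / mgf R l) \<partial>M)"
    unfolding tilted_measure_def by (subst emeasure_density) (auto intro!: nn_integral_cong)
  also have "\<dots> = ennreal (\<integral>\<omega>. W R l \<omega> / mgf R l \<partial>M)"
    using assms by (intro nn_integral_eq_integral) (auto simp: W_integrable W_nonneg intro!: divide_nonneg_pos)
  also have "(\<integral>\<omega>. W R l \<omega> / mgf R l \<partial>M) = 1"
    using assms by (simp add: mgf_def)
  finally show "emeasure (tilted_measure R l) (space (tilted_measure R l)) = 1"
    by (simp add: tilted_measure_def)
qed

lemma tilted_char_eq: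
  assumes "0 < mgf R l"
  shows "tilted_char R l c \<theta> = (CLINT \<omega>|tilted_measure R l. iexp (\<theta> * (Y \<omega> - c)))"
  using assms by (subst tilted_measure_integral(1))
    (auto simp: tilted_char_def scaleR_conv_of_real field_simps)

lemma tilted_char_le_1:
  assumes "0 \<le> l" "0 < mgf R l"
  shows "cmod (tilted_char R l c \<theta>) \<le> 1"
proof -
  interpret Q: prob_space "tilted_measure R l" by (rule tilted_measure_prob[OF assms])
  have "cmod (CLINT \<omega>|tilted_measure R l. iexp (\<theta> * (Y \<omega> - c)))
      \<le> (\<integral>\<omega>. cmod (iexp (\<theta> * (Y \<omega> - c))) \<partial>tilted_measure R l)"
    by (rule integral_norm_bound)
  also have "\<dots> = 1" by (simp add: Q.prob_space)
  finally show ?thesis using assms by (simp add: tilted_char_eq)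
qed

lemma second_central_integrable:
  assumes "0 < l"
  shows "integrable M (\<lambda>\<omega>. W R l \<omega> * (Y \<omega> - c)\<^sup>2)"
    and "(\<integral>\<omega>. W R l \<omega> * (Y \<omega> - c)\<^sup>2 \<partial>M)
      = (\<integral>\<omega>. (Y \<omega>)\<^sup>2 * W R l \<omega> \<partial>M) - 2 * c * dmgf R l + c\<^sup>2 * mgf R l"
proof -
  have eq: "W R l \<omega> * (Y \<omega> - c)\<^sup>2 = (Y \<omega>)\<^sup>2 * W R l \<omega> - 2 * c * (Y \<omega> * W R l \<omega>) + c\<^sup>2 * W R l \<omega>" for \<omega>
    by (simp add: power2_diff algebra_simps)
  note int = second_moment_integrable[OF assms, of R] YW_integrable[of l R] W_integrable[of l R]
  show "integrable M (\<lambda>\<omega>. W R l \<omega> * (Y \<omega> - c)\<^sup>2)"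
    unfolding eq using assms
    by (intro Bochner_Integration.integrable_add Bochner_Integration.integrable_diff int integrable_mult_right) auto
  show "(\<integral>\<omega>. W R l \<omega> * (Y \<omega> - c)\<^sup>2 \<partial>M)
      = (\<integral>\<omega>. (Y \<omega>)\<^sup>2 * W R l \<omega> \<partial>M) - 2 * c * dmgf R l + c\<^sup>2 * mgf R l"
    unfolding eq using assms int by (simp add: dmgf_def mgf_def)
qed

text \<open>Centring at the tilted mean removes the linear term of the expansion. The minimum in the
  error is essential: its cubic branch serves the small jumps, its quadratic branch the large
  ones.\<close>

lemma tilted_char_approx:
  assumes l: "0 < l" and mgf: "0 < mgf R l" and c: "c = dmgf R l / mgf R l"
    and \<sigma>: "\<sigma> = (\<integral>\<omega>. W R l \<omega> * (Y \<omega> - c)\<^sup>2 \<partial>M) / mgf R l"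
  shows "cmod (tilted_char R l c \<theta> - complex_of_real (1 - \<theta>\<^sup>2 * \<sigma> / 2))
     \<le> \<theta>\<^sup>2 / 6 * ((\<integral>\<omega>. W R l \<omega> * min (6 * (Y \<omega> - c)\<^sup>2) (\<bar>\<theta>\<bar> * \<bar>Y \<omega> - c\<bar> ^ 3) \<partial>M) / mgf R l)"
proof -
  interpret Q: prob_space "tilted_measure R l" using l by (intro tilted_measure_prob mgf) auto
  note I = tilted_measure_integral[OF _ mgf]
  have eq: "W R l \<omega> * (Y \<omega> - c) = Y \<omega> * W R l \<omega> - c * W R l \<omega>" for \<omega>
    by (simp add: algebra_simps)
  have int1: "integrable M (\<lambda>\<omega>. W R l \<omega> * (Y \<omega> - c))"
    unfolding eq using YW_integrable[of l R] W_integrable[of l R] l by simp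
  have mean0: "Q.expectation (\<lambda>\<omega>. Y \<omega> - c) = 0"
  proof -
    have "(\<integral>\<omega>. W R l \<omega> * (Y \<omega> - c) \<partial>M) = dmgf R l - c * mgf R l"
      unfolding eq using YW_integrable[of l R] W_integrable[of l R] l
      by (simp add: dmgf_def mgf_def)
    then show ?thesis using mgf by (subst I(1)) (auto simp: c)
  qed
  have "cmod (char (distr (tilted_measure R l) borel (\<lambda>\<omega>. Y \<omega> - c)) \<theta> - (1 - \<theta>\<^sup>2 * \<sigma> / 2))
     \<le> \<theta>\<^sup>2 / 6 * Q.expectation (\<lambda>\<omega>. min (6 * (Y \<omega> - c)\<^sup>2) (\<bar>\<theta>\<bar> * \<bar>Y \<omega> - c\<bar> ^ 3))"
  proof (rule Q.char_approx3'[OF _ _ _ mean0 _ refl])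
    show "integrable (tilted_measure R l) (\<lambda>\<omega>. Y \<omega> - c)" using int1 by (intro I(2)) auto
    show "integrable (tilted_measure R l) (\<lambda>\<omega>. (Y \<omega> - c)\<^sup>2)"
      using second_central_integrable(1)[OF l] by (intro I(2)) auto
    show "Q.variance (\<lambda>\<omega>. Y \<omega> - c) = \<sigma>"
      unfolding mean0 by (subst I(1)) (auto simp: \<sigma> divide_inverse mult.commute)
  qed auto
  also have "char (distr (tilted_measure R l) borel (\<lambda>\<omega>. Y \<omega> - c)) \<theta> = tilted_char R l c \<theta>"
    unfolding char_def by (subst integral_distr) (auto simp: tilted_char_eq[OF mgf])
  also have "Q.expectation (\<lambda>\<omega>. min (6 * (Y \<omega> - c)\<^sup>2) (\<bar>\<theta>\<bar> * \<bar>Y \<omega> - c\<bar> ^ 3))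
      = (\<integral>\<omega>. W R l \<omega> * min (6 * (Y \<omega> - c)\<^sup>2) (\<bar>\<theta>\<bar> * \<bar>Y \<omega> - c\<bar> ^ 3) \<partial>M) / mgf R l"
    by (subst I(1)) (auto simp: divide_inverse mult.commute)
  finally show ?thesis .
qed

text \<open>Below the level \<open>y\<close> the cubic branch gains the factor
  \<open>\<bar>\<theta>\<bar> * (y + \<bar>c\<bar>)\<close>; above it,
  \<open>6 * (Y - c)^2 \<le> 12 * Y^2 + 12 * c^2\<close> isolates the uncentred tail to which
  \<open>second_moment_tail\<close> applies.\<close>

lemma lindeberg_bound:
  assumes l: "0 < l" and y: "0 \<le> y"
  shows "(\<integral>\<omega>. W R l \<omega> * min (6 * (Y \<omega> - c)\<^sup>2) (\<bar>\<theta>\<bar> * \<bar>Y \<omega> - c\<bar> ^ 3) \<partial>M)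
    \<le> \<bar>\<theta>\<bar> * (y + \<bar>c\<bar>) * (\<integral>\<omega>. W R l \<omega> * (Y \<omega> - c)\<^sup>2 \<partial>M)
      + 12 * (\<integral>\<omega>. (Y \<omega>)\<^sup>2 * W R l \<omega> * indicator {\<omega>. y < \<bar>Y \<omega>\<bar>} \<omega> \<partial>M) + 12 * c\<^sup>2 * mgf R l"
proof -
  note int = second_central_integrable(1)[OF l, of R c]
  have intt: "integrable M (\<lambda>\<omega>. (Y \<omega>)\<^sup>2 * W R l \<omega> * indicator {\<omega>. y < \<bar>Y \<omega>\<bar>} \<omega>)"
    by (rule Bochner_Integration.integrable_bound[OF second_moment_integrable[OF l, of R]])
       (auto split: split_indicator simp: W_nonneg)
  have "(\<integral>\<omega>. W R l \<omega> * min (6 * (Y \<omega> - c)\<^sup>2) (\<bar>\<theta>\<bar> * \<bar>Y \<omega> - c\<bar> ^ 3) \<partial>M)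
    \<le> (\<integral>\<omega>. \<bar>\<theta>\<bar> * (y + \<bar>c\<bar>) * (W R l \<omega> * (Y \<omega> - c)\<^sup>2)
      + 12 * ((Y \<omega>)\<^sup>2 * W R l \<omega> * indicator {\<omega>. y < \<bar>Y \<omega>\<bar>} \<omega>) + 12 * c\<^sup>2 * W R l \<omega> \<partial>M)"
  proof (intro integral_mono Bochner_Integration.integrable_add integrable_mult_right int intt W_integrable)
    show "integrable M (\<lambda>\<omega>. W R l \<omega> * min (6 * (Y \<omega> - c)\<^sup>2) (\<bar>\<theta>\<bar> * \<bar>Y \<omega> - c\<bar> ^ 3))"
    proof (rule Bochner_Integration.integrable_bound[OF integrable_mult_right[OF int, of 6]])
      have "W R l \<omega> * min (6 * (Y \<omega> - c)\<^sup>2) (\<bar>\<theta>\<bar> * \<bar>Y \<omega> - c\<bar> ^ 3) \<le> W R l \<omega> * (6 * (Y \<omega> - c)\<^sup>2)" for \<omega>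
        by (intro mult_left_mono W_nonneg) simp
      then show "AE \<omega> in M. norm (W R l \<omega> * min (6 * (Y \<omega> - c)\<^sup>2) (\<bar>\<theta>\<bar> * \<bar>Y \<omega> - c\<bar> ^ 3))
          \<le> norm (6 * (W R l \<omega> * (Y \<omega> - c)\<^sup>2))"
        by (intro AE_I2) (auto simp: W_nonneg abs_mult mult_ac)
    qed auto
    fix \<omega>
    show "W R l \<omega> * min (6 * (Y \<omega> - c)\<^sup>2) (\<bar>\<theta>\<bar> * \<bar>Y \<omega> - c\<bar> ^ 3)
      \<le> \<bar>\<theta>\<bar> * (y + \<bar>c\<bar>) * (W R l \<omega> * (Y \<omega> - c)\<^sup>2)
      + 12 * ((Y \<omega>)\<^sup>2 * W R l \<omega> * indicator {\<omega>. y < \<bar>Y \<omega>\<bar>} \<omega>) + 12 * c\<^sup>2 * W R l \<omega>"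
    proof (cases "y < \<bar>Y \<omega>\<bar>")
      case True
      have "0 \<le> (Y \<omega> + c)\<^sup>2" by simp
      then have "6 * (Y \<omega> - c)\<^sup>2 \<le> 12 * (Y \<omega>)\<^sup>2 + 12 * c\<^sup>2"
        by (simp add: power2_eq_square algebra_simps)
      then have "min (6 * (Y \<omega> - c)\<^sup>2) (\<bar>\<theta>\<bar> * \<bar>Y \<omega> - c\<bar> ^ 3) \<le> 12 * (Y \<omega>)\<^sup>2 + 12 * c\<^sup>2" by simp
      then have "W R l \<omega> * min (6 * (Y \<omega> - c)\<^sup>2) (\<bar>\<theta>\<bar> * \<bar>Y \<omega> - c\<bar> ^ 3)
          \<le> W R l \<omega> * (12 * (Y \<omega>)\<^sup>2 + 12 * c\<^sup>2)"
        by (intro mult_left_mono W_nonneg)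
      moreover have "0 \<le> \<bar>\<theta>\<bar> * (y + \<bar>c\<bar>) * (W R l \<omega> * (Y \<omega> - c)\<^sup>2)"
        using y W_nonneg by simp
      ultimately show ?thesis using True by (simp add: algebra_simps)
    next
      case False
      have "\<bar>Y \<omega> - c\<bar> ^ 3 = \<bar>Y \<omega> - c\<bar> * (Y \<omega> - c)\<^sup>2"
        by (simp add: power3_eq_cube power2_eq_square flip: abs_mult)
      also have "\<dots> \<le> (y + \<bar>c\<bar>) * (Y \<omega> - c)\<^sup>2" using False by (intro mult_right_mono) auto
      finally have "\<bar>\<theta>\<bar> * \<bar>Y \<omega> - c\<bar> ^ 3 \<le> \<bar>\<theta>\<bar> * ((y + \<bar>c\<bar>) * (Y \<omega> - c)\<^sup>2)"
        by (intro mult_left_mono) auto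
      then have "W R l \<omega> * min (6 * (Y \<omega> - c)\<^sup>2) (\<bar>\<theta>\<bar> * \<bar>Y \<omega> - c\<bar> ^ 3)
          \<le> W R l \<omega> * (\<bar>\<theta>\<bar> * ((y + \<bar>c\<bar>) * (Y \<omega> - c)\<^sup>2))"
        by (intro mult_left_mono W_nonneg) auto
      moreover have "0 \<le> c\<^sup>2 * W R l \<omega>" using W_nonneg by simp
      ultimately show ?thesis using False by (simp add: mult_ac)
    qed
  qed (use l in auto)
  also have "\<dots> = \<bar>\<theta>\<bar> * (y + \<bar>c\<bar>) * (\<integral>\<omega>. W R l \<omega> * (Y \<omega> - c)\<^sup>2 \<partial>M)
      + 12 * (\<integral>\<omega>. (Y \<omega>)\<^sup>2 * W R l \<omega> * indicator {\<omega>. y < \<bar>Y \<omega>\<bar>} \<omega> \<partial>M) + 12 * c\<^sup>2 * mgf R l"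
    using l by (simp add: int intt W_integrable mgf_def)
  finally show ?thesis .
qed

end

text \<open>In the unit disc \<open>n\<close>-th powers differ by at most \<open>n\<close> times the
  difference of the bases, so \<open>\<psi> n\<close> may be replaced by
  \<open>exp (- \<tau> n / n)\<close>, whose distance from \<open>1 - \<tau> n / n\<close> is at
  most \<open>(\<tau> n / n)^2\<close>.\<close>

lemma power_exp_limit:
  fixes \<psi> :: "nat \<Rightarrow> complex" and \<tau> :: "nat \<Rightarrow> real"
  assumes le1: "\<forall>\<^sub>F n in sequentially. cmod (\<psi> n) \<le> 1"
    and near: "(\<lambda>n. real n * cmod (\<psi> n - complex_of_real (1 - \<tau> n / real n))) \<longlonglongrightarrow> 0"
    and \<tau>: "\<tau> \<longlonglongrightarrow> \<tau>0" "\<forall>\<^sub>F n in sequentially. 0 \<le> \<tau> n"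
  shows "(\<lambda>n. \<psi> n ^ n) \<longlonglongrightarrow> complex_of_real (exp (- \<tau>0))"
proof -
  have n0: "(\<lambda>n. \<tau> n / real n) \<longlonglongrightarrow> 0"
    by (rule real_tendsto_divide_at_top[OF \<tau>(1)]) (rule filterlim_real_sequentially)
  have lim: "(\<lambda>n. real n * cmod (\<psi> n - complex_of_real (1 - \<tau> n / real n)) + \<tau> n * (\<tau> n / real n)) \<longlonglongrightarrow> 0 + \<tau>0 * 0"
    by (intro tendsto_intros near \<tau> n0)
  have "(\<lambda>n. \<psi> n ^ n - complex_of_real (exp (- \<tau> n / n)) ^ n) \<longlonglongrightarrow> 0"
  proof (rule Lim_null_comparison)
    show "(\<lambda>n. real n * cmod (\<psi> n - complex_of_real (1 - \<tau> n / real n)) + \<tau> n * (\<tau> n / real n)) \<longlonglongrightarrow> 0"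
      using lim by simp
    show "\<forall>\<^sub>F n in sequentially. norm (\<psi> n ^ n - complex_of_real (exp (- \<tau> n / n)) ^ n)
       \<le> real n * cmod (\<psi> n - complex_of_real (1 - \<tau> n / real n)) + \<tau> n * (\<tau> n / real n)"
      using le1 \<tau>(2) order_tendstoD(2)[OF n0 zero_less_one] eventually_gt_at_top[of 0]
    proof eventually_elim
      case (elim n)
      define z where "z = \<tau> n / n"
      have z: "0 \<le> z" "z < 1" using elim by (auto simp: z_def)
      \<comment> \<open>Since \<open>(1 + z) * (1 - z + z^2) = 1 + z^3\<close>, dividing by
        \<open>1 + z\<close> yields the upper bound on \<open>exp (- z)\<close>; the lower one is
        the tangent line.\<close>
      have "(1 + z) * exp (- z) \<le> exp z * exp (- z)"
        by (intro mult_right_mono exp_ge_add_one_self) auto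
      also have "\<dots> = 1" by (simp flip: exp_add)
      also have "1 \<le> (1 + z) * (1 - z + z\<^sup>2)"
        using z by (simp add: algebra_simps power2_eq_square)
      finally have "exp (- z) \<le> 1 - z + z\<^sup>2" using z by simp
      then have e: "\<bar>exp (- z) - (1 - z)\<bar> \<le> z\<^sup>2"
        using exp_ge_add_one_self[of "- z"] by (simp add: abs_le_iff)
      have "norm (\<psi> n ^ n - complex_of_real (exp (- z)) ^ n)
          \<le> real n * cmod (\<psi> n - complex_of_real (exp (- z)))"
        using elim z by (intro norm_power_diff) auto
      also have "cmod (\<psi> n - complex_of_real (exp (- z)))
          \<le> cmod (\<psi> n - complex_of_real (1 - z)) + cmod (complex_of_real (1 - z) - complex_of_real (exp (- z)))"
        using norm_triangle_ineq[of "\<psi> n - complex_of_real (1 - z)" "complex_of_real (1 - z) - complex_of_real (exp (- z))"]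
        by simp
      also have "cmod (complex_of_real (1 - z) - complex_of_real (exp (- z))) \<le> z\<^sup>2"
        using e unfolding of_real_diff[symmetric] norm_of_real by (simp add: abs_minus_commute)
      finally have "norm (\<psi> n ^ n - complex_of_real (exp (- z)) ^ n)
          \<le> real n * (cmod (\<psi> n - complex_of_real (1 - z)) + z\<^sup>2)" by (simp add: mult_left_mono)
      also have "\<dots> = real n * cmod (\<psi> n - complex_of_real (1 - z)) + \<tau> n * z"
        using elim by (simp add: z_def power2_eq_square field_simps)
      finally show ?case by (simp add: z_def)
    qed
  qed
  moreover have "(\<lambda>n. complex_of_real (exp (- \<tau> n / n)) ^ n) \<longlonglongrightarrow> complex_of_real (exp (- \<tau>0))"
  proof (rule Lim_transform_eventually)
    show "(\<lambda>n. complex_of_real (exp (- \<tau> n))) \<longlonglongrightarrow> complex_of_real (exp (- \<tau>0))"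
      by (intro tendsto_intros \<tau>)
    show "\<forall>\<^sub>F n in sequentially. complex_of_real (exp (- \<tau> n)) = complex_of_real (exp (- \<tau> n / n)) ^ n"
      using eventually_gt_at_top[of 0]
      by eventually_elim (simp flip: of_real_power exp_of_nat_mult)
  qed
  ultimately show ?thesis using Lim_transform by fastforce
qed

section \<open>Tilted sums\<close>

text \<open>\<open>R\<close> is the truncation level for \<open>Y\<close> and \<open>t\<close> the
  prescribed tilted mean. \<open>R_le\<close> keeps the largest positive jumps at most of the order
  of the standard deviation, as Lindeberg's condition requires; \<open>B_le\<close> lets exponential
  decay in \<open>n\<close> at far frequencies be read as decay in
  \<open>\<bar>\<theta>\<bar> * B n\<close>; \<open>nonlattice\<close> is aperiodicity in Fourier
  terms.\<close>

locale tilted_sequence = slowly_varying_variance +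
  fixes R l t :: "nat \<Rightarrow> real" and A C :: real
  assumes R_lim: "filterlim R at_top sequentially"
    and tilt: "\<forall>\<^sub>F n in sequentially. 0 < l n \<and> 1 / 2 \<le> l n * R n \<and> l n * R n \<le> 2
        \<and> dmgf (R n) (l n) / mgf (R n) (l n) = t n"
    and t_lim: "t \<longlonglongrightarrow> 0"
    and A_pos: "0 < A" and R_le: "\<forall>\<^sub>F n in sequentially. R n \<le> A * sqrt (real n * V (R n))"
    and C_pos: "0 < C" and B_le: "\<forall>\<^sub>F n in sequentially. sqrt (real n * V (R n)) \<le> C * real n"
    and nonlattice: "\<And>\<theta>. 0 < \<bar>\<theta>\<bar> \<Longrightarrow> \<bar>\<theta>\<bar> \<le> pi \<Longrightarrow> cmod (CLINT \<omega>|M. iexp (\<theta> * Y \<omega>)) < 1"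
begin

text \<open>By \<open>\<sigma>_lim\<close>, the standard deviation of the tilted sum up to a factor
  tending to 1.\<close>

definition B :: "nat \<Rightarrow> real" where
  "B n = sqrt (real n * V (R n))"

definition \<psi> :: "nat \<Rightarrow> real \<Rightarrow> complex" where
  "\<psi> n \<theta> = tilted_char (R n) (l n) (t n) \<theta>"

lemma tilt_simple: "\<forall>\<^sub>F n in sequentially. 0 \<le> l n \<and> l n * R n \<le> 2"
  using tilt by eventually_elim auto

lemma mgf_lim: "(\<lambda>n. mgf (R n) (l n)) \<longlonglongrightarrow> 1"
  by (rule mgf_tendsto[OF R_lim tilt_simple])

lemma regular:
  "\<forall>\<^sub>F n in sequentially. 0 < n \<and> 0 < R n \<and> 0 < V (R n) \<and> 0 < B n \<and> 0 < l n \<and> l n * R n \<le> 2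
     \<and> 0 < mgf (R n) (l n) \<and> mgf (R n) (l n) \<le> 2 \<and> t n = dmgf (R n) (l n) / mgf (R n) (l n)
     \<and> R n \<le> A * B n \<and> B n \<le> C * real n"
proof -
  have "\<forall>\<^sub>F n in sequentially. 0 < mgf (R n) (l n)" "\<forall>\<^sub>F n in sequentially. mgf (R n) (l n) < 2"
    by (intro order_tendstoD[OF mgf_lim]; simp)+
  then show ?thesis
    using tilt R_le B_le eventually_compose_filterlim[OF V_eventually_pos R_lim]
      eventually_compose_filterlim[OF eventually_gt_at_top[of 0] R_lim] eventually_gt_at_top[of 0]
    by eventually_elim (auto simp: B_def)
qed

lemma V_bounded_below: "\<exists>v>0. \<forall>\<^sub>F n in sequentially. v \<le> V (R n)"
proof -
  obtain y where "0 < V y" using eventually_happens[OF V_eventually_pos] by auto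
  moreover have "\<forall>\<^sub>F n in sequentially. V y \<le> V (R n)"
    using eventually_compose_filterlim[OF eventually_ge_at_top[of y] R_lim]
    by eventually_elim (rule V_mono)
  ultimately show ?thesis by blast
qed

text \<open>The squared tilted mean separates the central from the raw second moment; it vanishes
  relative to \<open>V (R n)\<close> because the monotone \<open>V\<close> stays away from
  0.\<close>

lemma t2_V_lim: "(\<lambda>n. (t n)\<^sup>2 / V (R n)) \<longlonglongrightarrow> 0"
proof -
  obtain v where v: "v > 0" "\<forall>\<^sub>F n in sequentially. v \<le> V (R n)" using V_bounded_below by blast
  have "(\<lambda>n. (t n)\<^sup>2 / v) \<longlonglongrightarrow> 0\<^sup>2 / v" using v by (intro tendsto_intros t_lim) auto
  then have lim: "(\<lambda>n. (t n)\<^sup>2 / v) \<longlonglongrightarrow> 0" by simp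
  show ?thesis
    by (rule Lim_null_comparison[OF _ lim])
       (use v(2) in eventually_elim, use v(1) in \<open>auto intro!: divide_left_mono\<close>)
qed

lemma inverse_B_lim: "(\<lambda>n. inverse (B n)) \<longlonglongrightarrow> 0"
proof (rule tendsto_inverse_0_at_top)
  have "filterlim (\<lambda>n. inverse A * R n) at_top sequentially"
    using A_pos by (intro filterlim_tendsto_pos_mult_at_top[OF tendsto_const] R_lim) auto
  then show "filterlim B at_top sequentially"
    by (rule filterlim_at_top_mono) (use regular in eventually_elim, use A_pos in \<open>auto simp: field_simps\<close>)
qed

text \<open>A variance in spite of the letter: that of the tilted law, whose mean is eventually
  \<open>t n\<close>.\<close>

definition \<sigma> :: "nat \<Rightarrow> real" where
  "\<sigma> n = (\<integral>\<omega>. W (R n) (l n) \<omega> * (Y \<omega> - t n)\<^sup>2 \<partial>M) / mgf (R n) (l n)"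

lemma \<sigma>_lim: "(\<lambda>n. \<sigma> n / V (R n)) \<longlonglongrightarrow> 1"
proof -
  have "(\<lambda>n. (\<integral>\<omega>. (Y \<omega>)\<^sup>2 * W (R n) (l n) \<omega> \<partial>M) / V (R n) / mgf (R n) (l n) - (t n)\<^sup>2 / V (R n))
      \<longlonglongrightarrow> 1 / 1 - 0"
    by (intro tendsto_diff tendsto_divide second_moment_tendsto[OF R_lim, of 2 _ 2] mgf_lim t2_V_lim)
       (use tilt in \<open>auto elim!: eventually_mono\<close>)
  moreover have "\<forall>\<^sub>F n in sequentially. (\<integral>\<omega>. (Y \<omega>)\<^sup>2 * W (R n) (l n) \<omega> \<partial>M) / V (R n) / mgf (R n) (l n)
      - (t n)\<^sup>2 / V (R n) = \<sigma> n / V (R n)"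
    using regular
  proof eventually_elim
    case (elim n)
    then have d: "dmgf (R n) (l n) = t n * mgf (R n) (l n)" by simp
    show ?case
      using elim unfolding \<sigma>_def by (subst second_central_integrable) (auto simp: d power2_eq_square field_simps)
  qed
  ultimately show ?thesis by (auto elim: Lim_transform_eventually)
qed

text \<open>The error of one factor, multiplied by \<open>n\<close>, is
  \<open>n * \<theta>^2 = s^2 / V (R n)\<close> times the Lindeberg quantity. Jumps up to
  \<open>\<epsilon> * R n\<close> are at most \<open>\<epsilon> * A\<close> on the scale
  \<open>B n\<close> by \<open>R_le\<close>; those beyond fall to
  \<open>second_moment_tail\<close>.\<close>

lemma clt: "(\<lambda>n. \<psi> n (s / B n) ^ n) \<longlonglongrightarrow> complex_of_real (exp (- (s\<^sup>2 / 2)))"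
  proof (rule power_exp_limit[where \<tau> = "\<lambda>n. s\<^sup>2 / 2 * (\<sigma> n / V (R n))"])
    show "\<forall>\<^sub>F n in sequentially. cmod (\<psi> n (s / B n)) \<le> 1"
      using regular by eventually_elim (auto simp: \<psi>_def intro!: tilted_char_le_1)
    have "(\<lambda>n. s\<^sup>2 / 2 * (\<sigma> n / V (R n))) \<longlonglongrightarrow> s\<^sup>2 / 2 * 1"
      by (intro tendsto_intros \<sigma>_lim)
    then show "(\<lambda>n. s\<^sup>2 / 2 * (\<sigma> n / V (R n))) \<longlonglongrightarrow> s\<^sup>2 / 2" by simp
    show "\<forall>\<^sub>F n in sequentially. 0 \<le> s\<^sup>2 / 2 * (\<sigma> n / V (R n))"
      using regular by eventually_elim (auto simp: \<sigma>_def W_nonneg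
          intro!: divide_nonneg_pos Bochner_Integration.integral_nonneg mult_nonneg_nonneg)
    show "(\<lambda>n. real n * cmod (\<psi> n (s / B n) - complex_of_real (1 - s\<^sup>2 / 2 * (\<sigma> n / V (R n)) / real n))) \<longlonglongrightarrow> 0"
    proof (rule tendstoI)
      fix e :: real assume e: "0 < e"
      \<comment> \<open>The limit of \<open>?h\<close> below is
        \<open>s^2 * \<bar>s\<bar> * \<epsilon> * A / 6\<close>, which this choice brings under
        \<open>e\<close>; the added 1 covers \<open>s = 0\<close>.\<close>
      define \<epsilon> where "\<epsilon> = e / (s\<^sup>2 * \<bar>s\<bar> * A + 1)"
      have pos: "0 < s\<^sup>2 * \<bar>s\<bar> * A + 1" using A_pos by (intro add_nonneg_pos mult_nonneg_nonneg) auto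
      have \<epsilon>: "0 < \<epsilon>" using e pos by (simp add: \<epsilon>_def)
      let ?tail = "\<lambda>n. \<integral>\<omega>. (Y \<omega>)\<^sup>2 * W (R n) (l n) \<omega> * indicator {\<omega>. \<epsilon> * R n < \<bar>Y \<omega>\<bar>} \<omega> \<partial>M"
      let ?h = "\<lambda>n. s\<^sup>2 / 6 * (\<bar>s\<bar> * (\<epsilon> * A + \<bar>t n\<bar> * inverse (B n)) * (\<sigma> n / V (R n))
          + 12 * (?tail n / V (R n) / mgf (R n) (l n)) + 12 * ((t n)\<^sup>2 / V (R n)))"
      have "?h \<longlonglongrightarrow> s\<^sup>2 / 6 * (\<bar>s\<bar> * (\<epsilon> * A + \<bar>0\<bar> * 0) * 1 + 12 * (0 / 1) + 12 * 0)"
        by (intro tendsto_intros t_lim inverse_B_lim \<sigma>_lim t2_V_lim mgf_lim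
              second_moment_tail[OF R_lim, of 2 _ 2] \<epsilon>)
           (use tilt in \<open>auto elim!: eventually_mono\<close>)
      moreover have "s\<^sup>2 / 6 * (\<bar>s\<bar> * (\<epsilon> * A + \<bar>0\<bar> * 0) * 1 + 12 * (0 / 1) + 12 * 0) < e"
      proof -
        have "s\<^sup>2 * \<bar>s\<bar> * A * \<epsilon> < e" using e pos by (simp add: \<epsilon>_def field_simps)
        then show ?thesis using e by (simp add: mult_ac)
      qed
      ultimately have "\<forall>\<^sub>F n in sequentially. ?h n < e" by (rule order_tendstoD)
      then show "\<forall>\<^sub>F n in sequentially.
          dist (real n * cmod (\<psi> n (s / B n) - complex_of_real (1 - s\<^sup>2 / 2 * (\<sigma> n / V (R n)) / real n))) 0 < e"
        using regular
      proof eventually_elim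
        case (elim n)
        define \<theta> where "\<theta> = s / B n"
        define m where "m = mgf (R n) (l n)"
        define L where "L = (\<integral>\<omega>. W (R n) (l n) \<omega> * min (6 * (Y \<omega> - t n)\<^sup>2) (\<bar>\<theta>\<bar> * \<bar>Y \<omega> - t n\<bar> ^ 3) \<partial>M)"
        have reg: "0 < l n" "0 < m" "0 < n" "0 < R n" "0 < V (R n)" "0 < B n" "R n \<le> A * B n"
          "t n = dmgf (R n) (l n) / m" using elim by (auto simp: m_def)
        have n\<theta>: "real n * \<theta>\<^sup>2 = s\<^sup>2 / V (R n)"
          using reg by (simp add: \<theta>_def B_def power_divide)
        have \<sigma>m: "(\<integral>\<omega>. W (R n) (l n) \<omega> * (Y \<omega> - t n)\<^sup>2 \<partial>M) = \<sigma> n * m"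
          using reg by (simp add: \<sigma>_def m_def)
        have \<sigma>0: "0 \<le> \<sigma> n" unfolding \<sigma>_def using reg
          by (auto simp: W_nonneg m_def intro!: divide_nonneg_pos Bochner_Integration.integral_nonneg mult_nonneg_nonneg)
        have th: "\<theta>\<^sup>2 * \<sigma> n / 2 = s\<^sup>2 / 2 * (\<sigma> n / V (R n)) / n"
        proof -
          have "\<theta>\<^sup>2 = s\<^sup>2 / V (R n) / n" using n\<theta> reg by (simp add: field_simps)
          then show ?thesis by simp
        qed
        have alg: "s\<^sup>2 / v / 6 * ((x * (\<sigma> n * m) + 12 * y + 12 * z * m) / m)
            = s\<^sup>2 / 6 * (x * (\<sigma> n / v) + 12 * (y / v / m) + 12 * (z / v))" if "0 < v" for v x y z
          using that reg(2) by (simp add: field_simps)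
        have "cmod (\<psi> n \<theta> - complex_of_real (1 - \<theta>\<^sup>2 * \<sigma> n / 2)) \<le> \<theta>\<^sup>2 / 6 * (L / m)"
          using tilted_char_approx[of "l n" "R n" "t n" "\<sigma> n" \<theta>] reg
          by (simp add: \<psi>_def L_def \<sigma>_def m_def)
        then have "real n * cmod (\<psi> n \<theta> - complex_of_real (1 - \<theta>\<^sup>2 * \<sigma> n / 2))
            \<le> real n * (\<theta>\<^sup>2 / 6 * (L / m))" by (intro mult_left_mono) auto
        also have "\<dots> = (real n * \<theta>\<^sup>2) / 6 * (L / m)" by simp
        also have "\<dots> = s\<^sup>2 / V (R n) / 6 * (L / m)" by (simp only: n\<theta>)
        also have "L \<le> \<bar>\<theta>\<bar> * (\<epsilon> * R n + \<bar>t n\<bar>) * (\<sigma> n * m) + 12 * ?tail n + 12 * (t n)\<^sup>2 * m"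
          unfolding L_def \<sigma>m[symmetric] unfolding m_def
          using reg(1,4) \<epsilon> by (intro lindeberg_bound) auto
        also have "\<bar>\<theta>\<bar> * (\<epsilon> * R n + \<bar>t n\<bar>) \<le> \<bar>s\<bar> * (\<epsilon> * A + \<bar>t n\<bar> * inverse (B n))"
        proof -
          have "\<bar>\<theta>\<bar> * (\<epsilon> * R n + \<bar>t n\<bar>) \<le> \<bar>\<theta>\<bar> * (\<epsilon> * (A * B n) + \<bar>t n\<bar>)"
            using reg \<epsilon> by (intro mult_left_mono add_right_mono) auto
          also have "\<dots> = \<bar>s\<bar> * (\<epsilon> * A + \<bar>t n\<bar> * inverse (B n))"
            using reg(6) by (simp add: \<theta>_def field_simps)
          finally show ?thesis .
        qed
        also have "s\<^sup>2 / V (R n) / 6 * ((\<bar>s\<bar> * (\<epsilon> * A + \<bar>t n\<bar> * inverse (B n)) * (\<sigma> n * m)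
             + 12 * ?tail n + 12 * (t n)\<^sup>2 * m) / m) = ?h n"
          unfolding m_def[symmetric] by (rule alg[OF reg(5)])
        finally have "real n * cmod (\<psi> n \<theta> - complex_of_real (1 - \<theta>\<^sup>2 * \<sigma> n / 2)) \<le> ?h n"
          using reg \<sigma>0 by (simp add: divide_right_mono mult_left_mono mult_right_mono)
        then show ?case using elim(1) unfolding th by (simp add: \<theta>_def)
      qed
    qed
  qed

end

text \<open>From \<open>sin y \<ge> 5/6 * y\<close> on \<open>[0, 1]\<close>:
  \<open>1 - cos u\<close> is twice the square of \<open>sin (u / 2)\<close>, hence at least
  \<open>25/72 * u^2\<close>, slightly more than a third of \<open>u^2\<close>.\<close>

lemma one_minus_cos_ge:
  fixes u :: real assumes "\<bar>u\<bar> \<le> 2" shows "u\<^sup>2 / 3 \<le> 1 - cos u"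
proof -
  have half: "\<bar>u / 2\<bar> \<le> 1" using assms by simp
  have s: "5 / 6 * \<bar>x\<bar> \<le> \<bar>sin x\<bar>" if "\<bar>x\<bar> \<le> 1" for x :: real
  proof -
    have "5 / 6 * y \<le> sin y" if "0 \<le> y" "y \<le> 1" for y :: real
    proof -
      have "y ^ 3 \<le> y" using that power_decreasing[of 1 3 y] by simp
      then have "5 / 6 * y \<le> y - y ^ 3 / 6" by simp
      also have "\<dots> \<le> sin y"
      proof (cases "y = 0")
        case False
        \<comment> \<open>The fifth-order remainder is \<open>cos t * y ^ 5 / 120\<close>,
          nonnegative because \<open>t < 1\<close>, so it may be dropped from a lower bound.\<close>
        then have "\<exists>t>0. t < y \<and>
          sin y = (\<Sum>m<5. sin_coeff m * y ^ m) + sin (t + 1/2 * real 5 * pi) / fact 5 * y ^ 5"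
          using that by (intro Maclaurin_sin_expansion3) auto
        then obtain t where "0 < t" "t < y"
          "sin y = (\<Sum>m<5. sin_coeff m * y ^ m) + sin (t + 1/2 * real 5 * pi) / fact 5 * y ^ 5"
          by blast
        moreover have "(\<Sum>m<5. sin_coeff m * y ^ m) = y - y ^ 3 / 6"
          by (simp add: sin_coeff_def lessThan_nat_numeral lessThan_Suc fact_numeral)
        moreover have "sin (t + 1/2 * real 5 * pi) = cos t"
        proof -
          have "sin (t + 1/2 * real 5 * pi) = sin ((t + pi / 2) + 2 * pi)" by (simp add: algebra_simps)
          then show ?thesis by (simp only: sin_periodic) (simp add: sin_add)
        qed
        moreover have "0 \<le> cos t"
          using \<open>0 < t\<close> \<open>t < y\<close> that pi_gt3 by (intro cos_ge_zero) auto
        ultimately show ?thesis using that by simp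
      qed simp
      finally show ?thesis .
    qed
    from this[of "\<bar>x\<bar>"] that show ?thesis by (cases "0 \<le> x") auto
  qed
  have "(5 / 6 * \<bar>u / 2\<bar>)\<^sup>2 \<le> \<bar>sin (u / 2)\<bar>\<^sup>2"
    using s[OF half] by (intro power_mono) auto
  then have "25 / 144 * u\<^sup>2 \<le> (sin (u / 2))\<^sup>2"
    by (simp add: power_mult_distrib power_divide)
  moreover have "1 - cos u = 2 * (sin (u / 2))\<^sup>2"
    using cos_double_sin[of "u / 2"] by simp
  moreover have "0 \<le> u\<^sup>2" by simp
  ultimately show ?thesis by linarith
qed

text \<open>For \<open>\<bar>a\<bar> > 1\<close> the right-hand side is bounded below by a constant, so the shift may be dropped.\<close>

lemma one_minus_cos_shift_ge:
  fixes z a :: real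
  assumes "\<bar>z\<bar> \<le> 1 / 10" "\<bar>a\<bar> \<le> pi"
  shows "(z - (if \<bar>a\<bar> \<le> 1 then a else 0))\<^sup>2 / 20 \<le> 1 - cos (z - a)"
proof (cases "\<bar>a\<bar> \<le> 1")
  case True
  have "(z - a)\<^sup>2 / 3 \<le> 1 - cos (z - a)" using assms True by (intro one_minus_cos_ge) auto
  moreover have "(z - a)\<^sup>2 / 20 \<le> (z - a)\<^sup>2 / 3" by simp
  ultimately have "(z - a)\<^sup>2 / 20 \<le> 1 - cos (z - a)" by linarith
  then show ?thesis by (simp only: True if_True)
next
  case False
  define v where "v = \<bar>z - a\<bar>"
  have v: "9 / 10 \<le> v" "v \<le> pi + 1 / 10" using assms False by (auto simp: v_def abs_if split: if_splits)
  \<comment> \<open>On \<open>[9/10, pi + 1/10]\<close> the cosine is at most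
    \<open>1 - 27/100\<close>: it decreases up to \<open>pi\<close> and is nonpositive just beyond.
    The gap 27/100 exceeds \<open>z^2 / 20\<close>, which is at most 1/2000.\<close>
  have "(9 / 10 :: real)\<^sup>2 / 3 \<le> 1 - cos (9 / 10)" by (intro one_minus_cos_ge) auto
  then have c: "cos (9 / 10 :: real) \<le> 73 / 100" by (simp add: power2_eq_square)
  have "cos v \<le> 73 / 100"
  proof (cases "v \<le> pi")
    case True
    then show ?thesis using cos_monotone_0_pi_le[of "9 / 10" v] v c by simp
  next
    case False
    have "cos v = - cos (v - pi)" by (simp add: cos_diff)
    moreover have "0 \<le> cos (v - pi)" using False v pi_gt3 by (intro cos_ge_zero) auto
    ultimately show ?thesis by simp
  qed
  then have "cos (z - a) \<le> 73 / 100" by (simp add: v_def)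
  moreover have "z\<^sup>2 \<le> (1 / 10)\<^sup>2" using assms by (simp add: abs_le_square_iff[symmetric])
  ultimately show ?thesis using False by (simp add: power2_eq_square)
qed

section \<open>Decay of the tilted characteristic function near zero\<close>

context slowly_varying_variance
begin

lemma tilted_char_norm: "cmod (tilted_char R l c \<theta>) = cmod (tilted_char R l 0 \<theta>)"
proof -
  have "complex_of_real (W R l \<omega>) * iexp (\<theta> * (Y \<omega> - c))
      = iexp (- \<theta> * c) * (complex_of_real (W R l \<omega>) * iexp (\<theta> * (Y \<omega> - 0)))" for \<omega>
    by (simp add: mult_ac flip: exp_add of_real_mult) (simp add: algebra_simps)
  then have "tilted_char R l c \<theta> = iexp (- \<theta> * c) * tilted_char R l 0 \<theta>"
    by (simp only: tilted_char_def integral_mult_right_zero times_divide_eq_right)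
  then show ?thesis by (simp add: norm_mult)
qed

definition truncated_prob :: "real \<Rightarrow> real" where
  "truncated_prob y = (\<integral>\<omega>. indicator {\<omega>. \<bar>Y \<omega>\<bar> \<le> y} \<omega> \<partial>M)"

definition truncated_mean :: "real \<Rightarrow> real" where
  "truncated_mean y = (\<integral>\<omega>. Y \<omega> * indicator {\<omega>. \<bar>Y \<omega>\<bar> \<le> y} \<omega> \<partial>M)"

lemma truncated_prob_integrable: "integrable M (\<lambda>\<omega>. indicator {\<omega>. \<bar>Y \<omega>\<bar> \<le> y} \<omega> :: real)"
  by (rule integrable_const_bound[where B = 1]) (auto split: split_indicator)

lemma truncated_mean_integrable: "integrable M (\<lambda>\<omega>. Y \<omega> * indicator {\<omega>. \<bar>Y \<omega>\<bar> \<le> y} \<omega>)"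
  by (rule Bochner_Integration.integrable_bound[OF Y_integrable]) (auto split: split_indicator)

text \<open>By centring, the truncated mean is minus the mean of what has been cut off.\<close>

lemma truncated_mean_le: "\<bar>truncated_mean y\<bar> \<le> T y"
proof -
  have int: "integrable M (\<lambda>\<omega>. Y \<omega> * indicator {\<omega>. y < \<bar>Y \<omega>\<bar>} \<omega>)"
    by (rule Bochner_Integration.integrable_bound[OF Y_integrable]) (auto split: split_indicator)
  have "truncated_mean y = (\<integral>\<omega>. Y \<omega> - Y \<omega> * indicator {\<omega>. y < \<bar>Y \<omega>\<bar>} \<omega> \<partial>M)"
    unfolding truncated_mean_def
    by (rule Bochner_Integration.integral_cong) (auto split: split_indicator)
  also have "\<dots> = - (\<integral>\<omega>. Y \<omega> * indicator {\<omega>. y < \<bar>Y \<omega>\<bar>} \<omega> \<partial>M)"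
    using int Y_integrable Y_centred by simp
  finally have "\<bar>truncated_mean y\<bar> \<le> (\<integral>\<omega>. \<bar>Y \<omega> * indicator {\<omega>. y < \<bar>Y \<omega>\<bar>} \<omega>\<bar> \<partial>M)"
    using integral_abs_bound[of M "\<lambda>\<omega>. Y \<omega> * indicator {\<omega>. y < \<bar>Y \<omega>\<bar>} \<omega>"] by simp
  then show ?thesis by (simp add: T_def abs_mult)
qed

lemma truncated_prob_ge:
  assumes "0 < y" shows "1 - T y / y \<le> truncated_prob y"
proof -
  have "(\<integral>\<omega>. 1 - \<bar>Y \<omega>\<bar> * indicator {\<omega>. y < \<bar>Y \<omega>\<bar>} \<omega> / y \<partial>M) \<le> truncated_prob y"
    unfolding truncated_prob_def
    using assms by (intro integral_mono Bochner_Integration.integrable_diff integrable_divide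
        T_integrable truncated_prob_integrable) (auto split: split_indicator simp: field_simps)
  then show ?thesis by (simp add: T_def T_integrable prob_space)
qed

text \<open>If \<open>a\<close> is the argument of the tilted characteristic function at \<open>\<theta>\<close>, then one minus its modulus
  is the tilted expectation of \<open>1 - cos (\<theta> * Y - a)\<close>. Only the event \<open>\<bar>Y\<bar> \<le> y\<close> is kept, where the
  tilting weight is bounded below.\<close>

lemma char_decay:
  obtains y1 \<kappa> where "0 < y1" "0 < \<kappa>"
    "\<And>R l y \<theta> c. y1 \<le> y \<Longrightarrow> y \<le> R \<Longrightarrow> 0 < l \<Longrightarrow> l * R \<le> 2 \<Longrightarrow> 0 < mgf R l \<Longrightarrow> mgf R l \<le> 2 \<Longrightarrow>
      \<bar>\<theta>\<bar> * y \<le> 1 / 10 \<Longrightarrow> \<kappa> * \<theta>\<^sup>2 * V y \<le> 1 - cmod (tilted_char R l c \<theta>)"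
proof -
  obtain v where v: "0 < v" "\<forall>\<^sub>F y in at_top. v \<le> V y"
  proof -
    obtain y where "0 < V y" using eventually_happens[OF V_eventually_pos] by auto
    moreover have "\<forall>\<^sub>F z in at_top. V y \<le> V z"
      using eventually_ge_at_top[of y] by eventually_elim (rule V_mono)
    ultimately show ?thesis using that by blast
  qed
  \<comment> \<open>Two smallness conditions for \<open>var\<close> in one constant:
    \<open>d \<le> 1/2\<close> leaves the event \<open>\<bar>Y\<bar> \<le> y\<close> probability at
    least 1/2, and \<open>d^2 \<le> v / 8\<close> makes the squared truncated mean at most
    \<open>V y / 8\<close>.\<close>
  define d where "d = min (1 / 2) (v / 4)"
  have d: "0 < d" "d \<le> 1 / 2" "d \<le> v / 4" using v by (auto simp: d_def)
  have "\<forall>\<^sub>F y in at_top. 1 \<le> y \<and> T y < d \<and> v \<le> V y"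
    using v(2) order_tendstoD(2)[OF T_tendsto d(1)] eventually_ge_at_top[of 1] by eventually_elim simp
  then obtain y1 where y1: "\<And>y. y1 \<le> y \<Longrightarrow> 1 \<le> y \<and> T y < d \<and> v \<le> V y"
    by (auto simp: eventually_at_top_linorder)
  \<comment> \<open>The 80 collects 20 from \<open>one_minus_cos_shift_ge\<close>, 2 from
    \<open>var\<close> and 2 from \<open>mgf R l \<le> 2\<close>; \<open>exp (- 2)\<close> is the
    lower bound of the weight, as \<open>l * Y \<ge> - l * R \<ge> - 2\<close> on the retained
    event.\<close>
  define \<kappa> where "\<kappa> = exp (- 2 :: real) / 80"
  \<comment> \<open>The point \<open>b\<close> is arbitrary because the argument of the
    characteristic function is not under control. As the truncated mean is small, completing the
    square shows that no shift removes more than half of \<open>\<theta>^2 * V y\<close>.\<close>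
  have var: "\<theta>\<^sup>2 * V y / 2 \<le> (\<integral>\<omega>. (\<theta> * Y \<omega> - b)\<^sup>2 * indicator {\<omega>. \<bar>Y \<omega>\<bar> \<le> y} \<omega> \<partial>M)"
    if y: "y1 \<le> y" for y b \<theta>
  proof -
    note yy = y1[OF y]
    define p where "p = truncated_prob y"
    define e where "e = truncated_mean y"
    have "T y / y \<le> T y / 1" using yy T_nonneg[of y] by (intro divide_left_mono) auto
    then have p: "1 / 2 \<le> p" using truncated_prob_ge[of y] yy d by (simp add: p_def)
    have "\<bar>e\<bar> \<le> d" using truncated_mean_le[of y] yy by (simp add: e_def)
    then have "e\<^sup>2 \<le> d\<^sup>2" using d by (simp add: abs_le_square_iff[symmetric])
    also have "\<dots> \<le> 1 / 2 * (v / 4)" unfolding power2_eq_square using d by (intro mult_mono) auto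
    also have "\<dots> \<le> V y / 8" using yy by simp
    finally have e: "8 * e\<^sup>2 \<le> V y" by simp
    have eq: "(\<theta> * Y \<omega> - b)\<^sup>2 * indicator {\<omega>. \<bar>Y \<omega>\<bar> \<le> y} \<omega>
        = \<theta>\<^sup>2 * ((Y \<omega>)\<^sup>2 * indicator {\<omega>. \<bar>Y \<omega>\<bar> \<le> y} \<omega>) - 2 * b * \<theta> * (Y \<omega> * indicator {\<omega>. \<bar>Y \<omega>\<bar> \<le> y} \<omega>)
          + b\<^sup>2 * indicator {\<omega>. \<bar>Y \<omega>\<bar> \<le> y} \<omega>" for \<omega>
      by (simp add: power2_diff algebra_simps)
    have "(\<integral>\<omega>. (\<theta> * Y \<omega> - b)\<^sup>2 * indicator {\<omega>. \<bar>Y \<omega>\<bar> \<le> y} \<omega> \<partial>M)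
        = \<theta>\<^sup>2 * V y - 2 * b * \<theta> * e + b\<^sup>2 * p"
      unfolding eq by (simp add: V_integrable truncated_mean_integrable truncated_prob_integrable
          V_def e_def p_def truncated_mean_def truncated_prob_def)
    moreover have "b\<^sup>2 * (1 / 2) \<le> b\<^sup>2 * p" using p by (intro mult_left_mono) auto
    moreover have "2 * b * \<theta> * e \<le> b\<^sup>2 * (1 / 2) + 2 * (\<theta>\<^sup>2 * e\<^sup>2)"
      using zero_le_power2[of "b - 2 * (\<theta> * e)"] by (simp add: power2_eq_square algebra_simps)
    moreover have "8 * (\<theta>\<^sup>2 * e\<^sup>2) \<le> \<theta>\<^sup>2 * V y"
      using mult_left_mono[OF e, of "\<theta>\<^sup>2"] by simp
    moreover have "0 \<le> \<theta>\<^sup>2 * e\<^sup>2" by simp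
    ultimately show ?thesis by linarith
  qed
  show ?thesis
  proof (rule that[of y1 \<kappa>])
    show "0 < y1" using y1[of y1] by simp
    show "0 < \<kappa>" by (simp add: \<kappa>_def)
    fix R l y \<theta> c :: real
    assume y: "y1 \<le> y" "y \<le> R" and l: "0 < l" "l * R \<le> 2" and m: "0 < mgf R l" "mgf R l \<le> 2"
      and \<theta>: "\<bar>\<theta>\<bar> * y \<le> 1 / 10"
    interpret Q: prob_space "tilted_measure R l" using l m by (intro tilted_measure_prob) auto
    define z where "z = tilted_char R l 0 \<theta>"
    define a where "a = Arg z"
    have a: "\<bar>a\<bar> \<le> pi" using Arg_bounded[of z] by (auto simp: a_def)
    define b where "b = (if \<bar>a\<bar> \<le> 1 then a else 0)"
    have iexp_int: "integrable (tilted_measure R l) (\<lambda>\<omega>. iexp (\<theta> * Y \<omega> - a))"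
      by (rule Q.integrable_const_bound[where B = 1]) auto
    have "cmod z = Re (exp (- (\<i> * a)) * z)"
    proof -
      have "z = complex_of_real (cmod z) * exp (\<i> * a)"
        unfolding a_def using Arg_eq[of z] by (cases "z = 0") auto
      then have "exp (- (\<i> * a)) * z = complex_of_real (cmod z) * (exp (- (\<i> * a)) * exp (\<i> * a))"
        by (metis mult.left_commute)
      then show ?thesis by (simp flip: exp_add)
    qed
    also have "exp (- (\<i> * a)) * z = (CLINT \<omega>|tilted_measure R l. iexp (\<theta> * Y \<omega> - a))"
      unfolding z_def tilted_char_eq[OF m(1)]
      by (subst integral_mult_right_zero[symmetric])
         (auto intro!: Bochner_Integration.integral_cong simp: algebra_simps simp flip: exp_add)
    also have "Re \<dots> = (\<integral>\<omega>. cos (\<theta> * Y \<omega> - a) \<partial>tilted_measure R l)"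
      by (subst integral_Re[symmetric, OF iexp_int]) (simp add: Re_exp)
    finally have "1 - cmod z = (\<integral>\<omega>. 1 - cos (\<theta> * Y \<omega> - a) \<partial>tilted_measure R l)"
    proof -
      assume *: "cmod z = (\<integral>\<omega>. cos (\<theta> * Y \<omega> - a) \<partial>tilted_measure R l)"
      have "integrable (tilted_measure R l) (\<lambda>\<omega>. cos (\<theta> * Y \<omega> - a))"
        by (rule Q.integrable_const_bound[where B = 1]) auto
      then show ?thesis unfolding * by (simp add: Q.prob_space)
    qed
    also have "\<dots> = (\<integral>\<omega>. W R l \<omega> * (1 - cos (\<theta> * Y \<omega> - a)) \<partial>M) / mgf R l"
      by (subst tilted_measure_integral(1)[OF _ m(1)]) (auto simp: divide_inverse)
    finally have eq: "1 - cmod z = (\<integral>\<omega>. W R l \<omega> * (1 - cos (\<theta> * Y \<omega> - a)) \<partial>M) / mgf R l" .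
    have "(\<integral>\<omega>. exp (- 2) / 20 * ((\<theta> * Y \<omega> - b)\<^sup>2 * indicator {\<omega>. \<bar>Y \<omega>\<bar> \<le> y} \<omega>) \<partial>M)
        \<le> (\<integral>\<omega>. W R l \<omega> * (1 - cos (\<theta> * Y \<omega> - a)) \<partial>M)"
    proof (rule integral_mono)
      have bd: "\<bar>(\<theta> * Y \<omega> - b)\<^sup>2 * indicator {\<omega>. \<bar>Y \<omega>\<bar> \<le> y} \<omega>\<bar> \<le> (\<bar>\<theta>\<bar> * \<bar>y\<bar> + \<bar>b\<bar>)\<^sup>2" for \<omega>
      proof (cases "\<bar>Y \<omega>\<bar> \<le> y")
        case True
        have "\<bar>\<theta> * Y \<omega> - b\<bar> \<le> \<bar>\<theta>\<bar> * \<bar>Y \<omega>\<bar> + \<bar>b\<bar>" using abs_triangle_ineq4[of "\<theta> * Y \<omega>" b] by (simp add: abs_mult)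
        also have "\<dots> \<le> \<bar>\<theta>\<bar> * \<bar>y\<bar> + \<bar>b\<bar>" using True by (intro add_right_mono mult_left_mono) auto
        finally have "\<bar>\<theta> * Y \<omega> - b\<bar>\<^sup>2 \<le> (\<bar>\<theta>\<bar> * \<bar>y\<bar> + \<bar>b\<bar>)\<^sup>2" by (intro power_mono) auto
        then show ?thesis using True by simp
      qed simp
      then show "integrable M (\<lambda>\<omega>. exp (- 2) / 20 * ((\<theta> * Y \<omega> - b)\<^sup>2 * indicator {\<omega>. \<bar>Y \<omega>\<bar> \<le> y} \<omega>))"
        by (intro integrable_mult_right integrable_const_bound[where B = "(\<bar>\<theta>\<bar> * \<bar>y\<bar> + \<bar>b\<bar>)\<^sup>2"]) auto
      show "integrable M (\<lambda>\<omega>. W R l \<omega> * (1 - cos (\<theta> * Y \<omega> - a)))"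
      proof (rule Bochner_Integration.integrable_bound[of M "\<lambda>\<omega>. 2 * W R l \<omega>"])
        have "\<bar>1 - cos x\<bar> \<le> 2" for x :: real using cos_ge_minus_one[of x] cos_le_one[of x] unfolding abs_le_iff by linarith
        then show "AE \<omega> in M. norm (W R l \<omega> * (1 - cos (\<theta> * Y \<omega> - a))) \<le> norm (2 * W R l \<omega>)"
          by (intro AE_I2) (simp add: abs_mult W_nonneg mult.commute[of "W _ _ _"] mult_right_mono)
      qed (use l W_integrable in auto)
      fix \<omega>
      show "exp (- 2) / 20 * ((\<theta> * Y \<omega> - b)\<^sup>2 * indicator {\<omega>. \<bar>Y \<omega>\<bar> \<le> y} \<omega>)
          \<le> W R l \<omega> * (1 - cos (\<theta> * Y \<omega> - a))"
      proof (cases "\<bar>Y \<omega>\<bar> \<le> y")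
        case True
        have "\<bar>\<theta> * Y \<omega>\<bar> \<le> \<bar>\<theta>\<bar> * y" using True by (simp add: abs_mult mult_left_mono)
        then have 1: "(\<theta> * Y \<omega> - b)\<^sup>2 / 20 \<le> 1 - cos (\<theta> * Y \<omega> - a)"
          unfolding b_def using \<theta> a by (intro one_minus_cos_shift_ge) auto
        have "l * (- R) \<le> l * Y \<omega>" using True y l by (intro mult_left_mono) auto
        then have "- 2 \<le> l * Y \<omega>" using l by simp
        then have 2: "exp (- 2) \<le> W R l \<omega>" using True y by (auto simp: W_def)
        have "exp (- 2) * ((\<theta> * Y \<omega> - b)\<^sup>2 / 20) \<le> W R l \<omega> * (1 - cos (\<theta> * Y \<omega> - a))"
          by (intro mult_mono 1 2 W_nonneg) auto
        then show ?thesis using True by simp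
      qed (simp add: W_nonneg)
    qed
    then have main: "exp (- 2) / 20 * (\<integral>\<omega>. (\<theta> * Y \<omega> - b)\<^sup>2 * indicator {\<omega>. \<bar>Y \<omega>\<bar> \<le> y} \<omega> \<partial>M) / mgf R l
        \<le> 1 - cmod z"
      using m unfolding eq integral_mult_right_zero by (intro divide_right_mono) auto
    have "\<kappa> * \<theta>\<^sup>2 * V y = exp (- 2) / 20 * (\<theta>\<^sup>2 * V y / 2) / 2" by (simp add: \<kappa>_def)
    also have "\<dots> \<le> exp (- 2) / 20 * (\<theta>\<^sup>2 * V y / 2) / mgf R l"
      using m V_nonneg by (intro divide_left_mono) auto
    also have "\<dots> \<le> exp (- 2) / 20 * (\<integral>\<omega>. (\<theta> * Y \<omega> - b)\<^sup>2 * indicator {\<omega>. \<bar>Y \<omega>\<bar> \<le> y} \<omega> \<partial>M) / mgf R l"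
      using m by (intro divide_right_mono mult_left_mono var y) auto
    also note main
    finally show "\<kappa> * \<theta>\<^sup>2 * V y \<le> 1 - cmod (tilted_char R l c \<theta>)"
      unfolding z_def tilted_char_norm[of R l c \<theta>] .
  qed
qed

end

section \<open>Uniform domination and the local limit theorem\<close>

context tilted_sequence
begin

text \<open>Apply \<open>char_decay\<close> with \<open>y = min (R n) (1 / (10 * \<bar>\<theta>\<bar>))\<close>; the loss from replacing \<open>V (R n)\<close>
  by \<open>V y\<close> is at most of order \<open>sqrt (R n * \<bar>\<theta>\<bar>)\<close> by \<open>V_potter\<close>.\<close>

lemma near_decay:
  obtains \<delta> k where "0 < \<delta>" "0 < k"
    "\<forall>\<^sub>F n in sequentially. \<forall>\<theta>. \<bar>\<theta>\<bar> \<le> \<delta> \<longrightarrow>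
       k * (\<bar>\<theta>\<bar> * B n - 1) \<le> real n * (1 - cmod (\<psi> n \<theta>))"
proof -
  obtain y1 \<kappa> where y1: "0 < y1" "0 < \<kappa>" and decay:
    "\<And>R l y \<theta> c. y1 \<le> y \<Longrightarrow> y \<le> R \<Longrightarrow> 0 < l \<Longrightarrow> l * R \<le> 2 \<Longrightarrow> 0 < mgf R l \<Longrightarrow> mgf R l \<le> 2 \<Longrightarrow>
      \<bar>\<theta>\<bar> * y \<le> 1 / 10 \<Longrightarrow> \<kappa> * \<theta>\<^sup>2 * V y \<le> 1 - cmod (tilted_char R l c \<theta>)"
    using char_decay by blast
  obtain y0 where y0: "0 < y0" "0 < V y0" and potter:
    "\<And>y z. y0 \<le> y \<Longrightarrow> y \<le> z \<Longrightarrow> V z \<le> 2 * sqrt (z / y) * V y" using V_potter by blast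
  define y2 where "y2 = max y0 y1"
  have y2: "0 < y2" "y0 \<le> y2" "y1 \<le> y2" using y0 y1 by (auto simp: y2_def)
  \<comment> \<open>Ensures that \<open>1 / (10 * \<bar>\<theta>\<bar>)\<close> is at least
    \<open>y2\<close>, the threshold from which both \<open>char_decay\<close> and
    \<open>V_potter\<close> are available.\<close>
  define \<delta> where "\<delta> = 1 / (10 * y2)"
  define q where "q = 2 * sqrt (10 * A)"
  have q: "0 < q" using A_pos by (simp add: q_def)
  define k where "k = min \<kappa> (\<kappa> / q)"
  have k: "0 < k" "k \<le> \<kappa>" "k * q \<le> \<kappa>" using y1 q by (auto simp: k_def min_def field_simps)
  show ?thesis
  proof (rule that[of \<delta> k])
    show "0 < \<delta>" using y2 by (simp add: \<delta>_def)
    show "0 < k" by (rule k)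
    show "\<forall>\<^sub>F n in sequentially. \<forall>\<theta>. \<bar>\<theta>\<bar> \<le> \<delta> \<longrightarrow>
       k * (\<bar>\<theta>\<bar> * B n - 1) \<le> real n * (1 - cmod (\<psi> n \<theta>))"
      using regular eventually_compose_filterlim[OF eventually_ge_at_top[of y2] R_lim]
    proof (eventually_elim, intro allI impI)
      fix n \<theta>
      assume n: "0 < n \<and> 0 < R n \<and> 0 < V (R n) \<and> 0 < B n \<and> 0 < l n \<and> l n * R n \<le> 2
        \<and> 0 < mgf (R n) (l n) \<and> mgf (R n) (l n) \<le> 2 \<and> t n = dmgf (R n) (l n) / mgf (R n) (l n)
        \<and> R n \<le> A * B n \<and> B n \<le> C * real n" and Rn: "y2 \<le> R n" and \<theta>: "\<bar>\<theta>\<bar> \<le> \<delta>"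
      define s where "s = \<bar>\<theta>\<bar> * B n"
      define D where "D = 1 - cmod (\<psi> n \<theta>)"
      have D0: "0 \<le> D" using n tilted_char_le_1[of "l n" "R n"] by (simp add: D_def \<psi>_def)
      have s2: "real n * \<theta>\<^sup>2 * V (R n) = s\<^sup>2"
        using n by (simp add: s_def B_def power_mult_distrib)
      show "k * (\<bar>\<theta>\<bar> * B n - 1) \<le> real n * (1 - cmod (\<psi> n \<theta>))"
      \<comment> \<open>The subtracted 1 makes this range trivial: below the frequency
        \<open>1 / B n\<close> no decay is claimed.\<close>
      proof (cases "s \<le> 1")
        case True
        then have "k * (s - 1) \<le> 0" using k by (simp add: mult_nonneg_nonpos)
        also have "0 \<le> real n * D" using D0 by simp
        finally show ?thesis by (simp add: s_def D_def)
      next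
        case False
        then have s1: "1 < s" by simp
        then have "\<theta> \<noteq> 0" by (auto simp: s_def)
        show ?thesis
        proof (cases "R n \<le> 1 / (10 * \<bar>\<theta>\<bar>)")
          case True
          have "\<kappa> * \<theta>\<^sup>2 * V (R n) \<le> D" unfolding D_def \<psi>_def
            using n Rn y2 True \<open>\<theta> \<noteq> 0\<close> by (intro decay) (auto simp: field_simps)
          then have "real n * (\<kappa> * \<theta>\<^sup>2 * V (R n)) \<le> real n * D" by (rule mult_left_mono) simp
          moreover have "real n * (\<kappa> * \<theta>\<^sup>2 * V (R n)) = \<kappa> * s\<^sup>2" unfolding s2[symmetric] by simp
          moreover have "k * (s - 1) \<le> \<kappa> * s\<^sup>2"
          proof (intro mult_mono)
            have "s * 1 \<le> s * s" using s1 by (intro mult_left_mono) auto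
            then show "s - 1 \<le> s\<^sup>2" by (simp add: power2_eq_square)
          qed (use k s1 y1 in auto)
          ultimately show ?thesis by (simp add: s_def D_def)
        next
          case False
          define y where "y = 1 / (10 * \<bar>\<theta>\<bar>)"
          have y: "y2 \<le> y" "y \<le> R n" "\<bar>\<theta>\<bar> * y = 1 / 10" "0 < y"
            using \<theta> False \<open>\<theta> \<noteq> 0\<close> y2 by (auto simp: y_def \<delta>_def field_simps)
          have "\<kappa> * \<theta>\<^sup>2 * V y \<le> D" unfolding D_def \<psi>_def
            using n y y2 by (intro decay) auto
          then have "real n * (\<kappa> * \<theta>\<^sup>2 * V y) * (q * sqrt s) \<le> real n * D * (q * sqrt s)"
            using q s1 by (intro mult_right_mono mult_left_mono) auto
          \<comment> \<open>Between \<open>y\<close> and \<open>R n\<close>, whose ratio is at most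
            \<open>10 * A * s\<close> by \<open>R_le\<close>, Potter's bound loses a factor
            \<open>q * sqrt s\<close>. Of the Gaussian rate \<open>s^2\<close> there remains
            \<open>s * sqrt s\<close>, still more than linear.\<close>
          moreover have "\<kappa> * (sqrt s * sqrt s * s) \<le> real n * (\<kappa> * \<theta>\<^sup>2 * V y) * (q * sqrt s)"
          proof -
            have "R n / y = 10 * (\<bar>\<theta>\<bar> * R n)" by (simp add: y_def)
            also have "\<dots> \<le> 10 * (\<bar>\<theta>\<bar> * (A * B n))" using n by (intro mult_left_mono) auto
            also have "\<dots> = 10 * A * s" by (simp add: s_def)
            finally have "sqrt (R n / y) \<le> sqrt (10 * A) * sqrt s" by (simp flip: real_sqrt_mult)
            then have "2 * sqrt (R n / y) * V y \<le> 2 * (sqrt (10 * A) * sqrt s) * V y"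
              by (intro mult_right_mono mult_left_mono V_nonneg) auto
            then have "V (R n) \<le> q * sqrt s * V y"
              using potter[of y "R n"] y y2 by (simp add: q_def)
            then have "(real n * \<kappa> * \<theta>\<^sup>2) * V (R n) \<le> (real n * \<kappa> * \<theta>\<^sup>2) * (q * sqrt s * V y)"
              using y1 by (intro mult_left_mono) auto
            moreover have "(real n * \<kappa> * \<theta>\<^sup>2) * V (R n) = \<kappa> * (real n * \<theta>\<^sup>2 * V (R n))" by simp
            moreover have "sqrt s * sqrt s * s = s\<^sup>2" using s1 by (simp add: power2_eq_square)
            moreover have "(real n * \<kappa> * \<theta>\<^sup>2) * (q * sqrt s * V y)
                = real n * (\<kappa> * \<theta>\<^sup>2 * V y) * (q * sqrt s)" by simp
            ultimately show ?thesis by (simp only: s2)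
          qed
          ultimately have "sqrt s * (\<kappa> * (sqrt s * s)) \<le> sqrt s * (real n * D * q)"
            by (simp add: mult_ac)
          then have *: "\<kappa> * (sqrt s * s) \<le> real n * D * q"
            using s1 by (simp add: mult_le_cancel_left)
          have "(k * (s - 1)) * q = (k * q) * (s - 1)" by simp
          also have "\<dots> \<le> \<kappa> * (sqrt s * s)"
          proof (intro mult_mono k)
            have "1 * s \<le> sqrt s * s" using s1 by (intro mult_right_mono) auto
            then show "s - 1 \<le> sqrt s * s" by simp
          qed (use y1 s1 in auto)
          also note *
          finally have "k * (s - 1) \<le> real n * D" using q by simp
          then show ?thesis by (simp add: s_def D_def)
        qed
      qed
    qed
  qed
qed

lemma char_cont: "continuous_on S (\<lambda>\<theta>. CLINT \<omega>|M. iexp (\<theta> * Y \<omega>))"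
proof -
  interpret D: real_distribution "distr M borel Y" by simp
  have eq: "(\<lambda>\<theta>. CLINT \<omega>|M. iexp (\<theta> * Y \<omega>)) = char (distr M borel Y)"
    unfolding char_def by (subst integral_distr) auto
  have "continuous_on S (char (distr M borel Y))"
    by (intro continuous_at_imp_continuous_on ballI D.isCont_char)
  then show ?thesis unfolding eq .
qed

text \<open>The two integrands differ in modulus by \<open>\<bar>W Q r \<omega> - 1\<bar>\<close>
  whatever the frequency, and the centring changes only the phase; the comparison is therefore
  uniform in \<open>\<theta>\<close>.\<close>

lemma tilted_char_near_char:
  assumes l: "0 \<le> r" and m: "0 < mgf Q r"
  shows "mgf Q r * cmod (tilted_char Q r c \<theta>)
     \<le> cmod (CLINT \<omega>|M. iexp (\<theta> * Y \<omega>)) + (\<integral>\<omega>. \<bar>W Q r \<omega> - 1\<bar> \<partial>M)"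
proof -
  have int: "integrable M (\<lambda>\<omega>. complex_of_real (W Q r \<omega>) * iexp (\<theta> * Y \<omega>))"
    by (rule Bochner_Integration.integrable_bound[OF W_integrable[OF l, of Q]])
       (auto simp: norm_mult)
  have int1: "integrable M (\<lambda>\<omega>. iexp (\<theta> * Y \<omega>))"
    by (rule integrable_const_bound[where B = 1]) auto
  have "mgf Q r * cmod (tilted_char Q r c \<theta>) = cmod (CLINT \<omega>|M. complex_of_real (W Q r \<omega>) * iexp (\<theta> * Y \<omega>))"
    unfolding tilted_char_norm[of Q r c] using m by (simp add: tilted_char_def norm_divide)
  also have "(CLINT \<omega>|M. complex_of_real (W Q r \<omega>) * iexp (\<theta> * Y \<omega>))
     = (CLINT \<omega>|M. iexp (\<theta> * Y \<omega>)) + (CLINT \<omega>|M. complex_of_real (W Q r \<omega>) * iexp (\<theta> * Y \<omega>) - iexp (\<theta> * Y \<omega>))"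
    using int int1 by simp
  also have "cmod \<dots> \<le> cmod (CLINT \<omega>|M. iexp (\<theta> * Y \<omega>))
      + cmod (CLINT \<omega>|M. complex_of_real (W Q r \<omega>) * iexp (\<theta> * Y \<omega>) - iexp (\<theta> * Y \<omega>))"
    by (rule norm_triangle_ineq)
  also have "cmod (CLINT \<omega>|M. complex_of_real (W Q r \<omega>) * iexp (\<theta> * Y \<omega>) - iexp (\<theta> * Y \<omega>))
      \<le> (\<integral>\<omega>. cmod (complex_of_real (W Q r \<omega>) * iexp (\<theta> * Y \<omega>) - iexp (\<theta> * Y \<omega>)) \<partial>M)"
    by (rule integral_norm_bound)
  also have "\<dots> = (\<integral>\<omega>. \<bar>W Q r \<omega> - 1\<bar> \<partial>M)"
  proof (rule Bochner_Integration.integral_cong[OF refl])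
    fix \<omega>
    have "complex_of_real (W Q r \<omega>) * iexp (\<theta> * Y \<omega>) - iexp (\<theta> * Y \<omega>)
       = complex_of_real (W Q r \<omega> - 1) * iexp (\<theta> * Y \<omega>)" by (simp add: algebra_simps)
    then show "cmod (complex_of_real (W Q r \<omega>) * iexp (\<theta> * Y \<omega>) - iexp (\<theta> * Y \<omega>)) = \<bar>W Q r \<omega> - 1\<bar>"
      by (simp only: norm_mult norm_of_real norm_exp_i_times) simp
  qed
  finally show ?thesis by simp
qed

text \<open>Away from 0 the tilt is a mere perturbation: the untilted modulus is continuous and
  below 1 on a compact set of frequencies, hence at most some \<open>q0 < 1\<close> there, and the
  weight tends to 1 in mean.\<close>

lemma far_decay:
  assumes \<delta>: "0 < \<delta>"
  obtains q where "q < 1"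
    "\<forall>\<^sub>F n in sequentially. \<forall>\<theta>. \<delta> \<le> \<bar>\<theta>\<bar> \<longrightarrow> \<bar>\<theta>\<bar> \<le> pi \<longrightarrow> cmod (\<psi> n \<theta>) \<le> q"
proof -
  let ?S = "{-pi..-\<delta>} \<union> {\<delta>..pi}"
  let ?\<phi> = "\<lambda>\<theta>. CLINT \<omega>|M. iexp (\<theta> * Y \<omega>)"
  obtain q0 where q0: "0 \<le> q0" "q0 < 1" "\<And>\<theta>. \<theta> \<in> ?S \<Longrightarrow> cmod (?\<phi> \<theta>) \<le> q0"
  \<comment> \<open>For \<open>\<delta> > pi\<close> there is no frequency left and no maximum to
    take; any bound serves.\<close>
  proof (cases "?S = {}")
    case False
    have "\<exists>x\<in>?S. \<forall>y\<in>?S. cmod (?\<phi> y) \<le> cmod (?\<phi> x)"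
      using False by (intro continuous_attains_sup continuous_on_norm char_cont compact_Un compact_Icc)
    then obtain x where x: "x \<in> ?S" "\<And>y. y \<in> ?S \<Longrightarrow> cmod (?\<phi> y) \<le> cmod (?\<phi> x)" by blast
    have "cmod (?\<phi> x) < 1" using x(1) \<delta> by (intro nonlattice) auto
    then show ?thesis using that[of "cmod (?\<phi> x)"] x(2) by auto
  qed (use that[of 0] in auto)
  define q where "q = (1 + q0) / 2"
  have q: "q0 < q" "q < 1" using q0 by (auto simp: q_def)
  have "(\<lambda>n. (q0 + (\<integral>\<omega>. \<bar>W (R n) (l n) \<omega> - 1\<bar> \<partial>M)) / mgf (R n) (l n)) \<longlonglongrightarrow> (q0 + 0) / 1"
    by (intro tendsto_intros mgf_lim W_L1_tendsto[OF R_lim tilt_simple]) auto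
  then have "\<forall>\<^sub>F n in sequentially. (q0 + (\<integral>\<omega>. \<bar>W (R n) (l n) \<omega> - 1\<bar> \<partial>M)) / mgf (R n) (l n) < q"
    using q by (intro order_tendstoD) auto
  then have "\<forall>\<^sub>F n in sequentially. \<forall>\<theta>. \<delta> \<le> \<bar>\<theta>\<bar> \<longrightarrow> \<bar>\<theta>\<bar> \<le> pi \<longrightarrow> cmod (\<psi> n \<theta>) \<le> q"
    using regular
  proof (eventually_elim, intro allI impI)
    fix n \<theta>
    assume elim: "(q0 + (\<integral>\<omega>. \<bar>W (R n) (l n) \<omega> - 1\<bar> \<partial>M)) / mgf (R n) (l n) < q"
      "0 < n \<and> 0 < R n \<and> 0 < V (R n) \<and> 0 < B n \<and> 0 < l n \<and> l n * R n \<le> 2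
        \<and> 0 < mgf (R n) (l n) \<and> mgf (R n) (l n) \<le> 2 \<and> t n = dmgf (R n) (l n) / mgf (R n) (l n)
        \<and> R n \<le> A * B n \<and> B n \<le> C * real n" "\<delta> \<le> \<bar>\<theta>\<bar>" "\<bar>\<theta>\<bar> \<le> pi"
    have "\<theta> \<in> ?S" using elim by auto
    then have "mgf (R n) (l n) * cmod (\<psi> n \<theta>) \<le> q0 + (\<integral>\<omega>. \<bar>W (R n) (l n) \<omega> - 1\<bar> \<partial>M)"
      using tilted_char_near_char[of "l n" "R n" "t n" \<theta>] elim q0(3)[of \<theta>] by (simp add: \<psi>_def)
    then have "cmod (\<psi> n \<theta>) \<le> (q0 + (\<integral>\<omega>. \<bar>W (R n) (l n) \<omega> - 1\<bar> \<partial>M)) / mgf (R n) (l n)"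
      using elim by (simp add: field_simps)
    then show "cmod (\<psi> n \<theta>) \<le> q" using elim by linarith
  qed
  then show ?thesis using that q by blast
qed

text \<open>Away from 0, \<open>n * (1 - cmod (\<psi> n \<theta>))\<close> is at least
  \<open>n * (1 - q)\<close>, while \<open>\<bar>\<theta>\<bar> * B n \<le> pi * C * n\<close>; so
  both ranges of frequencies yield the linear bound of \<open>near_decay\<close>. Raising
  \<open>x \<le> exp (x - 1)\<close> to the \<open>n\<close>-th power then gives, in the variable
  \<open>s = \<theta> * B n\<close>, a majorant free of \<open>n\<close>.\<close>

lemma domination:
  obtains k where "0 < k"
    "\<forall>\<^sub>F n in sequentially. \<forall>\<theta>. \<bar>\<theta>\<bar> \<le> pi \<longrightarrow> cmod (\<psi> n \<theta> ^ n) \<le> exp (k - k * (\<bar>\<theta>\<bar> * B n))"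
proof -
  obtain \<delta> k0 where d: "0 < \<delta>" "0 < k0"
    "\<forall>\<^sub>F n in sequentially. \<forall>\<theta>. \<bar>\<theta>\<bar> \<le> \<delta> \<longrightarrow>
       k0 * (\<bar>\<theta>\<bar> * B n - 1) \<le> real n * (1 - cmod (\<psi> n \<theta>))" using near_decay by blast
  obtain q where q: "q < 1"
    "\<forall>\<^sub>F n in sequentially. \<forall>\<theta>. \<delta> \<le> \<bar>\<theta>\<bar> \<longrightarrow> \<bar>\<theta>\<bar> \<le> pi \<longrightarrow> cmod (\<psi> n \<theta>) \<le> q"
    using far_decay[OF d(1)] by blast
  define k where "k = min k0 ((1 - q) / (pi * C))"
  have k: "0 < k" "k \<le> k0" "k * (pi * C) \<le> 1 - q"
    using d(2) q(1) C_pos by (auto simp: k_def min_def field_simps)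
  have "\<forall>\<^sub>F n in sequentially. \<forall>\<theta>. \<bar>\<theta>\<bar> \<le> pi \<longrightarrow> cmod (\<psi> n \<theta> ^ n) \<le> exp (k - k * (\<bar>\<theta>\<bar> * B n))"
    using d(3) q(2) regular
  proof (eventually_elim, intro allI impI)
    fix n \<theta>
    assume elim: "\<forall>\<theta>. \<bar>\<theta>\<bar> \<le> \<delta> \<longrightarrow> k0 * (\<bar>\<theta>\<bar> * B n - 1) \<le> real n * (1 - cmod (\<psi> n \<theta>))"
      "\<forall>\<theta>. \<delta> \<le> \<bar>\<theta>\<bar> \<longrightarrow> \<bar>\<theta>\<bar> \<le> pi \<longrightarrow> cmod (\<psi> n \<theta>) \<le> q"
      "0 < n \<and> 0 < R n \<and> 0 < V (R n) \<and> 0 < B n \<and> 0 < l n \<and> l n * R n \<le> 2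
        \<and> 0 < mgf (R n) (l n) \<and> mgf (R n) (l n) \<le> 2 \<and> t n = dmgf (R n) (l n) / mgf (R n) (l n)
        \<and> R n \<le> A * B n \<and> B n \<le> C * real n" "\<bar>\<theta>\<bar> \<le> pi"
    have p1: "cmod (\<psi> n \<theta>) \<le> 1" using elim by (auto simp: \<psi>_def intro!: tilted_char_le_1)
    have "k * (\<bar>\<theta>\<bar> * B n - 1) \<le> real n * (1 - cmod (\<psi> n \<theta>))"
    proof (cases "\<bar>\<theta>\<bar> * B n \<le> 1")
      case True
      then have "k * (\<bar>\<theta>\<bar> * B n - 1) \<le> 0" using k by (simp add: mult_nonneg_nonpos)
      also have "0 \<le> real n * (1 - cmod (\<psi> n \<theta>))" using p1 by simp
      finally show ?thesis .
    next
      case big: False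
      show ?thesis
      proof (cases "\<bar>\<theta>\<bar> \<le> \<delta>")
        case True
        have "k * (\<bar>\<theta>\<bar> * B n - 1) \<le> k0 * (\<bar>\<theta>\<bar> * B n - 1)"
          using big k by (intro mult_right_mono) auto
        also have "\<dots> \<le> real n * (1 - cmod (\<psi> n \<theta>))" using elim True by blast
        finally show ?thesis .
      next
        case False
        have "\<bar>\<theta>\<bar> * B n \<le> pi * (C * real n)" using elim by (intro mult_mono) auto
        then have "k * (\<bar>\<theta>\<bar> * B n - 1) \<le> k * (pi * (C * real n))" using k by (intro mult_left_mono) auto
        also have "\<dots> = real n * (k * (pi * C))" by simp
        also have "\<dots> \<le> real n * (1 - q)" using k by (intro mult_left_mono) auto
        also have "\<dots> \<le> real n * (1 - cmod (\<psi> n \<theta>))" using elim False by (intro mult_left_mono) auto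
        finally show ?thesis .
      qed
    qed
    moreover have le: "cmod (\<psi> n \<theta> ^ n) \<le> exp (- (real n * (1 - cmod (\<psi> n \<theta>))))"
    proof -
      have "cmod (\<psi> n \<theta>) \<le> exp (- (1 - cmod (\<psi> n \<theta>)))"
        using exp_ge_add_one_self[of "- (1 - cmod (\<psi> n \<theta>))"] by simp
      then have "cmod (\<psi> n \<theta>) ^ n \<le> exp (- (1 - cmod (\<psi> n \<theta>))) ^ n" by (intro power_mono) auto
      also have "\<dots> = exp (- (real n * (1 - cmod (\<psi> n \<theta>))))"
        by (simp only: exp_of_nat_mult[symmetric] mult_minus_right)
      finally show ?thesis by (simp only: norm_power)
    qed
    moreover have "k * (\<bar>\<theta>\<bar> * B n - 1) = - (k - k * (\<bar>\<theta>\<bar> * B n))" by (simp add: right_diff_distrib)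
    ultimately have "- (real n * (1 - cmod (\<psi> n \<theta>))) \<le> k - k * (\<bar>\<theta>\<bar> * B n)" by linarith
    then have "exp (- (real n * (1 - cmod (\<psi> n \<theta>)))) \<le> exp (k - k * (\<bar>\<theta>\<bar> * B n))"
      by (simp only: exp_le_cancel_iff)
    with le show "cmod (\<psi> n \<theta> ^ n) \<le> exp (k - k * (\<bar>\<theta>\<bar> * B n))" by (rule order_trans)
  qed
  then show ?thesis using that k(1) by blast
qed

text \<open>\<open>clt\<close> supplies the pointwise limit and \<open>domination\<close> the
  integrable majorant \<open>exp (k - k * \<bar>s\<bar>)\<close>. The sequence \<open>d\<close> is
  the displacement of the lattice point from the mean of the tilted sum; on the scale
  \<open>B n\<close> its phase disappears.\<close>

lemma local_limit:
  assumes d: "(\<lambda>n. d n * inverse (B n)) \<longlonglongrightarrow> 0"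
  shows "(\<lambda>n. CLBINT s:{- (pi * B n)..pi * B n}. iexp (s * (d n * inverse (B n))) * \<psi> n (s / B n) ^ n)
     \<longlonglongrightarrow> complex_of_real (sqrt (2 * pi))"
proof -
  obtain k where k: "0 < k"
    "\<forall>\<^sub>F n in sequentially. \<forall>\<theta>. \<bar>\<theta>\<bar> \<le> pi \<longrightarrow> cmod (\<psi> n \<theta> ^ n) \<le> exp (k - k * (\<bar>\<theta>\<bar> * B n))"
    using domination by blast
  have "\<forall>\<^sub>F n in sequentially. 0 < B n \<and>
      (\<forall>\<theta>. \<bar>\<theta>\<bar> \<le> pi \<longrightarrow> cmod (\<psi> n \<theta> ^ n) \<le> exp (k - k * (\<bar>\<theta>\<bar> * B n)))"
    using regular k(2) by eventually_elim blast
  then obtain N where N: "\<And>n. N \<le> n \<Longrightarrow> 0 < B n \<and>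
      (\<forall>\<theta>. \<bar>\<theta>\<bar> \<le> pi \<longrightarrow> cmod (\<psi> n \<theta> ^ n) \<le> exp (k - k * (\<bar>\<theta>\<bar> * B n)))"
    unfolding eventually_sequentially by blast
  let ?f = "\<lambda>n s. indicator {- (pi * B n)..pi * B n} s *\<^sub>R
      (iexp (s * (d n * inverse (B n))) * \<psi> n (s / B n) ^ n)"
  have meas: "\<psi> n \<in> borel_measurable borel" for n
  proof -
    have [measurable]: "(\<lambda>(\<theta>, \<omega>). complex_of_real (W (R n) (l n) \<omega>) * iexp (\<theta> * (Y \<omega> - t n)))
        \<in> borel_measurable (borel \<Otimes>\<^sub>M M)" by measurable
    show ?thesis unfolding \<psi>_def[abs_def] tilted_char_def
      by (intro borel_measurable_divide borel_measurable_const borel_measurable_lebesgue_integral) simp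
  qed
  have "(\<lambda>n. LINT s|lborel. ?f (n + N) s) \<longlonglongrightarrow> (LINT s|lborel. complex_of_real (exp (- (s\<^sup>2 / 2))))"
  proof (rule integral_dominated_convergence[where w = "\<lambda>s. exp k * exp (- k * \<bar>s\<bar>)"])
    show "integrable lborel (\<lambda>s. exp k * exp (- k * \<bar>s\<bar>))"
    proof (intro integrable_mult_right)
      let ?g = "\<lambda>s :: real. indicator {0<..} s *\<^sub>R exp (- (s * k))"
      have g: "integrable lborel ?g"
        using integrable_I0i_exp_mscale[OF k(1)] by (simp add: set_integrable_def)
      have g': "integrable lborel (\<lambda>s. ?g (- s))"
        using lborel_integrable_real_affine[OF g, of "-1" 0] by simp
      \<comment> \<open>The half-lines are open, so the indicator of \<open>{0}\<close> restores the
        value at 0.\<close>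
      have "integrable lborel (\<lambda>s. ?g s + ?g (- s) + indicator {0} s)"
        by (intro Bochner_Integration.integrable_add g g') simp
      moreover have "(\<lambda>s. ?g s + ?g (- s) + indicator {0} s) = (\<lambda>s. exp (- k * \<bar>s\<bar>))"
        by (auto simp: fun_eq_iff indicator_def abs_if mult.commute)
      ultimately show "integrable lborel (\<lambda>s. exp (- k * \<bar>s\<bar>))" by simp
    qed
    show "AE s in lborel. (\<lambda>n. ?f (n + N) s) \<longlonglongrightarrow> complex_of_real (exp (- (s\<^sup>2 / 2)))"
    proof (rule AE_I2)
      fix s :: real
      have "(\<lambda>n. iexp (s * (d n * inverse (B n))) * \<psi> n (s / B n) ^ n)
          \<longlonglongrightarrow> iexp (s * 0) * complex_of_real (exp (- (s\<^sup>2 / 2)))"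
        by (intro tendsto_intros d clt)
      moreover have "\<forall>\<^sub>F n in sequentially. iexp (s * (d n * inverse (B n))) * \<psi> n (s / B n) ^ n = ?f n s"
      proof -
        have "(\<lambda>n. \<bar>s\<bar> * inverse (B n)) \<longlonglongrightarrow> \<bar>s\<bar> * 0" by (intro tendsto_intros inverse_B_lim)
        then have "\<forall>\<^sub>F n in sequentially. \<bar>s\<bar> * inverse (B n) < pi" by (intro order_tendstoD) auto
        then show ?thesis using regular
        proof eventually_elim
          case (elim n)
          then have "\<bar>s\<bar> \<le> pi * B n" by (simp add: field_simps)
          then have "s \<in> {- (pi * B n)..pi * B n}" by (auto simp: abs_le_iff)
          then show ?case by simp
        qed
      qed
      ultimately have "(\<lambda>n. ?f n s) \<longlonglongrightarrow> complex_of_real (exp (- (s\<^sup>2 / 2)))"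
        by (auto elim: Lim_transform_eventually)
      then show "(\<lambda>n. ?f (n + N) s) \<longlonglongrightarrow> complex_of_real (exp (- (s\<^sup>2 / 2)))"
        by (rule LIMSEQ_ignore_initial_segment)
    qed
    show "AE s in lborel. norm (?f (n + N) s) \<le> exp k * exp (- k * \<bar>s\<bar>)" for n
    proof (rule AE_I2)
      fix s :: real
      have Bn: "0 < B (n + N)" and dom: "\<And>\<theta>. \<bar>\<theta>\<bar> \<le> pi \<Longrightarrow>
         cmod (\<psi> (n + N) \<theta> ^ (n + N)) \<le> exp (k - k * (\<bar>\<theta>\<bar> * B (n + N)))"
        using N[of "n + N"] by simp_all
      show "norm (?f (n + N) s) \<le> exp k * exp (- k * \<bar>s\<bar>)"
      proof (cases "s \<in> {- (pi * B (n + N))..pi * B (n + N)}")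
        case True
        then have "\<bar>s / B (n + N)\<bar> \<le> pi" using Bn by (auto simp: abs_le_iff field_simps)
        from dom[OF this] have "cmod (\<psi> (n + N) (s / B (n + N)) ^ (n + N)) \<le> exp (k - k * \<bar>s\<bar>)"
          using Bn by simp
        then show ?thesis using True by (simp add: norm_mult flip: exp_add)
      qed simp
    qed
    note meas[measurable]
    show "?f (n + N) \<in> borel_measurable lborel" for n by measurable
  qed simp
  then have "(\<lambda>n. LINT s|lborel. ?f n s) \<longlonglongrightarrow> (LINT s|lborel. complex_of_real (exp (- (s\<^sup>2 / 2))))"
    by (rule LIMSEQ_offset)
  moreover have "(LINT s|lborel. complex_of_real (exp (- (s\<^sup>2 / 2)))) = complex_of_real (sqrt (2 * pi))"
  proof -
    have "(LINT s|lborel. std_normal_density s) = 1"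
      using integral_std_normal_moment_even[of 0] by simp
    then have "(LINT s|lborel. exp (- (s\<^sup>2 / 2))) = sqrt (2 * pi)"
      by (simp add: std_normal_density_def)
    then show ?thesis by (simp only: integral_complex_of_real)
  qed
  ultimately show ?thesis by (simp add: set_lebesgue_integral_def)
qed

end

section \<open>Fourier inversion\<close>

lemma CLBINT_iexp_int:
  fixes m :: int
  shows "(CLBINT \<theta>:{-pi..pi}. iexp (\<theta> * real_of_int m)) = (if m = 0 then 2 * pi else 0)"
proof (cases "m = 0")
  case True
  then show ?thesis by (simp add: set_lebesgue_integral_def scaleR_conv_of_real)
next
  case False
  let ?F = "\<lambda>\<theta>. exp (\<i> * (\<theta> * real_of_int m)) / (\<i> * of_int m)"
  have "(LBINT \<theta>. indicator {-pi..pi} \<theta> *\<^sub>R iexp (\<theta> * real_of_int m)) = ?F pi - ?F (- pi)"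
  proof (rule integral_FTC_Icc)
    fix \<theta> :: real
    have "((\<lambda>z. exp (\<i> * (z * of_int m)) / (\<i> * of_int m)) has_field_derivative
        exp (\<i> * (of_real \<theta> * of_int m))) (at (of_real \<theta>))"
      using False by (auto intro!: derivative_eq_intros simp: mult.left_commute[of \<i>])
    then show "(?F has_vector_derivative iexp (\<theta> * real_of_int m)) (at \<theta> within {-pi..pi})"
      by (auto dest!: has_vector_derivative_real_field intro: has_vector_derivative_at_within)
  qed (auto intro!: continuous_intros)
  also have "\<dots> = 0"
  proof -
    have "exp (\<i> * complex_of_real (pi * real_of_int m)) = exp (\<i> * complex_of_real (- pi * real_of_int m))"
      unfolding exp_eq by (intro exI[of _ m]) (simp add: algebra_simps)
    then show ?thesis by simp
  qed
  finally show ?thesis using False by (simp add: set_lebesgue_integral_def)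
qed

context prob_space
begin

text \<open>Orthogonality of the characters on \<open>[-pi, pi]\<close> selects the event
  \<open>S = k\<close>, and \<open>\<bar>Z\<bar>\<close> justifies Fubini. The weight
  \<open>Z\<close> is there to carry the tilt and the restriction on the maximum.\<close>

lemma int_fourier_inversion:
  fixes S :: "'a \<Rightarrow> int" and Z :: "'a \<Rightarrow> real"
  assumes S [measurable]: "S \<in> measurable M (count_space UNIV)"
    and Z: "integrable M Z"
  shows "(CLBINT \<theta>:{-pi..pi}. (CLINT \<omega>|M. Z \<omega> * iexp (\<theta> * real_of_int (S \<omega> - k))))
     = 2 * pi * (\<integral>\<omega>. Z \<omega> * indicator {\<omega>. S \<omega> = k} \<omega> \<partial>M)"
proof -
  have [measurable]: "Z \<in> borel_measurable M" using Z by auto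
  interpret pair_sigma_finite lborel M ..
  let ?f = "\<lambda>\<theta> \<omega>. indicator {-pi..pi} \<theta> *\<^sub>R (Z \<omega> * iexp (\<theta> * real_of_int (S \<omega> - k)))"
  have norm: "norm (?f \<theta> \<omega>) = indicator {-pi..pi} \<theta> * \<bar>Z \<omega>\<bar>" for \<theta> \<omega>
    by (simp add: norm_mult)
  have meas: "case_prod ?f \<in> borel_measurable (lborel \<Otimes>\<^sub>M M)" by measurable
  have int: "integrable (lborel \<Otimes>\<^sub>M M) (case_prod ?f)"
  proof (rule Fubini_integrable[OF meas])
    show "integrable lborel (\<lambda>\<theta>. \<integral>\<omega>. norm (case (\<theta>, \<omega>) of (\<theta>, \<omega>) \<Rightarrow> ?f \<theta> \<omega>) \<partial>M)"
      unfolding prod.case norm by (simp add: integrable_mult_left)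
    show "AE \<theta> in lborel. integrable M (\<lambda>\<omega>. case (\<theta>, \<omega>) of (\<theta>, \<omega>) \<Rightarrow> ?f \<theta> \<omega>)"
    proof (rule AE_I2)
      fix \<theta> :: real
      show "integrable M (\<lambda>\<omega>. case (\<theta>, \<omega>) of (\<theta>, \<omega>) \<Rightarrow> ?f \<theta> \<omega>)"
        unfolding prod.case
        by (rule Bochner_Integration.integrable_bound[OF integrable_abs[OF Z]])
           (auto simp: norm_mult split: split_indicator)
    qed
  qed
  have "(CLBINT \<theta>:{-pi..pi}. (CLINT \<omega>|M. Z \<omega> * iexp (\<theta> * real_of_int (S \<omega> - k))))
      = (LBINT \<theta>. (CLINT \<omega>|M. ?f \<theta> \<omega>))"
    by (simp add: set_lebesgue_integral_def)
  also have "\<dots> = (CLINT \<omega>|M. (LBINT \<theta>. ?f \<theta> \<omega>))"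
    using Fubini_integral[OF int] by simp
  also have "\<dots> = (CLINT \<omega>|M. complex_of_real (2 * pi * (Z \<omega> * indicator {\<omega>. S \<omega> = k} \<omega>)))"
  proof (rule Bochner_Integration.integral_cong[OF refl])
    fix \<omega>
    have "(LBINT \<theta>. ?f \<theta> \<omega>) = Z \<omega> * (CLBINT \<theta>:{-pi..pi}. iexp (\<theta> * real_of_int (S \<omega> - k)))"
      unfolding set_lebesgue_integral_def by (subst integral_mult_right_zero[symmetric]) simp
    then show "(LBINT \<theta>. ?f \<theta> \<omega>) = complex_of_real (2 * pi * (Z \<omega> * indicator {\<omega>. S \<omega> = k} \<omega>))"
      unfolding CLBINT_iexp_int by simp
  qed
  also have "\<dots> = 2 * pi * (\<integral>\<omega>. Z \<omega> * indicator {\<omega>. S \<omega> = k} \<omega> \<partial>M)"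
    by (simp only: integral_complex_of_real integral_mult_right_zero)
  finally show ?thesis .
qed

lemma iid_expectation_power:
  fixes \<xi> :: "'a \<Rightarrow> int" and X :: "nat \<Rightarrow> 'a \<Rightarrow> int" and g :: "int \<Rightarrow> complex"
  assumes \<xi> [measurable]: "\<xi> \<in> measurable M (count_space UNIV)"
    and indep: "indep_vars (\<lambda>_. count_space UNIV) X {1..}"
    and ident: "\<And>i. i \<ge> 1 \<Longrightarrow> distr M (count_space UNIV) (X i) = distr M (count_space UNIV) \<xi>"
    and int: "integrable M (\<lambda>\<omega>. g (\<xi> \<omega>))"
  shows "(CLINT \<omega>|M. (\<Prod>i=1..n. g (X i \<omega>))) = (CLINT \<omega>|M. g (\<xi> \<omega>)) ^ n"
    and "integrable M (\<lambda>\<omega>. (\<Prod>i=1..n. g (X i \<omega>)))"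
proof -
  have X: "X i \<in> measurable M (count_space UNIV)" if "i \<ge> 1" for i
    using indep that unfolding indep_vars_def by auto
  have int_i: "integrable M (\<lambda>\<omega>. g (X i \<omega>))" and eq_i: "(CLINT \<omega>|M. g (X i \<omega>)) = (CLINT \<omega>|M. g (\<xi> \<omega>))"
    if "i \<in> {1..n}" for i
  proof -
    have i: "i \<ge> 1" using that by simp
    have g: "g \<in> borel_measurable (count_space UNIV)" by simp
    show "integrable M (\<lambda>\<omega>. g (X i \<omega>))"
      using integrable_distr_eq[OF X[OF i] g] integrable_distr_eq[OF \<xi> g] int ident[OF i] by simp
    show "(CLINT \<omega>|M. g (X i \<omega>)) = (CLINT \<omega>|M. g (\<xi> \<omega>))"
      using integral_distr[OF X[OF i] g] integral_distr[OF \<xi> g] ident[OF i] by simp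
  qed
  have "indep_vars (\<lambda>_. count_space UNIV) X {1..n}" by (rule indep_vars_subset[OF indep]) auto
  then have ind: "indep_vars (\<lambda>_. borel) (\<lambda>i \<omega>. g (X i \<omega>)) {1..n}"
    by (rule indep_vars_compose2) simp
  show "integrable M (\<lambda>\<omega>. (\<Prod>i=1..n. g (X i \<omega>)))"
    by (rule indep_vars_integrable[OF _ ind int_i]) auto
  have "(CLINT \<omega>|M. (\<Prod>i=1..n. g (X i \<omega>))) = (\<Prod>i=1..n. (CLINT \<omega>|M. g (X i \<omega>)))"
    by (rule indep_vars_lebesgue_integral[OF _ ind int_i]) auto
  also have "\<dots> = (\<Prod>i=1..n. (CLINT \<omega>|M. g (\<xi> \<omega>)))"
    using eq_i by (intro prod.cong) auto
  finally show "(CLINT \<omega>|M. (\<Prod>i=1..n. g (X i \<omega>))) = (CLINT \<omega>|M. g (\<xi> \<omega>)) ^ n" by simp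
qed

text \<open>Modulus 1 forces \<open>cos (\<theta> * \<xi> - b) = 1\<close> almost surely, where
  \<open>b\<close> is the phase. Then the values of \<open>\<xi>\<close> differ by integers
  \<open>m\<close> with \<open>\<theta> * m\<close> a multiple of \<open>2 * pi\<close>, and these
  form a proper subgroup of the integers: a span of at least 2.\<close>

lemma aperiodic_char_less_1:
  fixes \<xi> :: "'a \<Rightarrow> int"
  assumes \<xi> [measurable]: "\<xi> \<in> measurable M (count_space UNIV)"
    and aper: "aperiodic M \<xi>" and \<theta>: "0 < \<bar>\<theta>\<bar>" "\<bar>\<theta>\<bar> \<le> pi"
  shows "cmod (CLINT \<omega>|M. iexp (\<theta> * (real_of_int (\<xi> \<omega>) - c))) < 1"
proof (rule ccontr)
  assume not: "\<not> ?thesis"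
  define z where "z = (CLINT \<omega>|M. iexp (\<theta> * (real_of_int (\<xi> \<omega>) - c)))"
  have z: "1 \<le> cmod z" using not by (simp add: z_def)
  define b where "b = \<theta> * c + Arg z"
  have int: "integrable M (\<lambda>\<omega>. iexp (\<theta> * real_of_int (\<xi> \<omega>) - b))"
    by (rule integrable_const_bound[where B = 1]) auto
  have cint: "integrable M (\<lambda>\<omega>. cos (\<theta> * real_of_int (\<xi> \<omega>) - b))"
    by (rule integrable_const_bound[where B = 1]) auto
  have "cmod z = Re (exp (- (\<i> * Arg z)) * z)"
  proof -
    have "z = complex_of_real (cmod z) * exp (\<i> * Arg z)"
      using Arg_eq[of z] by (cases "z = 0") auto
    then have "exp (- (\<i> * Arg z)) * z = complex_of_real (cmod z) * (exp (- (\<i> * Arg z)) * exp (\<i> * Arg z))"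
      by (metis mult.left_commute)
    then show ?thesis by (simp flip: exp_add)
  qed
  also have "exp (- (\<i> * Arg z)) * z = (CLINT \<omega>|M. exp (- (\<i> * Arg z)) * iexp (\<theta> * (real_of_int (\<xi> \<omega>) - c)))"
    unfolding integral_mult_right_zero z_def[symmetric] ..
  also have "\<dots> = (CLINT \<omega>|M. iexp (\<theta> * real_of_int (\<xi> \<omega>) - b))"
    unfolding b_def by (intro Bochner_Integration.integral_cong refl)
      (simp add: algebra_simps flip: exp_add)
  also have "Re \<dots> = (\<integral>\<omega>. cos (\<theta> * real_of_int (\<xi> \<omega>) - b) \<partial>M)"
    by (subst integral_Re[symmetric, OF int]) (simp add: Re_exp)
  finally have "(\<integral>\<omega>. 1 - cos (\<theta> * real_of_int (\<xi> \<omega>) - b) \<partial>M) = 1 - cmod z"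
    using cint by (simp add: prob_space)
  also have "\<dots> \<le> 0" using z by simp
  finally have le: "(\<integral>\<omega>. 1 - cos (\<theta> * real_of_int (\<xi> \<omega>) - b) \<partial>M) \<le> 0" .
  have "(\<integral>\<omega>. 1 - cos (\<theta> * real_of_int (\<xi> \<omega>) - b) \<partial>M) \<ge> 0"
    by (intro Bochner_Integration.integral_nonneg) simp
  with le have "(\<integral>\<omega>. 1 - cos (\<theta> * real_of_int (\<xi> \<omega>) - b) \<partial>M) = 0" by (rule antisym)
  then have AE: "AE \<omega> in M. 1 - cos (\<theta> * real_of_int (\<xi> \<omega>) - b) = 0"
    using cint by (subst (asm) integral_nonneg_eq_0_iff_AE) auto
  \<comment> \<open>The integers with \<open>P\<close> form a subgroup; it does not contain 1,
    because \<open>0 < \<bar>\<theta>\<bar> < 2 * pi\<close>.\<close>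
  define P where "P = (\<lambda>m :: int. \<exists>j :: int. \<theta> * real_of_int m = 2 * pi * real_of_int j)"
  have AE': "AE \<omega> in M. \<exists>j :: int. \<theta> * real_of_int (\<xi> \<omega>) - b = 2 * pi * real_of_int j"
    using AE by eventually_elim (auto simp: cos_one_2pi_int mult_ac)
  have "\<exists>\<omega>0 j0. \<theta> * real_of_int (\<xi> \<omega>0) - b = 2 * pi * real_of_int j0"
  proof (rule ccontr)
    assume "\<not> ?thesis"
    then have "AE \<omega> in M. False" using AE' by auto
    then show False by simp
  qed
  then obtain \<omega>0 j0 where j0: "\<theta> * real_of_int (\<xi> \<omega>0) - b = 2 * pi * real_of_int j0" by auto
  have AEP: "AE \<omega> in M. P (\<xi> \<omega> - \<xi> \<omega>0)"
    using AE'
  proof eventually_elim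
    case (elim \<omega>)
    then obtain j where "\<theta> * real_of_int (\<xi> \<omega>) - b = 2 * pi * real_of_int j" by auto
    then have "\<theta> * real_of_int (\<xi> \<omega> - \<xi> \<omega>0) = 2 * pi * real_of_int (j - j0)"
      using j0 by (simp add: algebra_simps)
    then show ?case unfolding P_def by blast
  qed
  have P1: "\<not> P 1"
  proof
    assume "P 1"
    then obtain j :: int where j: "\<theta> = 2 * pi * real_of_int j" by (auto simp: P_def)
    then have "j \<noteq> 0" using \<theta> by auto
    then have "1 \<le> \<bar>real_of_int j\<bar>" by linarith
    then have "2 * pi * 1 \<le> 2 * pi * \<bar>real_of_int j\<bar>" by (intro mult_left_mono) auto
    also have "\<dots> = \<bar>\<theta>\<bar>" unfolding j by (simp add: abs_mult)
    finally show False using \<theta> pi_gt_zero by linarith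
  qed
  have Pdiff: "P (m - q * h)" if "P m" "P h" for m h q
  proof -
    obtain i j :: int where "\<theta> * real_of_int m = 2 * pi * real_of_int i" "\<theta> * real_of_int h = 2 * pi * real_of_int j"
      using \<open>P m\<close> \<open>P h\<close> by (auto simp: P_def)
    then have "\<theta> * real_of_int (m - q * h) = 2 * pi * real_of_int (i - q * j)"
      by (simp add: algebra_simps)
    then show ?thesis unfolding P_def by blast
  qed
  \<comment> \<open>If the subgroup is trivial, 2 divides its only element; otherwise its least
    positive element divides all others, by division with remainder, and it differs from 1.\<close>
  have "\<exists>h\<ge>2. \<forall>m. P m \<longrightarrow> h dvd m"
  proof (cases "\<exists>m>0. P m")
    case False
    have "m = 0" if "P m" for m
    proof -
      have "P 0" by (auto simp: P_def)
      then have "P (- m)" using Pdiff[of 0 m 1] that by simp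
      then show ?thesis using that False by (meson neg_0_less_iff_less not_less_iff_gr_or_eq)
    qed
    then show ?thesis by (intro exI[of _ 2]) auto
  next
    case True
    define h where "h = int (LEAST k. 0 < k \<and> P (int k))"
    obtain m where "0 < m" "P m" using True by auto
    then have "0 < nat m \<and> P (int (nat m))" by simp
    then have h: "0 < h" "P h"
      using LeastI[of "\<lambda>k. 0 < k \<and> P (int k)" "nat m"] by (auto simp: h_def)
    have least: "h \<le> m" if "0 < m" "P m" for m
      using that Least_le[of "\<lambda>k. 0 < k \<and> P (int k)" "nat m"] by (auto simp: h_def le_nat_iff)
    have "h \<noteq> 1" using h P1 by auto
    moreover have "h dvd m" if "P m" for m
    proof (rule ccontr)
      assume "\<not> h dvd m"
      then have "0 < m mod h" using h(1) by (simp add: order_less_le dvd_eq_mod_eq_0)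
      moreover have "P (m mod h)" using Pdiff[OF that h(2), of "m div h"] by (simp add: minus_div_mult_eq_mod)
      ultimately show False using least[of "m mod h"] pos_mod_bound[OF h(1), of m] by simp
    qed
    ultimately show ?thesis using h(1) by (intro exI[of _ h]) auto
  qed
  then obtain h where h: "h \<ge> 2" "\<And>m. P m \<Longrightarrow> h dvd m" by auto
  have "AE \<omega> in M. \<exists>k. \<xi> \<omega> = \<xi> \<omega>0 + h * k"
    using AEP
  proof eventually_elim
    case (elim \<omega>)
    then obtain k where "\<xi> \<omega> - \<xi> \<omega>0 = h * k" using h(2) by (auto simp: dvd_def)
    then have "\<xi> \<omega> = \<xi> \<omega>0 + h * k" by simp
    then show ?case by blast
  qed
  then show False using aper h(1) unfolding aperiodic_def by blast
qed

end

text \<open>A bound on the maximum is a product of indicators, one per summand, so it enters the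
  weight of each factor, and independence turns the weighted Fourier integral into a power. On
  \<open>S = k\<close> the exponential weight is constant, which is the prefactor on the left. With
  \<open>0 < n\<close> the maximum is taken over a nonempty set.\<close>

lemma (in prob_space) truncated_local_probability:
  fixes \<xi> :: "'a \<Rightarrow> int" and X :: "nat \<Rightarrow> 'a \<Rightarrow> int" and k :: int and l c \<rho> :: real
  assumes \<xi> [measurable]: "\<xi> \<in> measurable M (count_space UNIV)"
    and indep: "indep_vars (\<lambda>_. count_space UNIV) X {1..}"
    and ident: "\<And>i. i \<ge> 1 \<Longrightarrow> distr M (count_space UNIV) (X i) = distr M (count_space UNIV) \<xi>"
    and l: "0 \<le> l" and n: "0 < n"
  shows "complex_of_real (2 * pi * exp (l * (real_of_int k - real n * c)) *
      prob {\<omega> \<in> space M. partial_sum X n \<omega> = k \<and> real_of_int (running_max X n \<omega>) \<le> \<rho>})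
    = (CLBINT \<theta>:{-pi..pi}. iexp (- \<theta> * (real_of_int k - real n * c)) * (CLINT \<omega>|M.
        complex_of_real (exp (l * (real_of_int (\<xi> \<omega>) - c)) * indicator {\<omega>. real_of_int (\<xi> \<omega>) \<le> \<rho>} \<omega>)
          * iexp (\<theta> * (real_of_int (\<xi> \<omega>) - c))) ^ n)"
proof -
  have X: "X i \<in> measurable M (count_space UNIV)" if "i \<in> {1..n}" for i
    using indep that unfolding indep_vars_def by auto
  have Xr: "(\<lambda>\<omega>. real_of_int (X i \<omega>)) \<in> borel_measurable M" if "i \<in> {1..n}" for i
    by (rule measurable_compose[OF X[OF that]]) simp
  define S where "S = partial_sum X n"
  define E where "E = {\<omega> \<in> space M. \<forall>i\<in>{1..n}. real_of_int (X i \<omega>) \<le> \<rho>}"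
  have E [measurable]: "E \<in> sets M"
    unfolding E_def
  proof (intro sets.sets_Collect_finite_All')
    show "{\<omega> \<in> space M. real_of_int (X i \<omega>) \<le> \<rho>} \<in> sets M" if "i \<in> {1..n}" for i
      using Xr[OF that] by measurable
  qed (use n in auto)
  have S_real: "(\<lambda>\<omega>. real_of_int (S \<omega>)) \<in> borel_measurable M"
    unfolding S_def partial_sum_def of_int_sum by (intro borel_measurable_sum Xr)
  have S [measurable]: "S \<in> measurable M (count_space UNIV)"
  proof (subst measurable_count_space_eq2_countable)
    show "S \<in> space M \<rightarrow> UNIV \<and> (\<forall>j\<in>UNIV. S -` {j} \<inter> space M \<in> sets M)"
    proof (intro conjI ballI)
      fix j
      have "{\<omega> \<in> space M. real_of_int (S \<omega>) = real_of_int j} \<in> sets M"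
        using S_real by measurable
      then show "S -` {j} \<inter> space M \<in> sets M"
        by (simp add: vimage_def Int_def conj_commute)
    qed simp
  qed
  have max: "real_of_int (running_max X n \<omega>) \<le> \<rho> \<longleftrightarrow> (\<forall>i\<in>{1..n}. real_of_int (X i \<omega>) \<le> \<rho>)" for \<omega>
  proof -
    have "real_of_int (running_max X n \<omega>) \<le> \<rho> \<longleftrightarrow> running_max X n \<omega> \<le> \<lfloor>\<rho>\<rfloor>" by (simp add: le_floor_iff)
    also have "\<dots> \<longleftrightarrow> (\<forall>i\<in>{1..n}. X i \<omega> \<le> \<lfloor>\<rho>\<rfloor>)"
      unfolding running_max_def using n by (subst Max_le_iff) auto
    finally show ?thesis by (simp add: le_floor_iff)
  qed
  have event: "{\<omega> \<in> space M. partial_sum X n \<omega> = k \<and> real_of_int (running_max X n \<omega>) \<le> \<rho>}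
      = E \<inter> {\<omega> \<in> space M. S \<omega> = k}"
    unfolding max E_def S_def by auto
  define w where "w x = exp (l * (real_of_int x - c)) * indicator {x. real_of_int x \<le> \<rho>} x" for x
  define g where "g \<theta> x = complex_of_real (w x) * iexp (\<theta> * (real_of_int x - c))" for \<theta> x
  have g_int: "integrable M (\<lambda>\<omega>. g \<theta> (\<xi> \<omega>))" for \<theta>
  proof (rule integrable_const_bound[where B = "exp (l * (\<rho> - c))"])
    show "AE \<omega> in M. norm (g \<theta> (\<xi> \<omega>)) \<le> exp (l * (\<rho> - c))"
      using l by (intro AE_I2) (auto simp: g_def w_def norm_mult mult_left_mono split: split_indicator)
    have "g \<theta> \<in> borel_measurable (count_space UNIV)" by simp
    then show "(\<lambda>\<omega>. g \<theta> (\<xi> \<omega>)) \<in> borel_measurable M" by measurable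
  qed
  define Z where "Z \<omega> = exp (l * (real_of_int (S \<omega>) - real n * c)) * indicator E \<omega>" for \<omega>
  have prod_w: "(\<Prod>i=1..n. w (X i \<omega>)) = Z \<omega>" if "\<omega> \<in> space M" for \<omega>
  proof (cases "\<forall>i\<in>{1..n}. real_of_int (X i \<omega>) \<le> \<rho>")
    case True
    then have "(\<Prod>i=1..n. w (X i \<omega>)) = (\<Prod>i=1..n. exp (l * (real_of_int (X i \<omega>) - c)))"
      by (intro prod.cong) (auto simp: w_def)
    also have "\<dots> = exp (\<Sum>i=1..n. l * (real_of_int (X i \<omega>) - c))" by (simp add: exp_sum)
    also have "(\<Sum>i=1..n. l * (real_of_int (X i \<omega>) - c)) = l * (real_of_int (S \<omega>) - real n * c)"
      by (simp add: S_def partial_sum_def sum_subtractf sum_distrib_left[symmetric])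
    finally show ?thesis using True that by (simp add: Z_def E_def)
  next
    case False
    then obtain j where j: "j \<in> {1..n}" "\<not> real_of_int (X j \<omega>) \<le> \<rho>" by auto
    then have "w (X j \<omega>) = 0" by (simp add: w_def)
    then have "(\<Prod>i=1..n. w (X i \<omega>)) = 0" using j(1) by (intro prod_zero) auto
    then show ?thesis using False by (auto simp: Z_def E_def)
  qed
  have prod_e: "(\<Prod>i=1..n. iexp (\<theta> * (real_of_int (X i \<omega>) - c))) = iexp (\<theta> * (real_of_int (S \<omega>) - real n * c))" for \<theta> \<omega>
  proof -
    have "(\<Prod>i=1..n. iexp (\<theta> * (real_of_int (X i \<omega>) - c)))
        = exp (\<Sum>i=1..n. \<i> * complex_of_real (\<theta> * (real_of_int (X i \<omega>) - c)))"
      by (simp add: exp_sum)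
    also have "(\<Sum>i=1..n. \<i> * complex_of_real (\<theta> * (real_of_int (X i \<omega>) - c)))
        = \<i> * complex_of_real (\<theta> * (\<Sum>i=1..n. real_of_int (X i \<omega>) - c))"
      by (simp only: sum_distrib_left of_real_sum)
    also have "(\<Sum>i=1..n. real_of_int (X i \<omega>) - c) = real_of_int (S \<omega>) - n * c"
      by (simp add: S_def partial_sum_def sum_subtractf)
    finally show ?thesis .
  qed
  have prod_g: "(\<Prod>i=1..n. g \<theta> (X i \<omega>)) = complex_of_real (Z \<omega>) * iexp (\<theta> * (real_of_int (S \<omega>) - real n * c))"
    if "\<omega> \<in> space M" for \<theta> \<omega>
    using prod_w[OF that] by (simp only: g_def prod.distrib prod_e of_real_prod[symmetric])
  \<comment> \<open>At frequency 0 the product of the factors is \<open>Z\<close> itself, which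
    therefore inherits integrability.\<close>
  have "integrable M (\<lambda>\<omega>. complex_of_real (Z \<omega>)) \<longleftrightarrow> integrable M (\<lambda>\<omega>. \<Prod>i=1..n. g 0 (X i \<omega>))"
  proof (rule Bochner_Integration.integrable_cong[OF refl])
    fix \<omega> assume "\<omega> \<in> space M"
    then show "complex_of_real (Z \<omega>) = (\<Prod>i=1..n. g 0 (X i \<omega>))"
      unfolding prod_g[OF \<open>\<omega> \<in> space M\<close>] by simp
  qed
  also have "\<dots>" by (rule iid_expectation_power(2)[OF \<xi> indep ident g_int])
  finally have "integrable M (\<lambda>\<omega>. complex_of_real (Z \<omega>))" .
  then have Z_int: "integrable M Z" by (simp add: complex_of_real_integrable_eq)
  have "(CLBINT \<theta>:{-pi..pi}. iexp (- \<theta> * (real_of_int k - real n * c)) * (CLINT \<omega>|M. g \<theta> (\<xi> \<omega>)) ^ n)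
     = (CLBINT \<theta>:{-pi..pi}. (CLINT \<omega>|M. Z \<omega> * iexp (\<theta> * real_of_int (S \<omega> - k))))"
  proof (rule arg_cong[of _ _ "\<lambda>f. CLBINT \<theta>:{-pi..pi}. f \<theta>"], rule ext)
    fix \<theta> :: real
    have "iexp (- \<theta> * (real_of_int k - real n * c)) * (CLINT \<omega>|M. g \<theta> (\<xi> \<omega>)) ^ n
        = (CLINT \<omega>|M. iexp (- \<theta> * (real_of_int k - real n * c)) * (\<Prod>i=1..n. g \<theta> (X i \<omega>)))"
      by (simp only: iid_expectation_power(1)[OF \<xi> indep ident g_int] integral_mult_right_zero)
    also have "\<dots> = (CLINT \<omega>|M. Z \<omega> * iexp (\<theta> * real_of_int (S \<omega> - k)))"
    proof (rule Bochner_Integration.integral_cong[OF refl])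
      fix \<omega> assume "\<omega> \<in> space M"
      have "iexp (- \<theta> * (real_of_int k - real n * c)) * iexp (\<theta> * (real_of_int (S \<omega>) - real n * c)) = iexp (\<theta> * real_of_int (S \<omega> - k))"
        unfolding exp_add[symmetric] by (rule arg_cong[of _ _ exp]) (simp add: algebra_simps)
      then show "iexp (- \<theta> * (real_of_int k - real n * c)) * (\<Prod>i=1..n. g \<theta> (X i \<omega>)) = Z \<omega> * iexp (\<theta> * real_of_int (S \<omega> - k))"
        unfolding prod_g[OF \<open>\<omega> \<in> space M\<close>] by (metis mult.left_commute)
    qed
    finally show "iexp (- \<theta> * (real_of_int k - real n * c)) * (CLINT \<omega>|M. g \<theta> (\<xi> \<omega>)) ^ n
        = (CLINT \<omega>|M. Z \<omega> * iexp (\<theta> * real_of_int (S \<omega> - k)))" .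
  qed
  also have "\<dots> = 2 * pi * (\<integral>\<omega>. Z \<omega> * indicator {\<omega>. S \<omega> = k} \<omega> \<partial>M)"
    by (rule int_fourier_inversion[OF S Z_int])
  also have "(\<integral>\<omega>. Z \<omega> * indicator {\<omega>. S \<omega> = k} \<omega> \<partial>M)
     = (\<integral>\<omega>. exp (l * (real_of_int k - real n * c)) * indicator (E \<inter> {\<omega> \<in> space M. S \<omega> = k}) \<omega> \<partial>M)"
    by (rule Bochner_Integration.integral_cong) (auto simp: Z_def split: split_indicator)
  also have "\<dots> = exp (l * (real_of_int k - real n * c)) * prob (E \<inter> {\<omega> \<in> space M. S \<omega> = k})"
    by simp
  finally show ?thesis unfolding event g_def w_def by (simp add: indicator_def)
qed

section \<open>Comparison of scales and identification of the tilt\<close>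

context slowly_varying_variance
begin

text \<open>Eventually the shifted level lies between half and twice the original one, so
  monotonicity and slow variation suffice. It reconciles the truncation of \<open>Y\<close> at
  \<open>r_n - \<mu>\<close> with the variance taken at \<open>r_n\<close>.\<close>

lemma V_shift:
  assumes r: "filterlim r at_top sequentially"
  shows "(\<lambda>n. V (r n - c) / V (r n)) \<longlonglongrightarrow> 1"
proof (rule tendsto_sandwich)
  show "(\<lambda>n. V (1 / 2 * r n) / V (r n)) \<longlonglongrightarrow> 1" "(\<lambda>n. V (2 * r n) / V (r n)) \<longlonglongrightarrow> 1"
    by (intro filterlim_compose[OF V_ratio r]; simp)+
  have ev: "\<forall>\<^sub>F n in sequentially. 2 * \<bar>c\<bar> \<le> r n \<and> 0 < V (r n)"
    using eventually_compose_filterlim[OF eventually_ge_at_top r]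
      eventually_compose_filterlim[OF V_eventually_pos r] by eventually_elim simp
  show "\<forall>\<^sub>F n in sequentially. V (1 / 2 * r n) / V (r n) \<le> V (r n - c) / V (r n)"
    using ev by eventually_elim (auto intro!: divide_right_mono V_mono)
  show "\<forall>\<^sub>F n in sequentially. V (r n - c) / V (r n) \<le> V (2 * r n) / V (r n)"
    using ev by eventually_elim (auto intro!: divide_right_mono V_mono)
qed

text \<open>Here \<open>x_n \<ge> a_n\<close> bounds the truncation level. If \<open>a < R\<close>,
  put \<open>w^2 = R / a\<close>; then \<open>a * R \<le> n * t * R \<le> 2 * n * V R \<le> 4 * w *
  n * V a \<le> 8 * w * a^2\<close> by Potter's bound, so \<open>w \<le> 8\<close> and
  \<open>R \<le> 64 * a\<close>. Hence \<open>R^2 \<le> 64 * n * t * R \<le> 128 * n * V R\<close>,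
  below \<open>12^2 * n * V R\<close>. For the other bound, \<open>a \<le> n * t \<le> n\<close>
  gives \<open>R \<le> 64 * n\<close>, and \<open>V_le\<close> does the rest.\<close>

lemma scale_bounds:
  assumes a: "filterlim a at_top sequentially"
    and a_norm: "(\<lambda>n. V (a n) / (a n)\<^sup>2 * real n) \<longlonglongrightarrow> 1"
    and R: "filterlim R at_top sequentially"
    and tR: "(\<lambda>n. t n * (R n / V (R n))) \<longlonglongrightarrow> 1"
    and at: "\<forall>\<^sub>F n in sequentially. a n \<le> real n * t n" and t: "t \<longlonglongrightarrow> 0"
  shows "\<forall>\<^sub>F n in sequentially. R n \<le> 12 * sqrt (real n * V (R n))"
    and "\<forall>\<^sub>F n in sequentially. sqrt (real n * V (R n)) \<le> 8 * (expectation (\<lambda>\<omega>. \<bar>Y \<omega>\<bar>) + 1) * real n"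
proof -
  obtain y0 where y0: "0 < y0" "0 < V y0" and potter:
    "\<And>y z. y0 \<le> y \<Longrightarrow> y \<le> z \<Longrightarrow> V z \<le> 2 * sqrt (z / y) * V y" using V_potter by blast
  have "\<forall>\<^sub>F n in sequentially. V (a n) / (a n)\<^sup>2 * real n < 2"
    "\<forall>\<^sub>F n in sequentially. t n * (R n / V (R n)) < 2"
    "\<forall>\<^sub>F n in sequentially. 1 / 2 < t n * (R n / V (R n))"
    "\<forall>\<^sub>F n in sequentially. t n < 1"
    by (intro order_tendstoD[OF a_norm] order_tendstoD[OF tR] order_tendstoD[OF t]; simp)+
  then have ev: "\<forall>\<^sub>F n in sequentially. 0 < n \<and> 0 < R n \<and> 0 < V (R n) \<and> 0 < a n \<and> a n \<le> real n * t n
      \<and> R n \<le> 64 * a n \<and> t n * R n < 2 * V (R n) \<and> t n < 1"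
    using at eventually_compose_filterlim[OF V_eventually_pos R]
      eventually_compose_filterlim[OF eventually_ge_at_top[of y0] a]
      eventually_compose_filterlim[OF eventually_gt_at_top[of 0] R] eventually_gt_at_top[of 0]
  proof eventually_elim
    case (elim n)
    have an: "0 < a n" using elim y0 by linarith
    have "V (a n) / (a n)\<^sup>2 * real n < 2" by fact
    then have Va: "real n * V (a n) \<le> 2 * (a n)\<^sup>2" using an by (simp add: field_simps)
    have VR: "V (R n) \<le> 2 * (t n * R n)" "t n * R n < 2 * V (R n)" using elim by (auto simp: field_simps)
    have "R n \<le> 64 * a n"
    proof (cases "R n \<le> a n")
      case False
      define w where "w = sqrt (R n / a n)"
      have w: "0 < w" "R n = w\<^sup>2 * a n" using elim an by (auto simp: w_def)
      have "a n * R n \<le> (real n * t n) * R n" using elim by (intro mult_right_mono) auto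
      also have "\<dots> = real n * (t n * R n)" by simp
      also have "\<dots> \<le> real n * (2 * V (R n))" using VR by (intro mult_left_mono) auto
      also have "\<dots> \<le> real n * (2 * (2 * w * V (a n)))"
        using potter[of "a n" "R n"] elim False by (intro mult_left_mono) (auto simp: w_def)
      also have "\<dots> = 4 * w * (real n * V (a n))" by simp
      also have "\<dots> \<le> 4 * w * (2 * (a n)\<^sup>2)" using Va w by (intro mult_left_mono) auto
      finally have "w * (w * (a n)\<^sup>2) \<le> 8 * (w * (a n)\<^sup>2)"
        unfolding w(2) by (simp add: power2_eq_square mult_ac)
      then have w8: "w \<le> 8" using w(1) an by (simp add: mult_le_cancel_right)
      have "w\<^sup>2 \<le> 8\<^sup>2" using w8 w(1) by (intro power_mono) auto
      then show ?thesis unfolding w(2) using an by simp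
    qed (use an in simp)
    then show ?case using elim an VR by simp
  qed
  show "\<forall>\<^sub>F n in sequentially. R n \<le> 12 * sqrt (real n * V (R n))"
    using ev
  proof eventually_elim
    case (elim n)
    have "R n * R n \<le> 64 * a n * R n" using elim by (intro mult_right_mono) auto
    also have "\<dots> \<le> 64 * (real n * t n) * R n" using elim by (intro mult_right_mono mult_left_mono) auto
    also have "\<dots> = 64 * (real n * (t n * R n))" by simp
    also have "\<dots> \<le> 64 * (real n * (2 * V (R n)))" using elim by (intro mult_left_mono) auto
    also have "\<dots> \<le> 12\<^sup>2 * (real n * V (R n))" using elim by simp
    finally have "(R n)\<^sup>2 \<le> 12\<^sup>2 * (real n * V (R n))" by (simp add: power2_eq_square)
    then have "R n \<le> sqrt (12\<^sup>2 * (real n * V (R n)))" by (rule real_le_rsqrt)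
    also have "\<dots> = 12 * sqrt (real n * V (R n))" by (simp add: real_sqrt_mult)
    finally show ?case .
  qed
  show "\<forall>\<^sub>F n in sequentially. sqrt (real n * V (R n)) \<le> 8 * (expectation (\<lambda>\<omega>. \<bar>Y \<omega>\<bar>) + 1) * real n"
    using ev
  proof eventually_elim
    case (elim n)
    define e where "e = expectation (\<lambda>\<omega>. \<bar>Y \<omega>\<bar>)"
    have e: "0 \<le> e" by (simp add: e_def)
    have "real n * t n \<le> real n * 1" using elim by (intro mult_left_mono) auto
    moreover have "a n \<le> real n * t n" "R n \<le> 64 * a n" using elim by auto
    ultimately have Rn: "R n \<le> 64 * real n" by linarith
    have "V (R n) \<le> R n * e" using V_le[of "R n"] elim by (simp add: e_def)
    also have "\<dots> \<le> 64 * real n * e" using Rn e by (rule mult_right_mono)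
    also have "\<dots> \<le> 64 * real n * (e + 1)\<^sup>2"
      using e by (intro mult_left_mono) (auto simp: power2_eq_square algebra_simps)
    finally have "real n * V (R n) \<le> real n * (64 * real n * (e + 1)\<^sup>2)" by (intro mult_left_mono) auto
    also have "\<dots> = (8 * (e + 1) * real n)\<^sup>2" by (simp add: power2_eq_square algebra_simps)
    finally show ?case unfolding e_def[symmetric] using e by (intro real_le_lsqrt) auto
  qed
qed

text \<open>Every \<open>u \<ge> 0\<close> is a limit point of \<open>{0..}\<close>, so the
  one-sided derivative is unique and equals \<open>dmgf\<close>. Centring moves the truncation from
  \<open>\<rho>\<close> to \<open>\<rho> - mean M \<xi>\<close>.\<close>

lemma tilted_mean_eq:
  fixes \<xi> :: "'a \<Rightarrow> int"
  assumes Y: "\<And>\<omega>. Y \<omega> = real_of_int (\<xi> \<omega>) - mean M \<xi>" and u: "0 \<le> u"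
  shows "tilted_mean M \<xi> \<rho> u = dmgf (\<rho> - mean M \<xi>) u / mgf (\<rho> - mean M \<xi>) u"
proof -
  have mgf: "trunc_mgf M \<xi> \<rho> = mgf (\<rho> - mean M \<xi>)"
    unfolding trunc_mgf_def mgf_def
    by (intro ext Bochner_Integration.integral_cong) (simp_all add: W_def Y indicator_def)
  have "u islimpt {u<..<u + 1}" by (rule islimpt_greaterThanLessThan1) simp
  then have "u islimpt {0..}" by (rule islimpt_subset) (use u in auto)
  then have "at u within {0..} \<noteq> bot" by (simp add: trivial_limit_within)
  then have "vector_derivative (trunc_mgf M \<xi> \<rho>) (at u within {0..}) = dmgf (\<rho> - mean M \<xi>) u"
    unfolding mgf using mgf_has_derivative[OF u]
    by (intro vector_derivative_within) (simp_all add: has_real_derivative_iff_has_vector_derivative)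
  then show ?thesis unfolding tilted_mean_def mgf by simp
qed

text \<open>Strict monotonicity makes the tilted mean injective on \<open>{0..}\<close>, so a
  solution found by the intermediate value theorem is the value of the inverse function.\<close>

lemma tilt_eq:
  fixes \<xi> :: "'a \<Rightarrow> int"
  assumes Y: "\<And>\<omega>. Y \<omega> = real_of_int (\<xi> \<omega>) - mean M \<xi>"
    and nondeg: "\<And>c. \<not> (AE \<omega> in M. Y \<omega> \<le> \<rho> - mean M \<xi> \<longrightarrow> Y \<omega> = c)"
    and l: "0 \<le> l" "dmgf (\<rho> - mean M \<xi>) l / mgf (\<rho> - mean M \<xi>) l = t"
  shows "tilt M \<xi> \<rho> t = l"
  unfolding tilt_def
proof (rule the_inv_into_f_eq)
  show "inj_on (tilted_mean M \<xi> \<rho>) {0..}"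
  proof (rule inj_onI, rule ccontr)
    fix u v assume "u \<in> {0..}" "v \<in> {0..}" "tilted_mean M \<xi> \<rho> u = tilted_mean M \<xi> \<rho> v" "u \<noteq> v"
    then show False
      using tilted_mean_strict_mono[OF nondeg, of u v] tilted_mean_strict_mono[OF nondeg, of v u]
      by (cases "u < v") (auto simp: tilted_mean_eq[OF Y])
  qed
qed (use l in \<open>auto simp: tilted_mean_eq[OF Y]\<close>)

end

context tilted_sequence
begin

lemma local_limit_rescaled:
  assumes d: "(\<lambda>n. d n * inverse (B n)) \<longlonglongrightarrow> 0"
  shows "(\<lambda>n. B n * (CLBINT \<theta>:{-pi..pi}. iexp (\<theta> * d n) * \<psi> n \<theta> ^ n)) \<longlonglongrightarrow> complex_of_real (sqrt (2 * pi))"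
proof (rule Lim_transform_eventually[OF local_limit[OF d]])
  show "\<forall>\<^sub>F n in sequentially.
      (CLBINT s:{- (pi * B n)..pi * B n}. iexp (s * (d n * inverse (B n))) * \<psi> n (s / B n) ^ n)
      = B n * (CLBINT \<theta>:{-pi..pi}. iexp (\<theta> * d n) * \<psi> n \<theta> ^ n)"
    using regular
  proof eventually_elim
    case (elim n)
    then have B: "0 < B n" by simp
    have "(CLBINT s:{- (pi * B n)..pi * B n}. iexp (s * (d n * inverse (B n))) * \<psi> n (s / B n) ^ n)
      = \<bar>B n\<bar> *\<^sub>R (LBINT \<theta>. indicator {- (pi * B n)..pi * B n} (0 + B n * \<theta>) *\<^sub>R
          (iexp ((0 + B n * \<theta>) * (d n * inverse (B n))) * \<psi> n ((0 + B n * \<theta>) / B n) ^ n))"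
      unfolding set_lebesgue_integral_def using B by (intro lborel_integral_real_affine) simp
    also have "(\<lambda>\<theta>. indicator {- (pi * B n)..pi * B n} (0 + B n * \<theta>) *\<^sub>R
          (iexp ((0 + B n * \<theta>) * (d n * inverse (B n))) * \<psi> n ((0 + B n * \<theta>) / B n) ^ n))
        = (\<lambda>\<theta>. indicator {-pi..pi} \<theta> *\<^sub>R (iexp (\<theta> * d n) * \<psi> n \<theta> ^ n))"
    proof
      fix \<theta>
      have "- (pi * B n) \<le> B n * \<theta> \<longleftrightarrow> - pi \<le> \<theta>" "B n * \<theta> \<le> pi * B n \<longleftrightarrow> \<theta> \<le> pi"
        using B mult_le_cancel_left_pos[OF B, of "- pi" \<theta>] mult_le_cancel_left_pos[OF B, of \<theta> pi]
        by (simp_all add: mult.commute)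
      then have "indicator {- (pi * B n)..pi * B n} (0 + B n * \<theta>) = (indicator {-pi..pi} \<theta> :: real)"
        by (simp add: indicator_def)
      moreover have "(0 + B n * \<theta>) * (d n * inverse (B n)) = \<theta> * d n" "(0 + B n * \<theta>) / B n = \<theta>"
        using B by auto
      ultimately show "indicator {- (pi * B n)..pi * B n} (0 + B n * \<theta>) *\<^sub>R
          (iexp ((0 + B n * \<theta>) * (d n * inverse (B n))) * \<psi> n ((0 + B n * \<theta>) / B n) ^ n)
          = indicator {-pi..pi} \<theta> *\<^sub>R (iexp (\<theta> * d n) * \<psi> n \<theta> ^ n)"
        by (simp only:)
    qed
    finally show ?case using B by (simp add: set_lebesgue_integral_def scaleR_conv_of_real)
  qed
qed

end

section \<open>Removal of the tilt: the local estimate for truncated sums\<close>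

theorem proposition2p15:
  fixes \<Omega> :: "'a measure"
    and \<xi> :: "'a \<Rightarrow> int"
    and X :: "nat \<Rightarrow> 'a \<Rightarrow> int"
    and a :: "nat \<Rightarrow> real"
    and r :: "real \<Rightarrow> real"
    and x :: "nat \<Rightarrow> int"
    and rn :: "nat \<Rightarrow> real"
  assumes prob: "prob_space \<Omega>"
    and xi_rv: "\<xi> \<in> measurable \<Omega> (count_space UNIV)"
    and indep: "prob_space.indep_vars \<Omega> (\<lambda>_. count_space UNIV) X {1..}"
    and ident: "\<And>i. i \<ge> 1 \<Longrightarrow> distr \<Omega> (count_space UNIV) (X i) = distr \<Omega> (count_space UNIV) \<xi>"
    and aper: "aperiodic \<Omega> \<xi>"
    and integr: "integrable \<Omega> (\<lambda>\<omega>. real_of_int (\<xi> \<omega>))"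
    and slow: "slowly_varying (trunc_var \<Omega> \<xi>)"
    and a_pos: "\<And>n. n \<ge> 1 \<Longrightarrow> a n > 0"
    and a_lim: "filterlim a at_top sequentially"
    and a_norm: "(\<lambda>n. trunc_var \<Omega> \<xi> (a n) / (a n)\<^sup>2) \<sim>[sequentially] (\<lambda>n. 1 / real n)"
    and r_nonneg: "\<And>t. t > 0 \<Longrightarrow> r t \<ge> 0"
    and r_lim: "filterlim r at_top at_top"
    and r_norm: "(\<lambda>t. r t / trunc_var \<Omega> \<xi> (r t)) \<sim>[at_top] (\<lambda>t. t)"
    and x_ge: "\<And>n. n \<ge> 1 \<Longrightarrow> real_of_int (x n) \<ge> a n"
    and x_lim: "(\<lambda>n. real_of_int (x n) / real n) \<longlonglongrightarrow> 0"
    and rn: "\<And>n. n \<ge> 1 \<Longrightarrow> rn n = r (real n / real_of_int (x n))"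
  shows "(\<lambda>n. measure \<Omega> {\<omega> \<in> space \<Omega>.
              partial_sum X n \<omega> - \<lfloor>real n * mean \<Omega> \<xi>\<rfloor> = x n \<and>
              real_of_int (running_max X n \<omega>) \<le> rn n})
         \<sim>[sequentially]
         (\<lambda>n. 1 / sqrt (2 * pi * real n * trunc_var \<Omega> \<xi> (rn n)) *
              exp (- (real n * entropy \<Omega> \<xi> (rn n) (real_of_int (x n) / real n))))"
proof -
  interpret P: prob_space \<Omega> by (rule prob)
  note xi_rv[measurable]
  define \<mu> where "\<mu> = mean \<Omega> \<xi>"
  define Y where "Y \<omega> = real_of_int (\<xi> \<omega>) - \<mu>" for \<omega>
  have trunc_var: "trunc_var \<Omega> \<xi> = (\<lambda>y. \<integral>\<omega>. (Y \<omega>)\<^sup>2 * indicator {\<omega>. \<bar>Y \<omega>\<bar> \<le> y} \<omega> \<partial>\<Omega>)"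
    unfolding trunc_var_def Y_def \<mu>_def by (rule ext) (rule refl)
  interpret S: slowly_varying_variance \<Omega> Y
  proof unfold_locales
    show "Y \<in> borel_measurable \<Omega>" unfolding Y_def by measurable
    show "integrable \<Omega> Y" unfolding Y_def using integr by simp
    show "P.expectation Y = 0" unfolding Y_def using integr by (simp add: \<mu>_def mean_def P.prob_space)
    show "slowly_varying (\<lambda>y. \<integral>\<omega>. (Y \<omega>)\<^sup>2 * indicator {\<omega>. \<bar>Y \<omega>\<bar> \<le> y} \<omega> \<partial>\<Omega>)"
      using slow unfolding trunc_var .
  qed
  have V: "trunc_var \<Omega> \<xi> y = S.V y" for y by (simp add: trunc_var S.V_def)
  have Y_eq: "Y \<omega> = real_of_int (\<xi> \<omega>) - mean \<Omega> \<xi>" for \<omega> by (simp add: Y_def \<mu>_def)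
  define t where "t n = real_of_int (x n) / real n" for n
  define R where "R n = rn n - \<mu>" for n
  define l where "l n = tilt \<Omega> \<xi> (rn n) (t n)" for n
  have t_lim: "t \<longlonglongrightarrow> 0" using x_lim by (simp add: t_def[abs_def])
  have t_pos: "0 < t n" if "n \<ge> 1" for n
    using a_pos[OF that] x_ge[OF that] that by (auto simp: t_def intro!: divide_pos_pos)
  have "\<forall>\<^sub>F n in sequentially. 0 < t n"
    using eventually_ge_at_top[of 1] by eventually_elim (rule t_pos)
  \<comment> \<open>As \<open>rn n\<close> is eventually \<open>r\<close> at
    \<open>inverse (t n)\<close>, this limit carries the asymptotic properties of \<open>r\<close>
    over to the sequence.\<close>
  with t_lim have inv_t: "filterlim (\<lambda>n. inverse (t n)) at_top sequentially"
    by (rule filterlim_inverse_at_top)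
  have rn_eq: "\<forall>\<^sub>F n in sequentially. r (inverse (t n)) = rn n"
    using eventually_ge_at_top[of 1] by eventually_elim (simp add: rn t_def)
  have rn_lim: "filterlim rn at_top sequentially"
    by (rule filterlim_cong[THEN iffD1, OF refl refl rn_eq]) (rule filterlim_compose[OF r_lim inv_t])
  have R_lim: "filterlim R at_top sequentially"
    unfolding R_def[abs_def] using filterlim_tendsto_add_at_top[OF tendsto_const rn_lim, of "- \<mu>"] by simp
  have V_rn: "(\<lambda>n. S.V (R n) / S.V (rn n)) \<longlonglongrightarrow> 1"
    unfolding R_def by (rule S.V_shift[OF rn_lim])
  have pos: "\<forall>\<^sub>F n in sequentially. 1 \<le> n \<and> 0 < rn n \<and> 0 < R n \<and> 0 < S.V (rn n) \<and> 0 < S.V (R n)"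
    using eventually_ge_at_top[of 1] eventually_compose_filterlim[OF eventually_gt_at_top[of 0] rn_lim]
      eventually_compose_filterlim[OF eventually_gt_at_top[of 0] R_lim]
      eventually_compose_filterlim[OF S.V_eventually_pos rn_lim]
      eventually_compose_filterlim[OF S.V_eventually_pos R_lim] by eventually_elim simp
  have trn: "(\<lambda>n. t n * (rn n / S.V (rn n))) \<longlonglongrightarrow> 1"
  proof -
    have "((\<lambda>u. (r u / S.V (r u)) / u) \<longlongrightarrow> 1) at_top"
      using r_norm unfolding V by (rule asymp_equivD_strong)
        (rule eventually_mono[OF eventually_gt_at_top[of 0]], simp)
    from filterlim_compose[OF this inv_t]
    have "(\<lambda>n. r (inverse (t n)) / S.V (r (inverse (t n))) / inverse (t n)) \<longlonglongrightarrow> 1" .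
    moreover have "\<forall>\<^sub>F n in sequentially. r (inverse (t n)) / S.V (r (inverse (t n))) / inverse (t n)
        = t n * (rn n / S.V (rn n))"
      using rn_eq by eventually_elim (simp add: field_simps)
    ultimately show ?thesis by (rule Lim_transform_eventually)
  qed
  \<comment> \<open>The same relation at the level \<open>rn n - \<mu>\<close> of the centred
    variable: levels and variances both change by factors tending to 1.\<close>
  have tR: "(\<lambda>n. t n * (R n / S.V (R n))) \<longlonglongrightarrow> 1"
  proof -
    have "(\<lambda>n. t n * (rn n / S.V (rn n)) * (1 - \<mu> * inverse (rn n)) / (S.V (R n) / S.V (rn n)))
        \<longlonglongrightarrow> 1 * (1 - \<mu> * 0) / 1"
      by (intro tendsto_intros trn V_rn tendsto_inverse_0_at_top[OF rn_lim]) auto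
    moreover have "\<forall>\<^sub>F n in sequentially. t n * (rn n / S.V (rn n)) * (1 - \<mu> * inverse (rn n))
        / (S.V (R n) / S.V (rn n)) = t n * (R n / S.V (R n))"
      using pos by eventually_elim (auto simp: R_def field_simps)
    ultimately show ?thesis by (auto elim: Lim_transform_eventually)
  qed
  have a_norm': "(\<lambda>n. S.V (a n) / (a n)\<^sup>2 * real n) \<longlonglongrightarrow> 1"
  proof -
    have "(\<lambda>n. (S.V (a n) / (a n)\<^sup>2) / (1 / real n)) \<longlonglongrightarrow> 1"
      using a_norm unfolding V by (rule asymp_equivD_strong)
        (rule eventually_mono[OF eventually_gt_at_top[of 0]], simp)
    then show ?thesis by simp
  qed
  have "\<forall>\<^sub>F n in sequentially. a n \<le> real n * t n"
    using eventually_ge_at_top[of 1] by eventually_elim (use x_ge in \<open>auto simp: t_def\<close>)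
  note bounds = S.scale_bounds[OF a_lim a_norm' R_lim tR this t_lim]
  obtain R0 where R0: "\<And>R c. R0 \<le> R \<Longrightarrow> \<not> (AE \<omega> in \<Omega>. Y \<omega> \<le> R \<longrightarrow> Y \<omega> = c)"
    using S.nondegenerate by blast
  have tilt: "\<forall>\<^sub>F n in sequentially. 0 < l n \<and> 1 / 2 \<le> l n * R n \<and> l n * R n \<le> 2
        \<and> S.dmgf (R n) (l n) / S.mgf (R n) (l n) = t n"
    using S.tilt_exists[OF R_lim tR] eventually_compose_filterlim[OF eventually_ge_at_top[of R0] R_lim]
  proof eventually_elim
    case (elim n)
    then obtain l' where l': "1 / 2 \<le> l' * R n" "l' * R n \<le> 2" "0 < l'"
      "S.dmgf (R n) l' / S.mgf (R n) l' = t n" by blast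
    have "l n = l'"
      unfolding l_def using l' R0[OF elim(2)] by (intro S.tilt_eq[OF Y_eq]) (auto simp: R_def \<mu>_def)
    then show ?case using l' by simp
  qed
  define E where "E = P.expectation (\<lambda>\<omega>. \<bar>Y \<omega>\<bar>)"
  have E: "0 \<le> E" by (simp add: E_def)
  interpret Q: tilted_sequence \<Omega> Y R l t 12 "8 * (E + 1)"
  proof unfold_locales
    show "\<forall>\<^sub>F n in sequentially. R n \<le> 12 * sqrt (real n * S.V (R n))" by (rule bounds(1))
    show "\<forall>\<^sub>F n in sequentially. sqrt (real n * S.V (R n)) \<le> 8 * (E + 1) * real n"
      unfolding E_def by (rule bounds(2))
    show "cmod (CLINT \<omega>|\<Omega>. iexp (\<theta> * Y \<omega>)) < 1" if "0 < \<bar>\<theta>\<bar>" "\<bar>\<theta>\<bar> \<le> pi" for \<theta>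
      unfolding Y_def by (rule P.aperiodic_char_less_1[OF xi_rv aper that])
  qed (use R_lim tilt t_lim E in auto)
  \<comment> \<open>The fractional part of \<open>n * \<mu>\<close>, left over by the floor: the
    event puts the centred sum at \<open>x n - d n\<close>, which is \<open>d n\<close> below its
    tilted mean \<open>n * t n = x n\<close>. Only boundedness of \<open>d\<close> matters.\<close>
  define d where "d n = real n * \<mu> - \<lfloor>real n * \<mu>\<rfloor>" for n
  have d01: "0 \<le> d n" "d n \<le> 1" for n unfolding d_def by linarith+
  have small: "(\<lambda>n. d n * f n) \<longlonglongrightarrow> 0" if "f \<longlonglongrightarrow> 0" for f
  proof (rule Lim_null_comparison)
    show "(\<lambda>n. \<bar>f n\<bar>) \<longlonglongrightarrow> 0" using that by (rule tendsto_rabs_zero)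
    show "\<forall>\<^sub>F n in sequentially. norm (d n * f n) \<le> \<bar>f n\<bar>"
      using d01 by (intro always_eventually allI) (auto simp: abs_mult intro!: mult_left_le_one_le)
  qed
  have l_lim: "l \<longlonglongrightarrow> 0"
  proof (rule Lim_null_comparison)
    show "\<forall>\<^sub>F n in sequentially. norm (l n) \<le> 2 * inverse (R n)"
      using tilt pos by eventually_elim (auto simp: field_simps)
    show "(\<lambda>n. 2 * inverse (R n)) \<longlonglongrightarrow> 0"
      using tendsto_mult_right_zero[OF tendsto_inverse_0_at_top[OF R_lim], of 2] by simp
  qed
  define J where "J n = (CLBINT \<theta>:{-pi..pi}. iexp (\<theta> * d n) * Q.\<psi> n \<theta> ^ n)" for n
  have J: "(\<lambda>n. Q.B n * J n) \<longlonglongrightarrow> complex_of_real (sqrt (2 * pi))"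
    unfolding J_def by (intro Q.local_limit_rescaled small Q.inverse_B_lim)
  let ?p = "\<lambda>n. measure \<Omega> {\<omega> \<in> space \<Omega>. partial_sum X n \<omega> - \<lfloor>real n * mean \<Omega> \<xi>\<rfloor> = x n \<and>
              real_of_int (running_max X n \<omega>) \<le> rn n}"
  let ?q = "\<lambda>n. 1 / sqrt (2 * pi * real n * trunc_var \<Omega> \<xi> (rn n)) *
              exp (- (real n * entropy \<Omega> \<xi> (rn n) (real_of_int (x n) / real n)))"
  \<comment> \<open>For large \<open>n\<close> this is an exact identity. Each of its pieces tends
    to 1: the exponential of the displacement, the normalised Fourier integral, and the ratio of the
    variances at the two levels.\<close>
  have main: "\<forall>\<^sub>F n in sequentially.
      exp (d n * l n) * (Re (Q.B n * J n) / sqrt (2 * pi)) / sqrt (S.V (R n) / S.V (rn n)) = ?p n / ?q n"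
    using Q.regular pos
  proof eventually_elim
    case (elim n)
    define m where "m = S.mgf (R n) (l n)"
    define k where "k = x n + \<lfloor>real n * \<mu>\<rfloor>"
    have reg: "0 < n" "0 < m" "0 \<le> l n" "0 < Q.B n" "0 < S.V (R n)" "0 < S.V (rn n)"
      using elim by (auto simp: m_def)
    have nt: "real n * t n = x n" using reg(1) by (simp add: t_def)
    have k: "real_of_int k - real n * \<mu> = x n - d n" by (simp add: k_def d_def)
    have event: "?p n = P.prob {\<omega> \<in> space \<Omega>. partial_sum X n \<omega> = k \<and> real_of_int (running_max X n \<omega>) \<le> rn n}"
      unfolding k_def \<mu>_def by (rule arg_cong[of _ _ "measure \<Omega>"]) auto
    have char: "(CLINT \<omega>|\<Omega>. complex_of_real (exp (l n * (\<xi> \<omega> - \<mu>)) * indicator {\<omega>. real_of_int (\<xi> \<omega>) \<le> rn n} \<omega>)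
          * iexp (\<theta> * (\<xi> \<omega> - \<mu>))) = m * (iexp (\<theta> * t n) * Q.\<psi> n \<theta>)" for \<theta>
    proof -
      have "complex_of_real (exp (l n * (\<xi> \<omega> - \<mu>)) * indicator {\<omega>. real_of_int (\<xi> \<omega>) \<le> rn n} \<omega>) * iexp (\<theta> * (\<xi> \<omega> - \<mu>))
        = iexp (\<theta> * t n) * (complex_of_real (S.W (R n) (l n) \<omega>) * iexp (\<theta> * (Y \<omega> - t n)))" for \<omega>
      proof -
        have e1: "iexp (\<theta> * (\<xi> \<omega> - \<mu>)) = iexp (\<theta> * t n) * iexp (\<theta> * (Y \<omega> - t n))"
          unfolding exp_add[symmetric] Y_def by (rule arg_cong[of _ _ exp]) (simp add: algebra_simps)
        have e2: "exp (l n * (\<xi> \<omega> - \<mu>)) * indicator {\<omega>. real_of_int (\<xi> \<omega>) \<le> rn n} \<omega> = S.W (R n) (l n) \<omega>"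
          by (simp add: S.W_def Y_def R_def indicator_def)
        show ?thesis unfolding e1 e2 by (rule mult.left_commute)
      qed
      then have "(CLINT \<omega>|\<Omega>. complex_of_real (exp (l n * (\<xi> \<omega> - \<mu>)) * indicator {\<omega>. real_of_int (\<xi> \<omega>) \<le> rn n} \<omega>)
          * iexp (\<theta> * (\<xi> \<omega> - \<mu>)))
          = iexp (\<theta> * t n) * (CLINT \<omega>|\<Omega>. complex_of_real (S.W (R n) (l n) \<omega>) * iexp (\<theta> * (Y \<omega> - t n)))"
        by (simp only: integral_mult_right_zero)
      also have "(CLINT \<omega>|\<Omega>. complex_of_real (S.W (R n) (l n) \<omega>) * iexp (\<theta> * (Y \<omega> - t n))) = m * Q.\<psi> n \<theta>"
        using reg(2) by (simp add: Q.\<psi>_def S.tilted_char_def m_def)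
      finally show ?thesis by (simp only: mult.left_commute)
    qed
    have "complex_of_real (2 * pi * exp (l n * (k - n * \<mu>)) * ?p n)
       = (CLBINT \<theta>:{-pi..pi}. iexp (- \<theta> * (k - n * \<mu>)) * (m * (iexp (\<theta> * t n) * Q.\<psi> n \<theta>)) ^ n)"
      unfolding event
      by (subst P.truncated_local_probability[OF xi_rv indep ident reg(3,1)]) (simp_all only: char)
    \<comment> \<open>Centring the \<open>n\<close> factors at \<open>t n\<close> contributes the
      phase \<open>\<theta> * x n\<close>, which cancels the inversion phase up to
      \<open>\<theta> * d n\<close>.\<close>
    also have "\<dots> = (CLBINT \<theta>:{-pi..pi}. complex_of_real (m ^ n) * (iexp (\<theta> * d n) * Q.\<psi> n \<theta> ^ n))"
    proof (rule arg_cong[of _ _ "\<lambda>f. CLBINT \<theta>:{-pi..pi}. f \<theta>"], rule ext)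
      fix \<theta> :: real
      have e1: "iexp (\<theta> * t n) ^ n = iexp (\<theta> * x n)"
        unfolding nt[symmetric] exp_of_nat_mult[symmetric]
        by (rule arg_cong[of _ _ exp]) simp
      have e2: "iexp (- \<theta> * (k - n * \<mu>)) * iexp (\<theta> * x n) = iexp (\<theta> * d n)"
        unfolding exp_add[symmetric] k by (rule arg_cong[of _ _ exp]) (simp add: algebra_simps)
      show "iexp (- \<theta> * (k - n * \<mu>)) * (m * (iexp (\<theta> * t n) * Q.\<psi> n \<theta>)) ^ n
          = complex_of_real (m ^ n) * (iexp (\<theta> * d n) * Q.\<psi> n \<theta> ^ n)"
        unfolding power_mult_distrib of_real_power e1 e2[symmetric] by (simp only: mult_ac)
    qed
    also have "\<dots> = complex_of_real (m ^ n) * J n"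
      unfolding J_def by (rule set_integral_mult_right)
    finally have "Re (complex_of_real (2 * pi * exp (l n * (k - n * \<mu>)) * ?p n)) = Re (complex_of_real (m ^ n) * J n)"
      by (rule arg_cong)
    then have p: "2 * pi * exp (l n * (x n - d n)) * ?p n = m ^ n * Re (J n)"
      unfolding k by (simp only: Re_complex_of_real times_complex.sel Im_complex_of_real)
    have "trunc_mgf \<Omega> \<xi> (rn n) (l n) = m"
      by (simp add: trunc_mgf_def m_def S.mgf_def S.W_def Y_eq R_def \<mu>_def indicator_def)
    \<comment> \<open>As \<open>n * t n = x n\<close>, the entropy factor is exactly the
      \<open>n\<close>-th power of the normalisation times the inverse tilt at \<open>x n\<close>,
      that is, what the change of measure leaves apart from the displacement.\<close>
    then have ent: "exp (- (real n * entropy \<Omega> \<xi> (rn n) (t n))) = m ^ n * exp (- (l n * x n))"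
    proof -
      assume *: "trunc_mgf \<Omega> \<xi> (rn n) (l n) = m"
      have "- (real n * entropy \<Omega> \<xi> (rn n) (t n)) = real n * ln m - l n * (real n * t n)"
        unfolding entropy_def l_def[symmetric] * by (simp add: algebra_simps)
      also have "\<dots> = real n * ln m + - (l n * x n)" by (simp only: nt)
      finally show ?thesis using reg(2) by (simp only: exp_add exp_of_nat_mult exp_ln)
    qed
    have BV: "Q.B n / sqrt (S.V (R n) / S.V (rn n)) = sqrt (real n * S.V (rn n))"
      using reg by (simp add: Q.B_def real_sqrt_mult real_sqrt_divide)
    have pn: "?p n = m ^ n * exp (- (l n * x n)) * exp (d n * l n) * Re (J n) / (2 * pi)"
    proof -
      have e: "exp (l n * (x n - d n)) * (exp (- (l n * x n)) * exp (d n * l n)) = 1"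
        unfolding exp_add[symmetric] by (simp add: algebra_simps)
      have "2 * pi * ?p n = 2 * pi * ?p n * (exp (l n * (x n - d n)) * (exp (- (l n * x n)) * exp (d n * l n)))"
        by (simp only: e mult_1_right)
      also have "\<dots> = (2 * pi * exp (l n * (x n - d n)) * ?p n) * (exp (- (l n * x n)) * exp (d n * l n))"
        by (simp only: mult_ac)
      also have "\<dots> = 2 * pi * (m ^ n * exp (- (l n * x n)) * exp (d n * l n) * Re (J n) / (2 * pi))"
        unfolding p by simp
      finally show ?thesis by (rule mult_left_cancel[THEN iffD1, rotated]) simp
    qed
    have sq: "sqrt (2 * pi * real n * S.V (rn n)) = sqrt (2 * pi) * sqrt (real n * S.V (rn n))"
      by (simp add: real_sqrt_mult)
    have "?p n / ?q n = exp (d n * l n) * Re (J n) / (2 * pi) * (sqrt (2 * pi) * sqrt (real n * S.V (rn n)))"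
      unfolding pn V t_def[symmetric] ent sq using reg(2) by simp
    also have "\<dots> = exp (d n * l n) * Re (J n) / (2 * pi) * (sqrt (2 * pi) * (Q.B n / sqrt (S.V (R n) / S.V (rn n))))"
      unfolding BV ..
    also have "\<dots> = exp (d n * l n) * (Q.B n * Re (J n) * (sqrt (2 * pi) / (2 * pi))) / sqrt (S.V (R n) / S.V (rn n))"
      by simp
    also have "sqrt (2 * pi) / (2 * pi) = 1 / sqrt (2 * pi)"
      by (simp add: real_div_sqrt field_simps)
    finally show ?case by simp
  qed
  have "(\<lambda>n. exp (d n * l n) * (Re (Q.B n * J n) / sqrt (2 * pi)) / sqrt (S.V (R n) / S.V (rn n)))
      \<longlonglongrightarrow> exp 0 * (Re (complex_of_real (sqrt (2 * pi))) / sqrt (2 * pi)) / sqrt 1"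
    by (intro tendsto_intros small l_lim J V_rn) auto
  then have "(\<lambda>n. exp (d n * l n) * (Re (Q.B n * J n) / sqrt (2 * pi)) / sqrt (S.V (R n) / S.V (rn n))) \<longlonglongrightarrow> 1"
    by simp
  then have "(\<lambda>n. ?p n / ?q n) \<longlonglongrightarrow> 1" using main by (rule Lim_transform_eventually)
  then show ?thesis by (rule asymp_equivI')
qed

end
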